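(* Let $m,m'\in\mathbb Z\setminus\{0\}$, $\xi\in\mathbb Z_m$, $\xi'\in\mathbb Z_{m'}$. Then $\overline{BS}(m,\xi)$ and $\overline{BS}(m',\xi')$ are isomorphic as abstract groups if and only if there exist $\epsilon\in\{1,-1\}$ and a positive integer $d$ such that $m=\epsilon m'$, $d=\gcd(m,\xi)=\gcd(m',\xi')$, and the $m$-adic integers $\xi/d$ and $\epsilon\xi'/d$ have the same image under the canonical map $\mathbb Z_m\to\mathbb Z_{m/d}$. (Equivalently, for $m,m'>0$: $\widetilde{BS}(m,\xi)\cong\widetilde{BS}(m',\xi')$ iff $m=m'$ and $r_i(\xi)=r_i(\xi')$ for all $i\ge1$.)
   Context: $\mathbb Z_m$ is the ring of $m$-adic integers (note $\mathbb Z_m=\mathbb Z_{-m}$). For $n\in\mathbb Z,\xi\in\mathbb Z_m$, $\gcd(n,\xi)$ is the positive integer $d$ with $n\mathbb Z_m+\xi\mathbb Z_m=d\mathbb Z_m$; $\xi/d$ is well defined. For $p,q\in\mathbb Z\setminus\{0\}$, $BS(p,q)=\langle a,b\mid ab^pa^{-1}=b^q\rangle$, marked by $(a,b)$. $\mathcal G_2$ is the space of normal subgroups of $\mathbb F(a,b)$ with the ultrametric $d(N_1,N_2)=e^{-\lambda}$, $\lambda$ the minimal word length of an element of $N_1\triangle N_2$. $\overline{BS}(m,\xi)$ is the limit in $\mathcal G_2$ of $BS(m,\xi_n)$ for any sequence of integers $(\xi_n)$ with $|\xi_n|\to\infty$, $\xi_n\to\xi$ in $\mathbb Z_m$ (exists,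 independent of the sequence). The functions $r_i$: $r_0(\xi)=0$, $s_0(\xi)=1$, and for $i\ge1$, $r_i(\xi)\in\{0,\dots,|m|-1\}$, $s_i(\xi)\in\mathbb Z_m$ unique with $\xi s_{i-1}(\xi)=ms_i(\xi)+r_i(\xi)$. $\widetilde{BS}(m,\xi)=\langle E,a\mid axa^{-1}=\phi(x)\ \forall x\in E_{m,\xi}\rangle$ where $E$ is free abelian on $e_0,e_1,\dots$, $E_{m,\xi}$ has basis $me_0,\ e_i-r_i(\xi)e_0$ ($i\ge1$), and $\phi(me_0)=e_1$, $\phi(e_i-r_i(\xi)e_0)=e_{i+1}$. *)

theory Defs
  imports "HOL-Algebra.Algebra"
begin

text \<open>The ring of m-adic integers Z_m = lim Z/|m|^j Z, represented as compatible
sequences of residues x j in [0, |m|^j).  Note Z_m = Z_{-m} literally.\<close>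

definition Zadic :: "int \<Rightarrow> (nat \<Rightarrow> int) set" where
  "Zadic m = {x. \<forall>j. 0 \<le> x j \<and> x j < \<bar>m\<bar> ^ j \<and> x (Suc j) mod (\<bar>m\<bar> ^ j) = x j}"

definition adic_of_int :: "int \<Rightarrow> int \<Rightarrow> (nat \<Rightarrow> int)" where
  "adic_of_int m k = (\<lambda>j. k mod (\<bar>m\<bar> ^ j))"

definition adic_add :: "int \<Rightarrow> (nat \<Rightarrow> int) \<Rightarrow> (nat \<Rightarrow> int) \<Rightarrow> (nat \<Rightarrow> int)" where
  "adic_add m x y = (\<lambda>j. (x j + y j) mod (\<bar>m\<bar> ^ j))"

definition adic_mul :: "int \<Rightarrow> (nat \<Rightarrow> int) \<Rightarrow> (nat \<Rightarrow> int) \<Rightarrow> (nat \<Rightarrow> int)" where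
  "adic_mul m x y = (\<lambda>j. (x j * y j) mod (\<bar>m\<bar> ^ j))"

definition adic_smul :: "int \<Rightarrow> int \<Rightarrow> (nat \<Rightarrow> int) \<Rightarrow> (nat \<Rightarrow> int)" where
  "adic_smul m c x = adic_mul m (adic_of_int m c) x"

definition adic_gcd :: "int \<Rightarrow> int \<Rightarrow> (nat \<Rightarrow> int) \<Rightarrow> int" where
  "adic_gcd m n \<xi> = (THE d. d > 0 \<and> d dvd n \<and>
     {adic_add m (adic_smul m n x) (adic_mul m \<xi> y) | x y. x \<in> Zadic m \<and> y \<in> Zadic m}
     = {adic_smul m d z | z. z \<in> Zadic m})"

definition adic_div :: "int \<Rightarrow> (nat \<Rightarrow> int) \<Rightarrow> int \<Rightarrow> (nat \<Rightarrow> int)" where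
  "adic_div m \<xi> d = (THE \<eta>. \<eta> \<in> Zadic m \<and> adic_smul m d \<eta> = \<xi>)"

text \<open>Canonical map Z_m \<rightarrow> Z_k for k dividing m: reduce the level-j residue mod |k|^j.\<close>
definition adic_proj :: "int \<Rightarrow> (nat \<Rightarrow> int) \<Rightarrow> (nat \<Rightarrow> int)" where
  "adic_proj k x = (\<lambda>j. x j mod (\<bar>k\<bar> ^ j))"

definition adic_tendsto :: "int \<Rightarrow> (nat \<Rightarrow> int) \<Rightarrow> (nat \<Rightarrow> int) \<Rightarrow> bool" where
  "adic_tendsto m s \<xi> = (\<forall>j. \<exists>n0. \<forall>n\<ge>n0. s n mod (\<bar>m\<bar> ^ j) = \<xi> j)"

text \<open>Letters: (generator, inverted); generator False = a, True = b.\<close>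
type_synonym letter = "bool \<times> bool"

definition inv_letter :: "letter \<Rightarrow> letter" where
  "inv_letter l = (fst l, \<not> snd l)"

fun reduced :: "letter list \<Rightarrow> bool" where
  "reduced [] = True"
| "reduced [x] = True"
| "reduced (x # y # w) = (y \<noteq> inv_letter x \<and> reduced (y # w))"

definition cons_red :: "letter \<Rightarrow> letter list \<Rightarrow> letter list" where
  "cons_red l w = (case w of [] \<Rightarrow> [l] | h # t \<Rightarrow> (if h = inv_letter l then t else l # w))"

definition reduce :: "letter list \<Rightarrow> letter list" where
  "reduce w = foldr cons_red w []"

definition FG :: "letter list monoid" where
  "FG = \<lparr>carrier = {w. reduced w}, monoid.mult = (\<lambda>x y. reduce (x @ y)), monoid.one = []\<rparr>"

definition gen_a :: "letter list" where "gen_a = [(False, False)]"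
definition gen_b :: "letter list" where "gen_b = [(True, False)]"

definition BS_rel :: "int \<Rightarrow> int \<Rightarrow> letter list" where
  "BS_rel p q = gen_a \<otimes>\<^bsub>FG\<^esub> (gen_b [^]\<^bsub>FG\<^esub> p) \<otimes>\<^bsub>FG\<^esub> inv\<^bsub>FG\<^esub> gen_a
                \<otimes>\<^bsub>FG\<^esub> inv\<^bsub>FG\<^esub> (gen_b [^]\<^bsub>FG\<^esub> q)"

text \<open>The kernel of F(a,b) \<rightarrow> BS(p,q): normal closure of the relator.\<close>
definition BSN :: "int \<Rightarrow> int \<Rightarrow> letter list set" where
  "BSN p q = \<Inter> {N. N \<lhd> FG \<and> BS_rel p q \<in> N}"

text \<open>Convergence in the space G_2 (ultrametric d = e^-lambda, lambda = minimal length
of a reduced word in the symmetric difference).\<close>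
definition G2_tendsto :: "(nat \<Rightarrow> letter list set) \<Rightarrow> letter list set \<Rightarrow> bool" where
  "G2_tendsto Ns N = (\<forall>L::nat. \<exists>n0. \<forall>n\<ge>n0. \<forall>w \<in> carrier FG.
      length w \<le> L \<longrightarrow> (w \<in> Ns n \<longleftrightarrow> w \<in> N))"

definition BSbar :: "int \<Rightarrow> (nat \<Rightarrow> int) \<Rightarrow> letter list set" where
  "BSbar m \<xi> = (THE N. N \<lhd> FG \<and>
     (\<forall>s :: nat \<Rightarrow> int. filterlim (\<lambda>n. \<bar>s n\<bar>) at_top sequentially \<and> adic_tendsto m s \<xi>
        \<longrightarrow> G2_tendsto (\<lambda>n. BSN m (s n)) N))"

end

theory Submission
  imports Defs "HOL-Computational_Algebra.Polynomial" "HOL-Library.Centered_Division"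
begin

text \<open>For \<open>m > 0\<close> the limit group is the HNN extension of \<open>E = \<int>[X]\<close> (with \<open>e\<^sub>i = X\<^sup>i\<close>) by
\<open>\<phi> : E\<^bsub>m,\<xi>\<^esub> \<rightarrow> X\<int>[X]\<close>: the normal forms of \<open>BS(m,\<xi>\<^sub>n)\<close> are eventually the images of those of
this extension under \<open>e\<^sub>0 \<mapsto> 1\<close>, \<open>e\<^sub>i \<mapsto> \<xi>\<^sub>n s\<^bsub>i-1\<^esub>(\<xi>\<^sub>n)\<close>.  So the limit only depends on \<open>m\<close> and the
digits \<open>r\<^sub>i\<close>, and comparing digits is elementary arithmetic.

Conversely let \<open>f\<close> be an isomorphism between two such groups.  In the Bass-Serre tree of the target,
with its height function coming from the exponent sum of \<open>a\<close>, the element \<open>f(b)\<close> preserves heights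
and fixes a vertex, because \<open>f(a b\<^sup>m a\<^sup>-\<^sup>1)\<close> commutes with it.  After conjugation \<open>f(b)\<close> lies in \<open>E'\<close>;
as \<open>E\<close> is the centralizer of \<open>b\<close> for \<open>m \<ge> 2\<close>, \<open>f\<close> maps \<open>E\<close> onto \<open>E'\<close>.  Conjugation by an
element of height \<open>h\<close> acts on \<open>E'\<close> as a partial power \<open>\<phi>'\<^sup>h\<close>, which raises degrees by \<open>h\<close>.
Surjectivity forces \<open>f(e\<^sub>0) = \<plusminus> e\<^sub>0\<close> and \<open>f \<phi> = \<phi>' f\<close>, and then \<open>m\<close> and all \<open>r\<^sub>i\<close> can be read off.
The case \<open>m = 1\<close> is the one where elements of height zero commute.\<close>

section \<open>Reduced words and actions of the free group\<close>

lemma inv_letter_inv_letter [simp]: "inv_letter (inv_letter l) = l"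
  by (simp add: inv_letter_def)

lemma reduced_ConsD: "reduced (l # w) \<Longrightarrow> reduced w"
  by (cases w) auto

lemma reduced_cons_red: "reduced w \<Longrightarrow> reduced (cons_red l w)"
  by (cases w) (auto simp: cons_red_def dest: reduced_ConsD)

lemma cons_red_cancel: "reduced w \<Longrightarrow> cons_red l (cons_red (inv_letter l) w) = w"
  by (cases w rule: reduced.cases) (auto simp: cons_red_def)

definition word_inv :: "letter list \<Rightarrow> letter list" where
  "word_inv w = map inv_letter (rev w)"

lemma word_inv_word_inv [simp]: "word_inv (word_inv w) = w"
  by (simp add: word_inv_def rev_map comp_def)

locale letter_action =
  fixes S :: "'s set" and T :: "letter \<Rightarrow> 's \<Rightarrow> 's"
  assumes T_closed: "s \<in> S \<Longrightarrow> T l s \<in> S"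
    and T_cancel: "s \<in> S \<Longrightarrow> T l (T (inv_letter l) s) = s"
begin

lemma foldr_closed: "s \<in> S \<Longrightarrow> foldr T w s \<in> S"
  by (induction w) (auto intro: T_closed)

lemma foldr_cons_red:
  assumes "s \<in> S"
  shows "foldr T (cons_red l w) s = T l (foldr T w s)"
proof (cases w)
  case (Cons h t)
  then show ?thesis using T_cancel[OF foldr_closed[OF assms, of t]] by (auto simp: cons_red_def)
qed (simp add: cons_red_def)

lemma foldr_reduce: "s \<in> S \<Longrightarrow> foldr T (reduce w) s = foldr T w s"
  by (induction w) (simp_all add: reduce_def foldr_cons_red)

lemma foldr_word_inv: "s \<in> S \<Longrightarrow> foldr T (word_inv w) (foldr T w s) = s"
proof (induction w)
  case (Cons l w)
  then show ?case
    using T_cancel[OF foldr_closed, of s "inv_letter l" w] by (simp add: word_inv_def)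
qed (simp add: word_inv_def)

end

interpretation cons_red: letter_action "{w. reduced w}" cons_red
  by unfold_locales (simp_all add: reduced_cons_red cons_red_cancel)

lemma reduced_reduce: "reduced (reduce w)"
  using cons_red.foldr_closed[of "[]" w] by (simp add: reduce_def)

lemma reduce_id: "reduced w \<Longrightarrow> reduce w = w"
proof (induction w)
  case (Cons l w)
  then show ?case
    by (cases w) (auto simp: reduce_def cons_red_def dest: reduced_ConsD)
qed (simp add: reduce_def)

lemma reduce_append_left: "reduce (reduce u @ w) = reduce (u @ w)"
  using cons_red.foldr_reduce[of "reduce w" u] reduced_reduce[of w] by (simp add: reduce_def)

lemma reduce_append_right: "reduce (u @ reduce w) = reduce (u @ w)"
  using reduce_id[OF reduced_reduce, of w] by (simp add: reduce_def)

lemma reduce_word_inv: "reduce (word_inv w @ w) = []"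
  using cons_red.foldr_word_inv[of "[]" w] by (simp add: reduce_def)

lemma carrier_FG [simp]: "w \<in> carrier FG \<longleftrightarrow> reduced w"
  and mult_FG [simp]: "u \<otimes>\<^bsub>FG\<^esub> w = reduce (u @ w)"
  and one_FG [simp]: "\<one>\<^bsub>FG\<^esub> = []"
  by (simp_all add: FG_def)

lemma group_FG: "group FG"
proof (rule groupI)
  fix w assume "w \<in> carrier FG"
  show "\<exists>v\<in>carrier FG. v \<otimes>\<^bsub>FG\<^esub> w = \<one>\<^bsub>FG\<^esub>"
    by (rule bexI[of _ "reduce (word_inv w)"])
      (simp_all add: reduced_reduce reduce_append_left reduce_word_inv)
qed (simp_all add: reduced_reduce reduce_append_left reduce_append_right reduce_id)

interpretation FG: group FG by (rule group_FG)

lemma reduced_gen [simp]: "reduced gen_a" "reduced gen_b"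
  by (simp_all add: gen_a_def gen_b_def)

lemma inv_FG_generator: "inv\<^bsub>FG\<^esub> [(g, False)] = [(g, True)]"
  by (rule FG.inv_equality) (auto simp: reduce_def cons_red_def inv_letter_def)

lemma FG_hom_foldr:
  assumes "group_hom FG K p" "reduced w"
  shows "p w = foldr (\<lambda>l k. p [l] \<otimes>\<^bsub>K\<^esub> k) w \<one>\<^bsub>K\<^esub>"
  using assms(2)
proof (induction w)
  case Nil
  show ?case using group_hom.hom_one[OF assms(1)] by simp
next
  case (Cons l w)
  have w: "reduced w" using Cons.prems by (rule reduced_ConsD)
  have "p (l # w) = p ([l] \<otimes>\<^bsub>FG\<^esub> w)" using reduce_id[OF Cons.prems] by simp
  also have "\<dots> = p [l] \<otimes>\<^bsub>K\<^esub> p w" using w by (intro group_hom.hom_mult[OF assms(1)]) simp_all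
  finally show ?case using Cons.IH[OF w] by simp
qed

definition act_group :: "(letter \<Rightarrow> 's \<Rightarrow> 's) \<Rightarrow> ('s \<Rightarrow> 's) monoid" where
  "act_group T = \<lparr>carrier = range (foldr T), monoid.mult = (\<circ>), monoid.one = id\<rparr>"

lemma act_group_simps [simp]:
  "carrier (act_group T) = range (foldr T)"
  "g \<otimes>\<^bsub>act_group T\<^esub> h = g \<circ> h"
  "\<one>\<^bsub>act_group T\<^esub> = id"
  by (simp_all add: act_group_def)

locale letter_permutation =
  fixes T :: "letter \<Rightarrow> 's \<Rightarrow> 's"
  assumes T_inv_letter: "T l (T (inv_letter l) s) = s"
begin

sublocale letter_action UNIV T
  by unfold_locales (simp_all add: T_inv_letter)

abbreviation G :: "('s \<Rightarrow> 's) set" where "G \<equiv> range (foldr T)"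

lemma G_comp: "g \<in> G \<Longrightarrow> h \<in> G \<Longrightarrow> g \<circ> h \<in> G"
  by (auto simp: image_iff) (metis comp_apply ext foldr_append)

lemma G_id: "id \<in> G"
  using foldr.simps(1)[of T] by (metis rangeI)

lemma G_funpow: "g \<in> G \<Longrightarrow> g ^^ n \<in> G"
proof (induction n)
  case 0
  show ?case unfolding funpow.simps by (rule G_id)
next
  case (Suc n)
  then show ?case unfolding funpow.simps by (intro G_comp)
qed

lemma G_letter: "T l \<in> G"
  by (rule range_eqI[of _ _ "[l]"]) simp

abbreviation perm_inv :: "('s \<Rightarrow> 's) \<Rightarrow> 's \<Rightarrow> 's" where "perm_inv \<equiv> inv_into UNIV"

lemma foldr_word_inv_eq: "foldr T (word_inv w) = perm_inv (foldr T w)"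
proof (rule inv_unique_comp[symmetric])
  show "foldr T (word_inv w) \<circ> foldr T w = id"
    by (simp add: fun_eq_iff foldr_word_inv)
  show "foldr T w \<circ> foldr T (word_inv w) = id"
    using foldr_word_inv[of _ "word_inv w"] by (simp add: fun_eq_iff)
qed

lemma G_inv: "g \<in> G \<Longrightarrow> perm_inv g \<in> G"
  by (auto simp flip: foldr_word_inv_eq)

lemma foldr_mult: "foldr T (u \<otimes>\<^bsub>FG\<^esub> w) = foldr T u \<circ> foldr T w"
  by (simp add: fun_eq_iff foldr_reduce)

lemma foldr_inv:
  assumes "u \<in> carrier FG"
  shows "foldr T (inv\<^bsub>FG\<^esub> u) = perm_inv (foldr T u)"
proof (rule inv_unique_comp[symmetric])
  show "foldr T (inv\<^bsub>FG\<^esub> u) \<circ> foldr T u = id"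
    unfolding foldr_mult[symmetric] FG.l_inv[OF assms] by simp
  show "foldr T u \<circ> foldr T (inv\<^bsub>FG\<^esub> u) = id"
    unfolding foldr_mult[symmetric] FG.r_inv[OF assms] by simp
qed

lemma bij_G: "g \<in> G \<Longrightarrow> bij g"
proof -
  have "bij (foldr T w)" for w
    by (rule o_bij[of "foldr T (word_inv w)"])
      (use foldr_word_inv foldr_word_inv[of _ "word_inv w"] in \<open>simp_all add: fun_eq_iff\<close>)
  then show "g \<in> G \<Longrightarrow> bij g" by blast
qed

lemma G_inv_comp: "g \<in> G \<Longrightarrow> perm_inv g \<circ> g = id" and G_comp_inv: "g \<in> G \<Longrightarrow> g \<circ> perm_inv g = id"
  using bij_G by (auto simp: bij_def surj_iff)

lemma conj_comp:
  assumes "h \<in> G"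
  shows "(perm_inv h \<circ> f \<circ> h) \<circ> (perm_inv h \<circ> g \<circ> h) = perm_inv h \<circ> (f \<circ> g) \<circ> h"
proof -
  have "(perm_inv h \<circ> f \<circ> h) \<circ> (perm_inv h \<circ> g \<circ> h) = perm_inv h \<circ> f \<circ> (h \<circ> perm_inv h) \<circ> g \<circ> h"
    by (simp only: comp_assoc)
  then show ?thesis unfolding G_comp_inv[OF assms] comp_id by (simp only: comp_assoc)
qed

lemma G_induct [consumes 1, case_names id letter]:
  assumes "g \<in> G" "P id" "\<And>l g. g \<in> G \<Longrightarrow> P g \<Longrightarrow> P (T l \<circ> g)"
  shows "P g"
proof -
  have "P (foldr T w)" for w
  proof (induction w)
    case (Cons l w)
    then show ?case unfolding foldr.simps by (intro assms(3) rangeI)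
  qed (simp only: foldr.simps assms(2))
  then show ?thesis using assms(1) by blast
qed

lemma group_act_group: "group (act_group T)"
proof (rule groupI)
  show "\<one>\<^bsub>act_group T\<^esub> \<in> carrier (act_group T)" using G_id by simp
  show "\<exists>h\<in>carrier (act_group T). h \<otimes>\<^bsub>act_group T\<^esub> g = \<one>\<^bsub>act_group T\<^esub>"
    if "g \<in> carrier (act_group T)" for g
    using that G_inv G_inv_comp by (metis act_group_simps)
qed (auto simp: comp_assoc intro: G_comp)

lemma group_hom_foldr: "group_hom FG (act_group T) (foldr T)"
  by (rule group_hom.intro[OF group_FG group_act_group], unfold_locales)
    (auto simp: hom_def foldr_reduce)

definition act_kernel :: "letter list set" where
  "act_kernel = {w. reduced w \<and> foldr T w = id}"

lemma act_kernel_eq: "act_kernel = kernel FG (act_group T) (foldr T)"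
  by (simp add: act_kernel_def kernel_def)

lemma normal_act_kernel: "act_kernel \<lhd> FG"
  unfolding act_kernel_eq by (rule group_hom.normal_kernel[OF group_hom_foldr])

lemma FG_Mod_act_kernel: "FG Mod act_kernel \<cong> act_group T"
proof -
  have "foldr T w = foldr T (reduce w)" for w
    by (simp add: fun_eq_iff foldr_reduce)
  then have "foldr T ` carrier FG = carrier (act_group T)"
    using reduced_reduce by (fastforce simp only: act_group_simps carrier_FG image_iff Bex_def)
  then show ?thesis unfolding act_kernel_eq
    by (rule group_hom.FactGroup_iso[OF group_hom_foldr])
qed

end

section \<open>Trees\<close>

locale graph =
  fixes V :: "'v set" and adj :: "'v \<Rightarrow> 'v \<Rightarrow> bool"
  assumes adj_sym: "adj u v \<Longrightarrow> adj v u"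
    and adj_V: "adj u v \<Longrightarrow> u \<in> V"
begin

fun reduced_path :: "'v list \<Rightarrow> bool" where
  "reduced_path [] \<longleftrightarrow> False"
| "reduced_path [u] \<longleftrightarrow> u \<in> V"
| "reduced_path (u # v # p) \<longleftrightarrow> adj u v \<and> reduced_path (v # p) \<and> (p = [] \<or> hd p \<noteq> u)"

lemma reduced_path_not_Nil: "reduced_path p \<Longrightarrow> p \<noteq> []" by auto

lemma reduced_path_set: "reduced_path p \<Longrightarrow> set p \<subseteq> V"
  by (induction p rule: reduced_path.induct) (auto dest: adj_V adj_sym)

lemma reduced_path_overlap:
  "reduced_path (p @ u # v # q) \<longleftrightarrow> reduced_path (p @ [u, v]) \<and> reduced_path (u # v # q)"
proof (induction p)
  case Nil
  show ?case using adj_V adj_sym by auto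
next
  case (Cons x p)
  then show ?case
    by (cases p; cases "tl p") (auto simp: adj_V)
qed

lemma reduced_path_appendD2: "reduced_path (p @ q) \<Longrightarrow> q \<noteq> [] \<Longrightarrow> reduced_path q"
proof (induction p)
  case (Cons u p)
  then show ?case by (cases "p @ q") auto
qed simp

lemma reduced_path_rev: "reduced_path (rev p) \<longleftrightarrow> reduced_path p"
proof -
  have "reduced_path p \<Longrightarrow> reduced_path (rev p)" for p
  proof (induction p rule: reduced_path.induct)
    case (3 u v q)
    show ?case
    proof (cases q)
      case Nil
      then show ?thesis using 3 adj_sym adj_V by auto
    next
      case (Cons w q')
      have "reduced_path (rev q' @ [w, v])" "reduced_path [w, v, u]"
        using 3 Cons adj_sym adj_V by (auto split: if_splits)
      then show ?thesis using Cons reduced_path_overlap[of "rev q'" w v "[u]"] by simp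
    qed
  qed auto
  from this[of p] this[of "rev p"] show ?thesis by auto
qed

lemma reduced_path_appendD1: "reduced_path (p @ q) \<Longrightarrow> p \<noteq> [] \<Longrightarrow> reduced_path p"
  using reduced_path_appendD2[of "rev q" "rev p"] by (simp add: reduced_path_rev flip: rev_append)

lemma ex_reduced_path:
  assumes "adj\<^sup>*\<^sup>* u v" "v \<in> V"
  shows "\<exists>p. reduced_path p \<and> hd p = u \<and> last p = v"
  using assms(1)
proof (induction rule: converse_rtranclp_induct)
  case base
  show ?case by (rule exI[of _ "[v]"]) (use assms in auto)
next
  case (step u w)
  then obtain q where q: "reduced_path (w # q)" "last (w # q) = v"
    by (metis list.exhaust_sel reduced_path_not_Nil)
  show ?case
  proof (cases "q \<noteq> [] \<and> hd q = u")
    case True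
    then have "reduced_path q" using q(1) reduced_path_appendD2[of "[w]" q] by simp
    then show ?thesis using True q(2) by auto
  next
    case False
    then have "reduced_path (u # w # q)" using step.hyps(1) q(1) by auto
    then show ?thesis using q(2) by (intro exI[of _ "u # w # q"]) simp
  qed
qed

end

locale tree = graph V adj for V :: "'v set" and adj +
  assumes connected: "u \<in> V \<Longrightarrow> v \<in> V \<Longrightarrow> adj\<^sup>*\<^sup>* u v"
    and acyclic: "reduced_path p \<Longrightarrow> hd p = last p \<Longrightarrow> length p = 1"
begin

lemma reduced_path_unique:
  assumes "reduced_path p" "reduced_path q" "hd p = hd q" "last p = last q"
  shows "p = q"
  using assms
proof (induction p arbitrary: q rule: reduced_path.induct)
  case (2 u)
  then show ?case using acyclic[of q] by (cases q) auto
next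
  case (3 u v p)
  obtain q' where q: "q = u # q'" using 3 by (cases q) auto
  show ?case
  proof (cases q')
    case Nil
    then show ?thesis using 3 acyclic[of "u # v # p"] q by auto
  next
    case (Cons w q'')
    show ?thesis
    proof (cases "v = w")
      case True
      then show ?thesis using 3(1)[of q'] 3(2-) q Cons by simp
    next
      case False
      have "reduced_path (rev p @ [v, u])" using 3(2) reduced_path_rev[of "u # v # p"] by simp
      moreover have "reduced_path (v # u # w # q'')" using 3 q Cons False adj_sym by auto
      ultimately have "reduced_path (rev p @ v # u # w # q'')" using reduced_path_overlap by blast
      moreover have "hd (rev p @ v # u # w # q'') = last (rev p @ v # u # w # q'')"
        using 3(5) q Cons by (simp add: hd_append hd_rev last_rev split: if_splits)
      ultimately show ?thesis using acyclic by fastforce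
    qed
  qed
qed auto

definition geodesic :: "'v \<Rightarrow> 'v \<Rightarrow> 'v list" where
  "geodesic u v = (THE p. reduced_path p \<and> hd p = u \<and> last p = v)"

lemma geodesicI: "reduced_path p \<Longrightarrow> hd p = u \<Longrightarrow> last p = v \<Longrightarrow> geodesic u v = p"
  unfolding geodesic_def by (rule the_equality) (auto intro: reduced_path_unique)

lemma geodesic:
  assumes "u \<in> V" "v \<in> V"
  shows "reduced_path (geodesic u v)" "hd (geodesic u v) = u" "last (geodesic u v) = v"
    "geodesic u v \<noteq> []"
proof -
  obtain p where "reduced_path p" "hd p = u" "last p = v"
    using ex_reduced_path[OF connected[OF assms] assms(2)] by auto
  then show "reduced_path (geodesic u v)" "hd (geodesic u v) = u" "last (geodesic u v) = v"
    "geodesic u v \<noteq> []"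
    using geodesicI[of p u v] by auto
qed

lemma geodesic_rev: "u \<in> V \<Longrightarrow> v \<in> V \<Longrightarrow> geodesic v u = rev (geodesic u v)"
  by (rule geodesicI) (auto simp: reduced_path_rev geodesic hd_rev last_rev)

lemma geodesic_self: "u \<in> V \<Longrightarrow> geodesic u u = [u]"
  by (rule geodesicI) auto

lemma geodesic_ConsE:
  assumes "u \<in> V" "v \<in> V" "u \<noteq> v"
  obtains w p where "geodesic u v = u # w # p" "adj u w"
proof -
  note uv = geodesic[OF assms(1,2)]
  obtain p where p: "geodesic u v = u # p" using uv by (cases "geodesic u v") auto
  then obtain w q where "p = w # q" using uv assms(3) by (cases p) auto
  then show ?thesis using that p uv(1) by simp
qed

lemma geodesic_snocE:
  assumes "u \<in> V" "v \<in> V" "u \<noteq> v"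
  obtains p w where "geodesic u v = p @ [w, v]"
proof -
  obtain w p where "geodesic v u = v # w # p" using geodesic_ConsE assms by metis
  then have "geodesic u v = rev p @ [w, v]" using geodesic_rev[of v u] assms by simp
  then show ?thesis by (rule that)
qed

lemma geodesic_tl:
  assumes "u \<in> V" "v \<in> V" "geodesic u v = u # w # p"
  shows "geodesic w v = w # p"
  by (rule geodesicI) (use geodesic[OF assms(1,2)] assms(3) in auto)

lemma geodesic_adj_left:
  assumes "adj u w" "v \<in> V"
  shows "geodesic u v = u # geodesic w v \<or> geodesic w v = w # geodesic u v"
proof -
  have w: "w \<in> V" using assms adj_sym adj_V by blast
  then obtain q where q: "geodesic w v = w # q" using geodesic[OF w assms(2)]
    by (cases "geodesic w v") auto
  note wv = geodesic[OF w assms(2), unfolded q]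
  show ?thesis
  proof (cases "q \<noteq> [] \<and> hd q = u")
    case True
    then have "geodesic u v = q"
      using wv(1,3) reduced_path_appendD2[of "[w]" q] by (intro geodesicI) auto
    then show ?thesis using q by simp
  next
    case False
    then have "geodesic u v = u # w # q"
      using wv assms(1) by (intro geodesicI) auto
    then show ?thesis using q by simp
  qed
qed

lemma geodesic_adj_right:
  assumes "adj u w" "v \<in> V"
  shows "geodesic v u = geodesic v w @ [u] \<or> geodesic v w = geodesic v u @ [w]"
proof -
  have "u \<in> V" "w \<in> V" using assms(1) adj_V adj_sym by blast+
  then show ?thesis
    using geodesic_adj_left[OF assms] geodesic_rev[of v u] geodesic_rev[of v w] assms(2) by auto
qed

lemma geodesic_move_start:
  assumes "reduced_path (w # ws)" "v \<in> V" "geodesic w v = p @ z # q" "length ws < length p"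
  shows "\<exists>p'. geodesic (last (w # ws)) v = p' @ z # q"
  using assms
proof (induction ws arbitrary: w p)
  case (Cons w' ws)
  have adj: "adj w w'" and red: "reduced_path (w' # ws)" using Cons.prems(1) by auto
  from geodesic_adj_left[OF adj Cons.prems(2)]
  obtain p' where "geodesic w' v = p' @ z # q" "length ws < length p'"
  proof
    assume "geodesic w v = w # geodesic w' v"
    then show thesis using Cons.prems(3,4) by (cases p) (auto intro: that[OF sym])
  next
    assume "geodesic w' v = w' # geodesic w v"
    then show thesis using Cons.prems(3,4) that[of "w' # p"] by simp
  qed
  then show ?case using Cons.IH[OF red Cons.prems(2)] by simp
qed simp

lemma geodesic_middle:
  assumes V: "u \<in> V" "v \<in> V" "u' \<in> V" "v' \<in> V"
    and g: "geodesic u v = p @ z # q"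
    and u: "length (geodesic u u') \<le> length p" and v: "length (geodesic v v') \<le> length q"
  shows "z \<in> set (geodesic u' v')"
proof -
  have move: "\<exists>p'. geodesic w' v = p' @ z # q"
    if ends: "w \<in> V" "w' \<in> V" "v \<in> V" and g: "geodesic w v = p @ z # q"
      and short: "length (geodesic w w') \<le> length p" for w w' v p q
  proof -
    obtain ws where ws: "geodesic w w' = w # ws"
      using geodesic[OF ends(1,2)] by (cases "geodesic w w'") auto
    then show ?thesis
      using geodesic_move_start[of w ws v p z q] ends g short geodesic[OF ends(1,2)] by fastforce
  qed
  obtain p' where p': "geodesic u' v = p' @ z # q" using move[OF V(1,3,2) g u] by blast
  have "geodesic v u' = rev q @ z # rev p'" using p' geodesic_rev[of u' v] V by simp
  from move[OF V(2,4,3) this] v obtain q' where "geodesic v' u' = q' @ z # rev p'" by auto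
  then have "z \<in> set (geodesic v' u')" by simp
  then show ?thesis using geodesic_rev[of u' v'] V by simp
qed

definition embedding :: "('v \<Rightarrow> 'v) \<Rightarrow> bool" where
  "embedding x \<longleftrightarrow> (\<forall>u v. adj u v \<longrightarrow> adj (x u) (x v)) \<and> inj_on x V \<and> x ` V \<subseteq> V"

lemma embedding_adj: "embedding x \<Longrightarrow> adj u v \<Longrightarrow> adj (x u) (x v)"
  and embedding_V: "embedding x \<Longrightarrow> u \<in> V \<Longrightarrow> x u \<in> V"
  by (auto simp: embedding_def)

lemma embedding_comp:
  assumes "embedding x" "embedding y"
  shows "embedding (x \<circ> y)"
proof -
  have "inj_on (x \<circ> y) V"
    using assms by (intro comp_inj_on) (auto simp: embedding_def intro: inj_on_subset)
  then show ?thesis using assms by (fastforce simp: embedding_def)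
qed

lemma embedding_funpow: "embedding x \<Longrightarrow> embedding (x ^^ k)"
proof (induction k)
  case (Suc k)
  then show ?case using embedding_comp[of x "x ^^ k"] by (simp add: comp_def)
qed (simp add: embedding_def)

lemma embedding_reduced_path:
  assumes "embedding x" "reduced_path p"
  shows "reduced_path (map x p)"
  using assms(2)
proof (induction p rule: reduced_path.induct)
  case (3 u v p)
  have "p \<noteq> [] \<Longrightarrow> x (hd p) \<noteq> x u"
    using 3 assms(1) reduced_path_set[of "u # v # p"]
    by (cases p) (auto simp: embedding_def inj_on_def)
  then show ?case using 3 assms(1) by (auto simp: embedding_adj hd_map)
qed (use assms in \<open>auto simp: embedding_V\<close>)

lemma geodesic_image:
  "embedding x \<Longrightarrow> u \<in> V \<Longrightarrow> v \<in> V \<Longrightarrow> geodesic (x u) (x v) = map x (geodesic u v)"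
  by (rule geodesicI) (auto simp: embedding_reduced_path geodesic hd_map last_map)

definition displacement :: "('v \<Rightarrow> 'v) \<Rightarrow> 'v \<Rightarrow> nat" where
  "displacement x u = length (geodesic u (x u))"

text \<open>If \<open>x\<close> fixes a vertex, this is the set of its fixed vertices.\<close>

definition axis :: "('v \<Rightarrow> 'v) \<Rightarrow> 'v set" where
  "axis x = {u \<in> V. \<forall>w\<in>V. displacement x u \<le> displacement x w}"

lemma axis_V: "u \<in> axis x \<Longrightarrow> u \<in> V" by (simp add: axis_def)

lemma axis_nonempty: "V \<noteq> {} \<Longrightarrow> axis x \<noteq> {}"
  using ex_has_least_nat[of "\<lambda>u. u \<in> V" _ "displacement x"] by (fastforce simp: axis_def)

lemma axis_commute:
  assumes x: "embedding x" and y: "embedding y" and comm: "\<And>u. u \<in> V \<Longrightarrow> y (x u) = x (y u)"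
    and u: "u \<in> axis x"
  shows "y u \<in> axis x"
proof -
  have V: "u \<in> V" "x u \<in> V" using u axis_V embedding_V[OF x] by blast+
  then have "geodesic (y u) (x (y u)) = map y (geodesic u (x u))"
    using geodesic_image[OF y] comm by metis
  then show ?thesis using u embedding_V[OF y] by (auto simp: axis_def displacement_def)
qed

lemma displacement_increasing:
  assumes x: "embedding x" and V: "p \<in> V" "q \<in> V" and moved: "x p \<noteq> p"
    and pq: "geodesic p q = p # p1 # rest"
    and away: "reduced_path (p1 # geodesic p (x p) @ [x p1])"
  shows "displacement x p < displacement x q"
proof -
  have xp: "x p \<in> V" using embedding_V[OF x V(1)] .
  obtain v c where c: "geodesic p (x p) = p # v # c"
    using geodesic_ConsE[OF V(1) xp] moved by metis
  obtain d where d: "geodesic p (x p) = d @ [x p]"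
    using geodesic[OF V(1) xp] by (metis append_butlast_last_id)
  have "reduced_path (rev (p # p1 # rest))"
    using geodesic(1)[OF V] unfolding pq reduced_path_rev .
  then have "reduced_path (rev rest @ [p1, p])" by simp
  then have "reduced_path (rev rest @ p1 # p # (v # c) @ [x p1])"
    using away unfolding c reduced_path_overlap[of "rev rest" p1 p "(v # c) @ [x p1]"] by simp
  then have "reduced_path (rev rest @ p1 # geodesic p (x p) @ [x p1])" by (simp add: c)
  then have "reduced_path ((rev rest @ p1 # d) @ [x p, x p1])" by (simp add: d)
  moreover have "reduced_path (x p # x p1 # map x rest)"
    using embedding_reduced_path[OF x geodesic(1)[OF V]] pq by simp
  ultimately have "reduced_path ((rev rest @ p1 # d) @ x p # x p1 # map x rest)"
    using reduced_path_overlap by blast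
  then have "geodesic q (x q) = (rev rest @ p1 # d) @ x p # x p1 # map x rest"
  proof (rule geodesicI)
    have "last (p1 # rest) = q" using geodesic(3)[OF V] pq by simp
    then show "hd ((rev rest @ p1 # d) @ x p # x p1 # map x rest) = q"
      and "last ((rev rest @ p1 # d) @ x p # x p1 # map x rest) = x q"
      by (auto simp: hd_append hd_rev last_map split: if_splits)
  qed
  then show ?thesis by (simp add: displacement_def d)
qed

end

text \<open>The vertices of a rooted tree as the sequences of edges that lead to them from the root.\<close>

locale prefix_closed =
  fixes V :: "'a list set"
  assumes prefix_V: "u @ [s] \<in> V \<Longrightarrow> u \<in> V"
begin

definition adj :: "'a list \<Rightarrow> 'a list \<Rightarrow> bool" where
  "adj u v \<longleftrightarrow> u \<in> V \<and> v \<in> V \<and> (\<exists>s. v = u @ [s] \<or> u = v @ [s])"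

sublocale graph V adj
  by unfold_locales (auto simp: adj_def)

lemma connected_to_root: "u \<in> V \<Longrightarrow> adj\<^sup>*\<^sup>* u [] \<and> adj\<^sup>*\<^sup>* [] u"
proof (induction u rule: rev_induct)
  case (snoc s u)
  have "u \<in> V" using snoc.prems by (rule prefix_V)
  then have "adj u (u @ [s])" "adj (u @ [s]) u" using snoc.prems by (auto simp: adj_def)
  then show ?case using snoc.IH[OF \<open>u \<in> V\<close>]
    by (meson converse_rtranclp_into_rtranclp rtranclp.rtrancl_into_rtrancl)
qed simp

lemma reduced_path_descending:
  "reduced_path (u # (u @ [s]) # p) \<Longrightarrow> \<exists>t. last (u # (u @ [s]) # p) = u @ s # t"
proof (induction p arbitrary: u s)
  case (Cons w p)
  have "adj (u @ [s]) w" "w \<noteq> u" using Cons.prems by auto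
  then obtain s' where w: "w = (u @ [s]) @ [s']" by (auto simp: adj_def)
  have "reduced_path ((u @ [s]) # ((u @ [s]) @ [s']) # p)" using Cons.prems w by simp
  from Cons.IH[OF this] w show ?case by auto
qed simp

lemma reduced_path_closed_ascends:
  assumes "reduced_path (u # v # p)" "last (v # p) = u"
  shows "v = butlast u"
proof -
  have "v \<noteq> u @ [s]" for s
  proof
    assume v: "v = u @ [s]"
    then have "last (v # p) \<noteq> u"
      using reduced_path_descending[of u s p] assms(1) by auto
    then show False using assms(2) by simp
  qed
  moreover have "adj u v" using assms(1) by simp
  ultimately show ?thesis by (auto simp: adj_def)
qed

lemma reduced_path_acyclic: "reduced_path p \<Longrightarrow> hd p = last p \<Longrightarrow> length p = 1"
proof (induction p rule: length_induct)
  case (1 p)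
  show ?case
  proof (rule ccontr)
    assume "length p \<noteq> 1"
    then obtain u v q where p: "p = u # v # q" using "1.prems"
      by (cases p rule: reduced_path.cases) auto
    then have "adj u v" using "1.prems"(1) by simp
    then have "u \<noteq> v" by (auto simp: adj_def)
    moreover have "v # q = butlast (v # q) @ [u]"
      using append_butlast_last_id[of "v # q"] "1.prems"(2) p by simp
    ultimately obtain r where r: "v # q = r @ [u]" "r \<noteq> []" by (metis append_Nil list.sel(1))
    have red: "reduced_path (u # r @ [u])" using "1.prems"(1) p r(1) by simp
    then have "reduced_path (u # rev r @ [u])" using reduced_path_rev[of "u # r @ [u]"] by simp
    moreover have "hd l = butlast u" if "reduced_path (u # l @ [u])" "l \<noteq> []" for l
      using reduced_path_closed_ascends[of u "hd l" "tl l @ [u]"] that by (cases l) auto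
    ultimately have "hd r = butlast u" "last r = butlast u"
      using red r(2) hd_rev[of r] by fastforce+
    moreover have "reduced_path r"
      using red reduced_path_appendD2[of "[u]" "r @ [u]"] reduced_path_appendD1[of r "[u]"] r(2)
      by simp
    ultimately have "length r = 1" using "1.IH" p r by simp
    then obtain w where "r = [w]" by (cases r) auto
    then show False using red by simp
  qed
qed

sublocale tree V adj
proof
  show "adj\<^sup>*\<^sup>* u v" if "u \<in> V" "v \<in> V" for u v
    using connected_to_root[OF that(1)] connected_to_root[OF that(2)] by auto
qed (rule reduced_path_acyclic)

end

section \<open>Height-preserving automorphisms of trees\<close>

locale height_tree = tree V adj for V :: "'v set" and adj +
  fixes ht :: "'v \<Rightarrow> int"
  assumes ht_adj: "adj u v \<Longrightarrow> ht u \<noteq> ht v"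
begin

definition height_shift :: "int \<Rightarrow> ('v \<Rightarrow> 'v) \<Rightarrow> bool" where
  "height_shift c x \<longleftrightarrow> embedding x \<and> (\<forall>u\<in>V. ht (x u) = ht u + c)"

lemma height_shift_embedding: "height_shift c x \<Longrightarrow> embedding x"
  and height_shift_ht: "height_shift c x \<Longrightarrow> u \<in> V \<Longrightarrow> ht (x u) = ht u + c"
  by (auto simp: height_shift_def)

lemma height_shift_funpow:
  assumes "height_shift c x" shows "height_shift (int k * c) (x ^^ k)"
proof -
  have "ht ((x ^^ k) u) = ht u + int k * c" if "u \<in> V" for u
  proof (induction k)
    case (Suc k)
    have "(x ^^ k) u \<in> V"
      using embedding_V[OF embedding_funpow[OF height_shift_embedding[OF assms]] that] .
    then show ?case using Suc height_shift_ht[OF assms] by (simp add: distrib_right)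
  qed simp
  then show ?thesis
    using embedding_funpow[OF height_shift_embedding[OF assms]] by (simp add: height_shift_def)
qed

end

locale hyperbolic = height_tree V adj ht
  for V :: "'v set" and adj ht +
  fixes x
  assumes shift: "height_shift 0 x" and no_fixed_vertex: "u \<in> V \<Longrightarrow> x u \<noteq> u"
begin

lemma embedding: "embedding x" by (rule height_shift_embedding[OF shift])

lemma ht_preserved: "u \<in> V \<Longrightarrow> ht (x u) = ht u"
  using height_shift_ht[OF shift] by simp

lemma x_V: "u \<in> V \<Longrightarrow> x u \<in> V"
  by (rule embedding_V[OF embedding])

lemma funpow_V: "u \<in> V \<Longrightarrow> (x ^^ k) u \<in> V"
  by (rule embedding_V[OF embedding_funpow[OF embedding]])

text \<open>Otherwise the geodesic from \<open>q\<close> back to \<open>p\<close>, on to \<open>x p\<close> and then to \<open>x q\<close> would be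
reduced, and \<open>q\<close> would be moved further than \<open>p\<close>.\<close>

lemma axis_geodesic_meets:
  assumes p: "p \<in> axis x" and q: "q \<in> axis x" and pq: "geodesic p q = p # p1 # rest"
  shows "geodesic p (x p) = p # geodesic p1 (x p) \<or> geodesic p (x p) = geodesic p (x p1) @ [x p]"
proof (rule ccontr)
  assume neg: "\<not> ?thesis"
  have V: "p \<in> V" "q \<in> V" "x p \<in> V" using p q axis_V x_V by auto
  have adj: "adj p p1" using geodesic(1)[OF V(1,2)] pq by simp
  then have p1: "p1 \<in> V" "x p1 \<in> V" "adj (x p) (x p1)"
    using adj_V adj_sym x_V embedding_adj[OF embedding] by blast+
  have "geodesic p1 (x p) = p1 # geodesic p (x p)" "geodesic p (x p1) = geodesic p (x p) @ [x p1]"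
    using neg geodesic_adj_left[OF adj V(3)] geodesic_adj_right[OF p1(3) V(1)] by auto
  then have red: "reduced_path (p1 # geodesic p (x p))" "reduced_path (geodesic p (x p) @ [x p1])"
    using geodesic(1)[OF p1(1) V(3)] geodesic(1)[OF V(1) p1(2)] by simp_all
  obtain c d where c: "geodesic p (x p) = c @ [d, x p]"
    using geodesic_snocE[OF V(1,3)] no_fixed_vertex[OF V(1)] by metis
  then have "reduced_path (d # x p # [x p1])"
    using red(2) reduced_path_overlap[of c d "x p" "[x p1]"] by simp
  then have "reduced_path (p1 # geodesic p (x p) @ [x p1])"
    using red(1) reduced_path_overlap[of "p1 # c" d "x p" "[x p1]"] by (simp add: c)
  then have "displacement x p < displacement x q"
    using displacement_increasing[OF embedding V(1,2) no_fixed_vertex[OF V(1)] pq] by blast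
  then show False using q V(1) by (auto simp: axis_def)
qed

lemma neighbour_displacement:
  assumes adj: "adj p p1"
    and meets: "geodesic p (x p) = p # geodesic p1 (x p) \<or>
      geodesic p (x p) = geodesic p (x p1) @ [x p]"
  shows "displacement x p1 \<le> displacement x p"
    and "ht ` set (geodesic p1 (x p1)) \<subseteq> ht ` set (geodesic p (x p))"
proof -
  have V: "p \<in> V" "p1 \<in> V" "x p1 \<in> V" "x p \<in> V"
    using adj adj_V adj_sym x_V by blast+
  have axp: "adj (x p) (x p1)" by (rule embedding_adj[OF embedding adj])
  have ht: "ht (x p1) = ht p1" by (rule ht_preserved[OF V(2)])
  have "displacement x p1 \<le> displacement x p \<and>
    ht ` set (geodesic p1 (x p1)) \<subseteq> ht ` set (geodesic p (x p))"
    using meets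
  proof
    assume left: "geodesic p (x p) = p # geodesic p1 (x p)"
    have "p1 \<in> set (geodesic p1 (x p))" using geodesic[OF V(2,4)] by (metis list.set_sel(1))
    then show ?thesis
      using geodesic_adj_right[OF axp V(2)] left ht by (auto simp: displacement_def)
  next
    assume right: "geodesic p (x p) = geodesic p (x p1) @ [x p]"
    have "x p1 \<in> set (geodesic p (x p1))" using geodesic[OF V(1,3)] by (metis last_in_set)
    then have "ht p1 \<in> ht ` set (geodesic p (x p1))" using ht by (metis imageI)
    then show ?thesis
      using geodesic_adj_left[OF adj V(3)] right by (auto simp: displacement_def)
  qed
  then show "displacement x p1 \<le> displacement x p"
    and "ht ` set (geodesic p1 (x p1)) \<subseteq> ht ` set (geodesic p (x p))" by auto
qed

lemma axis_step:
  assumes "p \<in> axis x" "q \<in> axis x" "geodesic p q = p # p1 # rest"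
  shows "p1 \<in> axis x" "ht ` set (geodesic p1 (x p1)) \<subseteq> ht ` set (geodesic p (x p))"
proof -
  have adj: "adj p p1" using geodesic(1)[of p q] assms axis_V by simp
  then have "p1 \<in> V" using adj_V adj_sym by blast
  then show "p1 \<in> axis x"
    using neighbour_displacement(1)[OF adj axis_geodesic_meets[OF assms]] assms(1)
    by (auto simp: axis_def intro: order_trans)
  show "ht ` set (geodesic p1 (x p1)) \<subseteq> ht ` set (geodesic p (x p))"
    by (rule neighbour_displacement(2)[OF adj axis_geodesic_meets[OF assms]])
qed

lemma
  assumes "p \<in> axis x" "q \<in> axis x"
  shows axis_convex: "set (geodesic p q) \<subseteq> axis x"
    and axis_height_in_translate: "ht q \<in> ht ` set (geodesic p (x p))"
proof -
  have "set (geodesic p q) \<subseteq> axis x \<and> ht q \<in> ht ` set (geodesic p (x p))"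
    using assms(1)
  proof (induction "length (geodesic p q)" arbitrary: p)
    case 0
    then show ?case using geodesic(4)[of p q] assms(2) axis_V by simp
  next
    case (Suc n)
    have V: "p \<in> V" "q \<in> V" using Suc.prems assms(2) axis_V by auto
    show ?case
    proof (cases "p = q")
      case True
      have "p \<in> set (geodesic p (x p))" using geodesic[OF V(1) x_V[OF V(1)]]
        by (metis list.set_sel(1))
      then show ?thesis using True Suc.prems V by (auto simp: geodesic_self)
    next
      case False
      then obtain p1 rest where pq: "geodesic p q = p # p1 # rest"
        using geodesic_ConsE[OF V] by metis
      note step = axis_step[OF Suc.prems assms(2) pq]
      have "geodesic p1 q = p1 # rest" by (rule geodesic_tl[OF V pq])
      then have "set (p1 # rest) \<subseteq> axis x \<and> ht q \<in> ht ` set (geodesic p1 (x p1))"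
        using Suc.hyps(1)[of p1] Suc.hyps(2) step(1) pq by simp
      then show ?thesis using step(2) pq Suc.prems by auto
    qed
  qed
  then show "set (geodesic p q) \<subseteq> axis x" "ht q \<in> ht ` set (geodesic p (x p))" by auto
qed

lemma finite_axis_heights: "finite (ht ` axis x)"
proof (cases "axis x = {}")
  case False
  then obtain p where "p \<in> axis x" by auto
  then have "ht ` axis x \<subseteq> ht ` set (geodesic p (x p))" using axis_height_in_translate by blast
  then show ?thesis using finite_surj by blast
qed auto

lemma axis_heights_not_shifted:
  assumes "axis x \<noteq> {}" "\<And>v. v \<in> axis x \<Longrightarrow> ht v + c \<in> ht ` axis x"
  shows "c = 0"
proof -
  let ?H = "ht ` axis x"
  have ne: "?H \<noteq> {}" using assms(1) by simp
  have shifted: "h + c \<in> ?H" if "h \<in> ?H" for h using assms(2) that by blast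
  have "Max ?H + c \<le> Max ?H"
    by (rule Max_ge[OF finite_axis_heights shifted[OF Max_in[OF finite_axis_heights ne]]])
  moreover have "Min ?H \<le> Min ?H + c"
    by (rule Min_le[OF finite_axis_heights shifted[OF Min_in[OF finite_axis_heights ne]]])
  ultimately show ?thesis by simp
qed

lemma axis_no_backtrack:
  assumes v: "v \<in> axis x" and first: "geodesic v (x v) = v # u # p"
    and last: "geodesic v (x v) = q @ [d, x v]"
  shows "x u \<noteq> d"
proof
  assume xu: "x u = d"
  have V: "v \<in> V" "x v \<in> V" using v axis_V x_V by auto
  note red = geodesic(1)[OF V]
  have adj: "adj v u" using red first by simp
  then have u: "u \<in> V" using adj_V adj_sym by blast
  show False
  proof (cases q)
    case Nil
    then have "x u = v" using first last xu by simp
    then show False using ht_preserved[OF u] ht_adj[OF adj] by simp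
  next
    case (Cons v' q')
    then have q: "geodesic v (x v) = v # (q' @ [d]) @ [x v]" using first last by simp
    have "reduced_path (q' @ [d])"
      using red reduced_path_appendD2[of "[v]" "(q' @ [d]) @ [x v]"]
        reduced_path_appendD1[of "q' @ [d]" "[x v]"] by (simp add: q)
    moreover have "hd (q' @ [d]) = u" using first q by (cases q') auto
    ultimately have "geodesic u (x u) = q' @ [d]" using xu by (intro geodesicI) auto
    then have "displacement x u < displacement x v" by (simp add: displacement_def q)
    then show False using v u by (auto simp: axis_def)
  qed
qed

lemma geodesic_funpow_Suc:
  assumes v: "v \<in> axis x"
  shows "geodesic v ((x ^^ Suc k) v) = geodesic v (x v) @ tl (map x (geodesic v ((x ^^ k) v)))"
proof (induction k)
  case 0
  show ?case using v axis_V by (simp add: geodesic_self)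
next
  case (Suc k)
  let ?g = "geodesic v ((x ^^ Suc k) v)"
  have V: "v \<in> V" "x v \<in> V" using v axis_V x_V by auto
  note k = geodesic[OF V(1) funpow_V[OF V(1), of "Suc k"]]
  have moved: "v \<noteq> x v" using no_fixed_vertex[OF V(1)] by metis
  obtain u p where first: "geodesic v (x v) = v # u # p" by (rule geodesic_ConsE[OF V moved])
  obtain q d where last: "geodesic v (x v) = q @ [d, x v]" by (rule geodesic_snocE[OF V moved])
  obtain g where g: "?g = v # u # g" using Suc.IH first by simp
  have "reduced_path (x v # x u # map x g)"
    using embedding_reduced_path[OF embedding k(1)] unfolding g by simp
  then have "reduced_path (d # x v # x u # map x g)"
    using geodesic(1)[OF V] reduced_path_appendD2[of q "[d, x v]"]
      axis_no_backtrack[OF v first last]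
    by (auto simp: last)
  then have "reduced_path (q @ d # x v # x u # map x g)"
    using geodesic(1)[OF V] unfolding last reduced_path_overlap[of q d "x v" "x u # map x g"]
    by simp
  then have "reduced_path (geodesic v (x v) @ tl (map x ?g))" unfolding g last by simp
  then show ?case
  proof (rule geodesicI)
    show "hd (geodesic v (x v) @ tl (map x ?g)) = v" by (simp add: first)
    show "last (geodesic v (x v) @ tl (map x ?g)) = (x ^^ Suc (Suc k)) v"
      using k(3) unfolding g by (simp add: last_map split: if_splits)
  qed
qed

lemma geodesic_funpow_Cons:
  assumes v: "v \<in> axis x"
  shows "\<exists>q. geodesic v ((x ^^ j) v) = v # q \<and> j \<le> length q"
proof (induction j)
  case 0
  show ?case using v axis_V by (simp add: geodesic_self)
next
  case (Suc j)
  have V: "v \<in> V" using v by (rule axis_V)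
  obtain u p where "geodesic v (x v) = v # u # p"
    using geodesic_ConsE[OF V x_V[OF V]] no_fixed_vertex[OF V] by metis
  then show ?case using Suc geodesic_funpow_Suc[OF v, of j] by auto
qed

lemma geodesic_funpow_split:
  assumes v: "v \<in> axis x"
  shows "\<exists>p q. geodesic v ((x ^^ (i + j)) v) = p @ (x ^^ i) v # q \<and> i \<le> length p \<and> j \<le> length q"
proof (induction i)
  case 0
  show ?case using geodesic_funpow_Cons[OF v, of j] by (auto intro: exI[of _ "[]"])
next
  case (Suc i)
  have V: "v \<in> V" "x v \<in> V" using v axis_V x_V by auto
  have moved: "v \<noteq> x v" using no_fixed_vertex[OF V(1)] by metis
  obtain c d where c: "geodesic v (x v) = c @ [d, x v]" by (rule geodesic_snocE[OF V moved])
  obtain p q where pq: "geodesic v ((x ^^ (i + j)) v) = p @ (x ^^ i) v # q"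
    "i \<le> length p" "j \<le> length q" using Suc.IH by blast
  have Suc_i: "geodesic v ((x ^^ (Suc i + j)) v) = (c @ [d, x v]) @ tl (map x (p @ (x ^^ i) v # q))"
    using geodesic_funpow_Suc[OF v, of "i + j"] by (simp add: pq(1) c)
  obtain p'
    where p': "(c @ [d, x v]) @ tl (map x (p @ (x ^^ i) v # q)) = p' @ (x ^^ Suc i) v # map x q"
    "Suc i \<le> length p'"
  proof (cases p)
    case Nil
    have "(x ^^ i) v = v" using Nil pq(1) geodesic(2)[OF V(1) funpow_V[OF V(1)], of "i + j"] by simp
    then show thesis using Nil pq(2) that[of "c @ [d]"] by simp
  next
    case (Cons w p')
    then show thesis using pq(2) that[of "c @ d # x v # map x p'"] by simp
  qed
  show ?case
  proof (intro exI conjI)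
    show "geodesic v ((x ^^ (Suc i + j)) v) = p' @ (x ^^ Suc i) v # map x q"
      unfolding Suc_i by (rule p'(1))
    show "j \<le> length (map x q)" using pq(3) by simp
  qed (rule p'(2))
qed

lemma conj_funpow:
  assumes "\<And>u. u \<in> V \<Longrightarrow> t ((x ^^ m) u) = y (t u)" "u \<in> V"
  shows "(y ^^ i) (t u) = t ((x ^^ (m * i)) u)"
proof (induction i)
  case (Suc i)
  have "(x ^^ (m * Suc i)) u = (x ^^ m) ((x ^^ (m * i)) u)" by (simp add: funpow_add)
  then show ?case using Suc assms(1)[OF funpow_V[OF assms(2)]] by simp
qed simp

text \<open>Since \<open>y\<close> preserves the axis, a long geodesic from \<open>v\<close> to a power of \<open>y\<close> applied to \<open>v\<close>
stays on it.  Its middle part is also the middle part of the image under \<open>t\<close> of a segment of the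
axis.\<close>

lemma conj_power_on_axis:
  assumes t: "embedding t" and y: "embedding y"
    and comm: "\<And>u. u \<in> V \<Longrightarrow> y (x u) = x (y u)"
    and conj: "\<And>u. u \<in> V \<Longrightarrow> t ((x ^^ m) u) = y (t u)" and m: "m > 0" and v: "v \<in> axis x"
  shows "t ((x ^^ (m * length (geodesic v (t v)))) v) \<in> axis x"
proof -
  let ?d = "length (geodesic v (t v))"
  let ?k = "m * ?d" and ?y = "y ^^ (2 * ?d)"
  have V: "v \<in> V" "t v \<in> V" using v axis_V embedding_V[OF t] by auto
  have embedding_y_pow: "embedding ?y" by (rule embedding_funpow[OF y])
  have V': "?y v \<in> V" "?y (t v) \<in> V" using embedding_V[OF embedding_y_pow] V by auto
  have on_axis: "(y ^^ i) v \<in> axis x" for i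
    by (induction i) (auto simp: v axis_commute[OF embedding y comm])
  obtain p q where pq: "geodesic v ((x ^^ (?k + ?k)) v) = p @ (x ^^ ?k) v # q"
    "?k \<le> length p" "?k \<le> length q" using geodesic_funpow_split[OF v] by blast
  moreover have "?d \<le> ?k" using m by simp
  ultimately have long: "?d \<le> length p" "?d \<le> length q" by linarith+
  have "?k + ?k = m * (2 * ?d)" by simp
  then have "geodesic (t v) (?y (t v)) = map t (geodesic v ((x ^^ (?k + ?k)) v))"
    using geodesic_image[OF t V(1) funpow_V[OF V(1)], of "?k + ?k"]
      conj_funpow[of t m y v, OF conj V(1)] by metis
  then have "geodesic (t v) (?y (t v)) = map t p @ t ((x ^^ ?k) v) # map t q" by (simp add: pq(1))
  then have "t ((x ^^ ?k) v) \<in> set (geodesic v (?y v))"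
  proof (rule geodesic_middle[OF V(2) V'(2) V(1) V'(1)])
    show "length (geodesic (t v) v) \<le> length (map t p)"
      using geodesic_rev[OF V] long(1) by simp
    show "length (geodesic (?y (t v)) (?y v)) \<le> length (map t q)"
      using geodesic_image[OF embedding_y_pow V] geodesic_rev[OF V'] long(2) by simp
  qed
  then show ?thesis using axis_convex[OF v on_axis] by blast
qed

lemma axis_height_shift:
  assumes t: "height_shift c t" and y: "embedding y"
    and comm: "\<And>u. u \<in> V \<Longrightarrow> y (x u) = x (y u)"
    and conj: "\<And>u. u \<in> V \<Longrightarrow> t ((x ^^ m) u) = y (t u)" and m: "m > 0" and v: "v \<in> axis x"
  shows "ht v + c \<in> ht ` axis x"
proof -
  let ?k = "m * length (geodesic v (t v))"
  have V: "v \<in> V" using v by (rule axis_V)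
  have "t ((x ^^ ?k) v) \<in> axis x"
    by (rule conj_power_on_axis[OF height_shift_embedding[OF t] y comm conj m v])
  moreover have "ht (t ((x ^^ ?k) v)) = ht v + c"
    using height_shift_ht[OF t funpow_V[OF V]] height_shift_ht[OF height_shift_funpow[OF shift] V]
    by simp
  ultimately show ?thesis by (metis imageI)
qed

end

context height_tree
begin

lemma hyperbolicI: "height_shift 0 x \<Longrightarrow> \<not> (\<exists>u\<in>V. x u = u) \<Longrightarrow> hyperbolic V adj ht x"
  by unfold_locales auto

lemma fixed_vertex_of_commuting:
  assumes y: "height_shift 0 y" and x: "height_shift c x" "c \<noteq> 0"
    and comm: "\<And>u. u \<in> V \<Longrightarrow> x (y u) = y (x u)" and ne: "V \<noteq> {}"
  shows "\<exists>u\<in>V. y u = u"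
proof (rule ccontr)
  assume "\<not> ?thesis"
  then interpret hyperbolic V adj ht y using y hyperbolicI by blast
  have "ht v + c \<in> ht ` axis y" if v: "v \<in> axis y" for v
  proof -
    have "x v \<in> axis y" by (rule axis_commute[OF embedding height_shift_embedding[OF x(1)] comm v])
    moreover have "ht (x v) = ht v + c" by (rule height_shift_ht[OF x(1) axis_V[OF v]])
    ultimately show ?thesis by (metis imageI)
  qed
  then show False using axis_heights_not_shifted[of c] axis_nonempty[OF ne] x(2) by metis
qed

lemma fixed_vertex_of_conj_power:
  assumes x: "height_shift 0 x" and t: "height_shift c t" "c \<noteq> 0" and y: "embedding y"
    and comm: "\<And>u. u \<in> V \<Longrightarrow> y (x u) = x (y u)"
    and conj: "\<And>u. u \<in> V \<Longrightarrow> t ((x ^^ m) u) = y (t u)" and m: "m > 0"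
    and ne: "V \<noteq> {}"
  shows "\<exists>u\<in>V. x u = u"
proof (rule ccontr)
  assume "\<not> ?thesis"
  then interpret hyperbolic V adj ht x using x hyperbolicI by blast
  have "ht v + c \<in> ht ` axis x" if "v \<in> axis x" for v
    by (rule axis_height_shift[OF t(1) y comm conj m that])
  then show False using axis_heights_not_shifted[of c] axis_nonempty[OF ne] t(2) by metis
qed

end

section \<open>HNN extensions of abelian groups\<close>

text \<open>An HNN extension of an abelian group \<open>E\<close> with stable letter \<open>a\<close>.  The elements that can pass
\<open>a\<close> (index \<open>True\<close>) or \<open>a\<^sup>-\<^sup>1\<close> (index \<open>False\<close>) from left to right form the subgroup where \<open>rep\<close>, which
picks coset representatives, vanishes, and \<open>q a\<^bsup>e\<^esup> = a\<^bsup>e\<^esup> (pass e q)\<close>.  The group acts on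
the states \<open>([(e\<^sub>1,\<rho>\<^sub>1),\<dots>], p)\<close>, which stand for the normal forms \<open>\<rho>\<^sub>1 a\<^bsup>e\<^sub>1\<^esup> \<rho>\<^sub>2 a\<^bsup>e\<^sub>2\<^esup> \<dots> p\<close>; the lists
alone are the vertices of the Bass-Serre tree.\<close>

type_synonym 'e vertex = "(bool \<times> 'e) list"
type_synonym 'e state = "'e vertex \<times> 'e"

locale hnn =
  fixes rep pass :: "bool \<Rightarrow> 'e::ab_group_add \<Rightarrow> 'e" and \<beta> :: 'e
  assumes rep_0 [simp]: "rep e 0 = 0"
    and rep_diff_rep: "rep e (x - rep e x) = 0"
    and rep_absorb: "rep e y = 0 \<Longrightarrow> rep e (x + y) = rep e x"
    and pass_add: "rep e x = 0 \<Longrightarrow> rep e y = 0 \<Longrightarrow> pass e (x + y) = pass e x + pass e y"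
    and rep_pass [simp]: "rep e x = 0 \<Longrightarrow> rep (\<not> e) (pass e x) = 0"
    and pass_pass [simp]: "rep e x = 0 \<Longrightarrow> pass (\<not> e) (pass e x) = x"
begin

lemma rep_pass_not [simp]: "rep (\<not> e) x = 0 \<Longrightarrow> rep e (pass (\<not> e) x) = 0"
  using rep_pass[of "\<not> e" x] by simp

lemma pass_pass_not [simp]: "rep (\<not> e) x = 0 \<Longrightarrow> pass e (pass (\<not> e) x) = x"
  using pass_pass[of "\<not> e" x] by simp

lemma rep_absorb_left: "rep e y = 0 \<Longrightarrow> rep e (y + x) = rep e x"
  using rep_absorb[of e y x] by (simp add: add.commute)

lemma rep_uminus: "rep e x = 0 \<Longrightarrow> rep e (- x) = 0"
  using rep_absorb[of e x "- x"] by simp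

lemma rep_diff: "rep e x = 0 \<Longrightarrow> rep e y = 0 \<Longrightarrow> rep e (x - y) = 0"
  using rep_absorb[of e "- y" x] rep_uminus[of e y] by simp

lemma rep_rep [simp]: "rep e (rep e x) = rep e x"
  using rep_absorb[OF rep_diff_rep, of e "rep e x" x] by simp

lemma rep_eqD: "rep e x = rep e y \<Longrightarrow> rep e (x - y) = 0"
  using rep_diff[OF rep_diff_rep[of e x] rep_diff_rep[of e y]] by simp

lemma pass_0 [simp]: "pass e 0 = 0"
  using pass_add[of e 0 0] by simp

text \<open>\<open>q \<rho> a\<^bsup>e\<^esup> = rep e (q + \<rho>) a\<^bsup>e\<^esup> (carry e q \<rho>)\<close>\<close>

definition carry :: "bool \<Rightarrow> 'e \<Rightarrow> 'e \<Rightarrow> 'e" where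
  "carry e q \<rho> = pass e (q + \<rho> - rep e (q + \<rho>))"

lemma rep_carry [simp]: "rep (\<not> e) (carry e q \<rho>) = 0"
  by (simp add: carry_def rep_diff_rep)

lemma carry_0: "rep e \<rho> = \<rho> \<Longrightarrow> carry e 0 \<rho> = 0"
  by (simp add: carry_def)

lemma rep_add_rep: "rep e (q1 + rep e (q2 + \<rho>)) = rep e (q1 + q2 + \<rho>)"
  using rep_absorb[OF rep_diff_rep[of e "q2 + \<rho>"], of "q1 + rep e (q2 + \<rho>)"]
  by (simp add: algebra_simps)

lemma carry_add: "carry e (q1 + q2) \<rho> = carry e q1 (rep e (q2 + \<rho>)) + carry e q2 \<rho>"
proof -
  have "q1 + q2 + \<rho> - rep e (q1 + q2 + \<rho>) =
    (q1 + rep e (q2 + \<rho>) - rep e (q1 + rep e (q2 + \<rho>))) + (q2 + \<rho> - rep e (q2 + \<rho>))"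
    unfolding rep_add_rep by simp
  then show ?thesis unfolding carry_def by (simp only: pass_add rep_diff_rep)
qed

fun normal_form :: "'e vertex \<Rightarrow> bool" where
  "normal_form [] \<longleftrightarrow> True"
| "normal_form ((e, \<rho>) # l) \<longleftrightarrow> rep e \<rho> = \<rho> \<and> normal_form l \<and> (l = [] \<or> hd l \<noteq> (\<not> e, 0))"

text \<open>Multiplying the list \<open>l\<close> by \<open>q\<close> from the left gives the list \<open>lmult q l\<close> followed by the
element \<open>lcarry q l\<close> of \<open>E\<close>.\<close>

fun lmult :: "'e \<Rightarrow> 'e vertex \<Rightarrow> 'e vertex" where
  "lmult q [] = []"
| "lmult q ((e, \<rho>) # l) = (e, rep e (q + \<rho>)) # lmult (carry e q \<rho>) l"

fun lcarry :: "'e \<Rightarrow> 'e vertex \<Rightarrow> 'e" where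
  "lcarry q [] = q"
| "lcarry q ((e, \<rho>) # l) = lcarry (carry e q \<rho>) l"

definition push :: "bool \<Rightarrow> 'e vertex \<Rightarrow> 'e vertex" where
  "push e l = (if l \<noteq> [] \<and> hd l = (\<not> e, 0) then tl l else (e, 0) # l)"

lemma lmult_add: "lmult (q1 + q2) l = lmult q1 (lmult q2 l)"
  by (induction l arbitrary: q1 q2) (auto simp: carry_add rep_add_rep)

lemma lcarry_add: "lcarry (q1 + q2) l = lcarry q1 (lmult q2 l) + lcarry q2 l"
  by (induction l arbitrary: q1 q2) (auto simp: carry_add rep_add_rep)

lemma lmult_eq_Nil [simp]: "lmult q l = [] \<longleftrightarrow> l = []"
  by (cases l) auto

lemma lmult_0: "normal_form l \<Longrightarrow> lmult 0 l = l"
  by (induction l rule: normal_form.induct) (auto simp: carry_0)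

lemma lcarry_0: "normal_form l \<Longrightarrow> lcarry 0 l = 0"
  by (induction l rule: normal_form.induct) (auto simp: carry_0)

lemma normal_form_lmult: "normal_form l \<Longrightarrow> normal_form (lmult q l)"
proof (induction l arbitrary: q)
  case (Cons s l)
  obtain e \<rho> where s: "s = (e, \<rho>)" by (cases s)
  have "hd (lmult (carry e q \<rho>) l) \<noteq> (\<not> e, 0)" if ne: "l \<noteq> []"
  proof
    assume h: "hd (lmult (carry e q \<rho>) l) = (\<not> e, 0)"
    obtain e' \<rho>' l' where l: "l = (e', \<rho>') # l'" using ne by (cases l) auto
    with h have "e' = (\<not> e)" "rep (\<not> e) (carry e q \<rho> + \<rho>') = 0" by auto
    then have "rep (\<not> e) \<rho>' = 0" using rep_absorb_left[OF rep_carry] by metis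
    then show False using Cons.prems s l \<open>e' = (\<not> e)\<close> by auto
  qed
  then show ?case using Cons s by auto
qed simp

lemma normal_form_tl: "normal_form l \<Longrightarrow> normal_form (tl l)"
  by (cases l rule: normal_form.cases) auto

lemma normal_form_appendD: "normal_form (u @ v) \<Longrightarrow> normal_form u"
  by (induction u rule: normal_form.induct) (auto simp: hd_append split: if_splits)

lemma normal_form_push: "normal_form l \<Longrightarrow> normal_form (push e l)"
  by (auto simp: push_def normal_form_tl)

lemma push_push: "normal_form l \<Longrightarrow> push e (push (\<not> e) l) = l"
  by (cases l rule: normal_form.cases) (auto simp: push_def)

lemma
  assumes "normal_form l" "rep (\<not> e) q = 0"
  shows push_lmult: "push e (lmult q l) = lmult (pass (\<not> e) q) (push e l)"
    and lcarry_push: "lcarry q l = lcarry (pass (\<not> e) q) (push e l)"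
proof -
  have "push e (lmult q l) = lmult (pass (\<not> e) q) (push e l) \<and>
    lcarry q l = lcarry (pass (\<not> e) q) (push e l)"
  proof (cases "l \<noteq> [] \<and> hd l = (\<not> e, 0)")
    case True
    then obtain l' where "l = (\<not> e, 0) # l'" by (cases l) auto
    then show ?thesis using assms by (auto simp: push_def carry_def)
  next
    case False
    have "\<not> (lmult q l \<noteq> [] \<and> hd (lmult q l) = (\<not> e, 0))"
      using False assms rep_absorb_left[of "\<not> e" q]
      by (cases e; cases l rule: normal_form.cases) auto
    then show ?thesis using False assms by (auto simp: push_def carry_def)
  qed
  then show "push e (lmult q l) = lmult (pass (\<not> e) q) (push e l)"
    and "lcarry q l = lcarry (pass (\<not> e) q) (push e l)" by auto
qed

text \<open>The operators are the identity outside the normal forms, so that they are permutations of the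
whole type.\<close>

definition base_op :: "'e \<Rightarrow> 'e state \<Rightarrow> 'e state" where
  "base_op q s =
    (if normal_form (fst s) then (lmult q (fst s), lcarry q (fst s) + snd s) else s)"

definition stable_op :: "bool \<Rightarrow> 'e state \<Rightarrow> 'e state" where
  "stable_op e s = (if normal_form (fst s) then (push e (fst s), snd s) else s)"

definition letter_op :: "letter \<Rightarrow> 'e state \<Rightarrow> 'e state" where
  "letter_op l = (if fst l then base_op (if snd l then - \<beta> else \<beta>) else stable_op (\<not> snd l))"

lemma base_op_add: "base_op (q1 + q2) = base_op q1 \<circ> base_op q2"
  by (auto simp: base_op_def normal_form_lmult lmult_add lcarry_add algebra_simps)

lemma base_op_0: "base_op 0 = id"
  by (auto simp: base_op_def lmult_0 lcarry_0)

lemma base_op_Nil [simp]: "base_op q ([], p) = ([], q + p)"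
  by (simp add: base_op_def)

lemma base_op_inj: "base_op p = base_op q \<Longrightarrow> p = q"
  using base_op_Nil[of p 0] base_op_Nil[of q 0] by (metis add.right_neutral prod.inject)

lemma base_op_uminus: "base_op (- q) \<circ> base_op q = id" "base_op q \<circ> base_op (- q) = id"
  by (simp_all flip: base_op_add add: base_op_0)

lemma base_op_commute: "base_op p \<circ> base_op q = base_op q \<circ> base_op p"
  by (simp flip: base_op_add add: add.commute)

lemma stable_op_stable_op: "stable_op e \<circ> stable_op (\<not> e) = id"
  by (auto simp: stable_op_def normal_form_push push_push)

lemma stable_op_base_op:
  "rep (\<not> e) q = 0 \<Longrightarrow> stable_op e \<circ> base_op q = base_op (pass (\<not> e) q) \<circ> stable_op e"
  by (auto simp: stable_op_def base_op_def normal_form_push normal_form_lmult push_lmult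
      lcarry_push)

sublocale letter_permutation letter_op
proof
  fix l s
  show "letter_op l (letter_op (inv_letter l) s) = s"
    using base_op_uminus[of \<beta>] stable_op_stable_op[of "\<not> snd l"]
    by (cases s) (auto simp: letter_op_def inv_letter_def fun_eq_iff)
qed

lemma stable_op_in_G: "stable_op e \<in> G"
  using G_letter[of "(False, \<not> e)"] by (simp add: letter_op_def)

lemma perm_inv_stable_op: "perm_inv (stable_op e) = stable_op (\<not> e)"
  using stable_op_stable_op[of e] stable_op_stable_op[of "\<not> e"] by (intro inv_unique_comp) simp_all

lemma base_op_generator_in_G: "base_op \<beta> \<in> G"
  using G_letter[of "(True, False)"] by (simp add: letter_op_def)

lemma perm_inv_base_op: "perm_inv (base_op q) = base_op (- q)"
  by (rule inv_unique_comp) (rule base_op_uminus)+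

lemma base_op_uminus_in_G: "base_op q \<in> G \<Longrightarrow> base_op (- q) \<in> G"
  using G_inv perm_inv_base_op by metis

lemma base_op_add_in_G: "base_op p \<in> G \<Longrightarrow> base_op q \<in> G \<Longrightarrow> base_op (p + q) \<in> G"
  unfolding base_op_add by (rule G_comp)

lemma base_op_pass_in_G:
  assumes "base_op q \<in> G" "rep e q = 0"
  shows "base_op (pass e q) \<in> G"
proof -
  have "stable_op (\<not> e) \<circ> base_op q = base_op (pass e q) \<circ> stable_op (\<not> e)"
    using stable_op_base_op[of "\<not> e" q] assms(2) by simp
  then have "base_op (pass e q) = stable_op (\<not> e) \<circ> base_op q \<circ> stable_op e"
    using stable_op_stable_op[of "\<not> e"] by (metis comp_assoc comp_id not_not)
  then show ?thesis using assms(1) G_comp stable_op_in_G by metis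
qed

lemma G_induct_op [consumes 1, case_names id stable base]:
  assumes "g \<in> G" "P id" "\<And>e g. g \<in> G \<Longrightarrow> P g \<Longrightarrow> P (stable_op e \<circ> g)"
    "\<And>q g. q = \<beta> \<or> q = - \<beta> \<Longrightarrow> g \<in> G \<Longrightarrow> P g \<Longrightarrow> P (base_op q \<circ> g)"
  shows "P g"
  using assms(1)
proof (induction rule: G_induct)
  case (letter l g)
  have "(\<exists>e. letter_op l = stable_op e) \<or> (\<exists>q. (q = \<beta> \<or> q = - \<beta>) \<and> letter_op l = base_op q)"
    unfolding letter_op_def by auto
  then show ?case using assms(3,4) letter by metis
qed (rule assms(2))

subsection \<open>The action on the Bass-Serre tree\<close>

fun exponent_sum :: "'e vertex \<Rightarrow> int" where
  "exponent_sum [] = 0"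
| "exponent_sum ((e, \<rho>) # l) = (if e then 1 else - 1) + exponent_sum l"

definition vertex_act :: "('e state \<Rightarrow> 'e state) \<Rightarrow> 'e vertex \<Rightarrow> 'e vertex" where
  "vertex_act g u = fst (g (u, 0))"

definition height :: "('e state \<Rightarrow> 'e state) \<Rightarrow> int" where
  "height g = exponent_sum (vertex_act g [])"

definition shifts_by :: "int \<Rightarrow> ('e state \<Rightarrow> 'e state) \<Rightarrow> bool" where
  "shifts_by h g \<longleftrightarrow> (\<forall>u. normal_form u \<longrightarrow> (\<exists>v c. normal_form v \<and>
     exponent_sum v = exponent_sum u + h \<and> (\<forall>p. g (u, p) = (v, c + p))))"

lemma exponent_sum_lmult: "exponent_sum (lmult q l) = exponent_sum l"
  by (induction l arbitrary: q) auto

lemma exponent_sum_push: "exponent_sum (push e l) = (if e then 1 else - 1) + exponent_sum l"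
  by (cases l) (auto simp: push_def)

lemma shifts_by_id: "shifts_by 0 id"
  by (auto simp: shifts_by_def)

lemma shifts_by_base_op: "shifts_by 0 (base_op q)"
  by (auto simp: shifts_by_def base_op_def normal_form_lmult exponent_sum_lmult)

lemma shifts_by_stable_op: "shifts_by (if e then 1 else - 1) (stable_op e)"
  by (auto simp: shifts_by_def stable_op_def normal_form_push exponent_sum_push)

lemma shifts_by_comp:
  assumes "shifts_by h g" "shifts_by k f"
  shows "shifts_by (h + k) (g \<circ> f)"
  unfolding shifts_by_def
proof (intro allI impI)
  fix u assume "normal_form u"
  then obtain v c where v: "normal_form v" "exponent_sum v = exponent_sum u + k"
    "\<And>p. f (u, p) = (v, c + p)" using assms(2) unfolding shifts_by_def by blast
  then obtain w d where "normal_form w" "exponent_sum w = exponent_sum v + h"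
    "\<And>p. g (v, p) = (w, d + p)" using assms(1) unfolding shifts_by_def by blast
  then show "\<exists>v c. normal_form v \<and> exponent_sum v = exponent_sum u + (h + k) \<and>
      (\<forall>p. (g \<circ> f) (u, p) = (v, c + p))"
    using v by (intro exI[of _ w] exI[of _ "d + c"]) (simp add: add.assoc)
qed

lemma shifts_by_funpow: "shifts_by h g \<Longrightarrow> shifts_by (int n * h) (g ^^ n)"
proof (induction n)
  case 0
  show ?case unfolding funpow.simps using shifts_by_id by (simp only: of_nat_0 mult_zero_left)
next
  case (Suc n)
  have "int (Suc n) * h = h + int n * h" by (simp add: distrib_right)
  then show ?case unfolding funpow.simps using shifts_by_comp Suc by metis
qed

lemma shifts_by_height: "shifts_by h g \<Longrightarrow> height g = h"
  unfolding shifts_by_def by (drule spec[of _ "[]"]) (auto simp: height_def vertex_act_def)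

lemma shifts_by_G: "g \<in> G \<Longrightarrow> shifts_by (height g) g"
proof -
  have "\<exists>h. shifts_by h g" if "g \<in> G" for g
    using that
  proof (induction rule: G_induct_op)
    case id
    then show ?case using shifts_by_id by blast
  next
    case (stable e g)
    then show ?case using shifts_by_comp shifts_by_stable_op by blast
  next
    case (base q g)
    then show ?case using shifts_by_comp shifts_by_base_op by blast
  qed
  then show "g \<in> G \<Longrightarrow> shifts_by (height g) g" using shifts_by_height by blast
qed

lemma
  assumes "g \<in> G" "normal_form u"
  shows act_eq: "g (u, p) = (vertex_act g u, snd (g (u, 0)) + p)"
    and normal_form_vertex_act: "normal_form (vertex_act g u)"
    and exponent_sum_vertex_act: "exponent_sum (vertex_act g u) = exponent_sum u + height g"
proof -
  obtain v c where "normal_form v" "exponent_sum v = exponent_sum u + height g"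
    "\<And>p. g (u, p) = (v, c + p)"
    using shifts_by_G[OF assms(1)] assms(2) unfolding shifts_by_def by blast
  then show "g (u, p) = (vertex_act g u, snd (g (u, 0)) + p)" "normal_form (vertex_act g u)"
    "exponent_sum (vertex_act g u) = exponent_sum u + height g"
    by (simp_all add: vertex_act_def)
qed

lemma vertex_act_comp:
  "g \<in> G \<Longrightarrow> h \<in> G \<Longrightarrow> normal_form u \<Longrightarrow> vertex_act (g \<circ> h) u = vertex_act g (vertex_act h u)"
  using act_eq[of h u 0] act_eq[of g "vertex_act h u" "snd (h (u, 0))"] normal_form_vertex_act
  by (simp add: vertex_act_def)

lemma vertex_act_id [simp]: "vertex_act id u = u"
  by (simp add: vertex_act_def)

lemma height_id [simp]: "height id = 0"
  by (rule shifts_by_height[OF shifts_by_id])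

lemma height_base_op [simp]: "height (base_op q) = 0"
  by (rule shifts_by_height[OF shifts_by_base_op])

lemma height_stable_op [simp]: "height (stable_op e) = (if e then 1 else - 1)"
  by (rule shifts_by_height[OF shifts_by_stable_op])

lemma height_comp: "g \<in> G \<Longrightarrow> h \<in> G \<Longrightarrow> height (g \<circ> h) = height g + height h"
  by (intro shifts_by_height shifts_by_comp shifts_by_G)

lemma height_perm_inv: "g \<in> G \<Longrightarrow> height (perm_inv g) = - height g"
  using height_comp[of "perm_inv g" g] G_inv_comp[of g] G_inv[of g] by simp

lemma height_conj: "h \<in> G \<Longrightarrow> g \<in> G \<Longrightarrow> height (perm_inv h \<circ> g \<circ> h) = height g"
  using height_comp height_perm_inv G_comp G_inv by simp

sublocale tree: prefix_closed "{u. normal_form u}"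
  by unfold_locales (auto dest: normal_form_appendD)

lemma adj_lmult: "tree.adj u v \<Longrightarrow> tree.adj (lmult q u) (lmult q v)"
proof -
  have append: "\<exists>q'. lmult q (l @ k) = lmult q l @ lmult q' k" for q l k
    by (induction l arbitrary: q) (auto intro: exI[of _ q])
  have "\<exists>s'. lmult q (u @ [s]) = lmult q u @ [s']" for u s
    using append[of q u "[s]"] by (cases s) auto
  then show "tree.adj u v \<Longrightarrow> tree.adj (lmult q u) (lmult q v)"
    unfolding tree.adj_def using normal_form_lmult by (metis mem_Collect_eq)
qed

lemma adj_push: "tree.adj u v \<Longrightarrow> tree.adj (push e u) (push e v)"
proof -
  have "\<exists>s'. push e (u @ [s]) = push e u @ [s'] \<or> push e u = push e (u @ [s]) @ [s']" for u s
    by (cases u) (auto simp: push_def)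
  then show "tree.adj u v \<Longrightarrow> tree.adj (push e u) (push e v)"
    unfolding tree.adj_def using normal_form_push by (metis mem_Collect_eq)
qed

sublocale tree: height_tree "{u. normal_form u}" tree.adj exponent_sum
proof
  have "exponent_sum (u @ [s]) \<noteq> exponent_sum u" for u s
    by (induction u rule: exponent_sum.induct) (cases s, auto)
  then show "exponent_sum u \<noteq> exponent_sum v" if "tree.adj u v" for u v
    using that unfolding tree.adj_def by metis
qed

lemma adj_vertex_act: "g \<in> G \<Longrightarrow> tree.adj u v \<Longrightarrow> tree.adj (vertex_act g u) (vertex_act g v)"
proof (induction arbitrary: u v rule: G_induct_op)
  case id
  then show ?case by (simp only: vertex_act_id)
next
  case (stable e g)
  have V: "normal_form u" "normal_form v" using stable(3) by (auto simp: tree.adj_def)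
  have "vertex_act (stable_op e) w = push e w" if "normal_form w" for w
    using that by (simp add: vertex_act_def stable_op_def)
  then have "vertex_act (stable_op e \<circ> g) w = push e (vertex_act g w)" if "normal_form w" for w
    unfolding vertex_act_comp[OF stable_op_in_G stable(1) that]
    using normal_form_vertex_act[OF stable(1) that] by blast
  then show ?case using adj_push[OF stable(2)[OF stable(3)]] V by metis
next
  case (base q g)
  have V: "normal_form u" "normal_form v" using base(4) by (auto simp: tree.adj_def)
  have q: "base_op q \<in> G" using base(1) base_op_generator_in_G base_op_uminus_in_G by auto
  have "vertex_act (base_op q) w = lmult q w" if "normal_form w" for w
    using that by (simp add: vertex_act_def base_op_def)
  then have "vertex_act (base_op q \<circ> g) w = lmult q (vertex_act g w)" if "normal_form w" for w
    unfolding vertex_act_comp[OF q base(2) that]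
    using normal_form_vertex_act[OF base(2) that] by blast
  then show ?case using adj_lmult[OF base(3)[OF base(4)]] V by metis
qed

lemma height_shift_vertex_act:
  assumes g: "g \<in> G"
  shows "tree.height_shift (height g) (vertex_act g)"
proof -
  have "vertex_act (perm_inv g) (vertex_act g u) = u" if "normal_form u" for u
    using vertex_act_comp[OF G_inv[OF g] g that] G_inv_comp[OF g] by simp
  then have "inj_on (vertex_act g) {u. normal_form u}" by (metis inj_onI mem_Collect_eq)
  then show ?thesis
    using g adj_vertex_act normal_form_vertex_act exponent_sum_vertex_act
    by (auto simp: tree.height_shift_def tree.embedding_def)
qed

end

subsection \<open>Evaluation of normal forms\<close>

locale hnn_evaluation = hnn rep pass \<beta> + monoid K
  for rep pass :: "bool \<Rightarrow> 'e::ab_group_add \<Rightarrow> 'e" and \<beta> and K (structure) +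
  fixes A :: "bool \<Rightarrow> 'k" and B :: "'e \<Rightarrow> 'k"
  assumes A_closed [simp]: "A e \<in> carrier K" and B_closed [simp]: "B q \<in> carrier K"
    and B_0: "B 0 = \<one>" and B_add: "B (p + q) = B p \<otimes> B q"
    and A_cancel: "A e \<otimes> A (\<not> e) = \<one>"
    and B_A: "rep e q = 0 \<Longrightarrow> B q \<otimes> A e = A e \<otimes> B (pass e q)"
begin

fun evaluate :: "'e state \<Rightarrow> 'k" where
  "evaluate ([], p) = B p"
| "evaluate ((e, \<rho>) # l, p) = B \<rho> \<otimes> (A e \<otimes> evaluate (l, p))"

definition letter_value :: "letter \<Rightarrow> 'k" where
  "letter_value l = (if fst l then B (if snd l then - \<beta> else \<beta>) else A (\<not> snd l))"

lemma evaluate_closed [simp]: "evaluate s \<in> carrier K"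
  by (induction s rule: evaluate.induct) auto

lemma evaluate_lmult: "evaluate (lmult q l, lcarry q l + p) = B q \<otimes> evaluate (l, p)"
proof (induction l arbitrary: q)
  case Nil
  show ?case by (simp add: B_add)
next
  case (Cons s l)
  obtain e \<rho> where s: "s = (e, \<rho>)" by (cases s)
  define \<rho>' where "\<rho>' = rep e (q + \<rho>)"
  have "B q \<otimes> evaluate (s # l, p) = B (\<rho>' + (q + \<rho> - \<rho>')) \<otimes> (A e \<otimes> evaluate (l, p))"
    by (simp add: s B_add m_assoc)
  also have "\<dots> = B \<rho>' \<otimes> ((B (q + \<rho> - \<rho>') \<otimes> A e) \<otimes> evaluate (l, p))"
    by (simp only: B_add m_assoc B_closed A_closed evaluate_closed m_closed)
  also have "B (q + \<rho> - \<rho>') \<otimes> A e = A e \<otimes> B (carry e q \<rho>)"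
    unfolding carry_def \<rho>'_def by (rule B_A[OF rep_diff_rep])
  finally show ?case by (simp add: s \<rho>'_def m_assoc Cons.IH)
qed

lemma evaluate_push: "evaluate (push e l, p) = A e \<otimes> evaluate (l, p)"
proof (cases "l \<noteq> [] \<and> hd l = (\<not> e, 0)")
  case True
  then obtain l' where "l = (\<not> e, 0) # l'" by (cases l) auto
  then show ?thesis using A_cancel[of e] by (simp add: push_def B_0 flip: m_assoc)
qed (auto simp: push_def B_0)

lemma evaluate_letter_op:
  "normal_form (fst s) \<Longrightarrow> evaluate (letter_op l s) = letter_value l \<otimes> evaluate s"
  by (cases s) (auto simp: letter_op_def letter_value_def base_op_def stable_op_def
      evaluate_lmult evaluate_push)

lemma evaluate_foldr:
  "evaluate (foldr letter_op w ([], 0)) = foldr (\<lambda>l k. letter_value l \<otimes> k) w \<one>"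
proof (induction w)
  case (Cons l w)
  have "normal_form (fst (foldr letter_op w ([], 0)))"
    using normal_form_vertex_act[of "foldr letter_op w" "[]"] by (simp add: vertex_act_def)
  then show ?case using Cons evaluate_letter_op by simp
qed (simp add: B_0)

end

context hnn
begin

lemma G_eq_evaluate:
  obtains eval where "\<And>g. g \<in> G \<Longrightarrow> g = eval (g ([], 0))" "\<And>p. eval ([], p) = base_op p"
proof -
  let ?K = "\<lparr>carrier = UNIV, monoid.mult = (\<circ>), one = id\<rparr> :: ('e state \<Rightarrow> 'e state) monoid"
  interpret K: hnn_evaluation rep pass \<beta> ?K stable_op base_op
  proof
    fix e q assume "rep e q = 0"
    then show "base_op q \<otimes>\<^bsub>?K\<^esub> stable_op e = stable_op e \<otimes>\<^bsub>?K\<^esub> base_op (pass e q)"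
      using stable_op_base_op[of e "pass e q"] by simp
  qed (auto simp: base_op_0 base_op_add stable_op_stable_op comp_assoc)
  have letter: "K.letter_value = letter_op"
    by (simp add: fun_eq_iff K.letter_value_def letter_op_def)
  have "foldr (\<lambda>l g. letter_op l \<circ> g) w id = foldr letter_op w" for w
    by (induction w) auto
  then have "g = K.evaluate (g ([], 0))" if "g \<in> G" for g
    using that K.evaluate_foldr by (auto simp: letter)
  then show thesis using that K.evaluate.simps(1) by blast
qed

lemma G_regular: "g \<in> G \<Longrightarrow> h \<in> G \<Longrightarrow> g ([], 0) = h ([], 0) \<Longrightarrow> g = h"
  using G_eq_evaluate by metis

lemma G_stabilizer: "g \<in> G \<Longrightarrow> vertex_act g [] = [] \<Longrightarrow> \<exists>q. g = base_op q"
  using G_eq_evaluate by (metis prod.collapse vertex_act_def)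

lemma act_kernel_iff: "reduced w \<Longrightarrow> w \<in> act_kernel \<longleftrightarrow> foldr letter_op w ([], 0) = ([], 0)"
  using G_regular[of "foldr letter_op w" id] G_id by (auto simp: act_kernel_def)

subsection \<open>Conjugation of base elements\<close>

definition passes :: "'e \<Rightarrow> 'e \<Rightarrow> bool" where
  "passes p q \<longleftrightarrow> rep False p = 0 \<and> q = pass False p"

definition passes_power :: "int \<Rightarrow> 'e \<Rightarrow> 'e \<Rightarrow> bool" where
  "passes_power h p q \<longleftrightarrow> (if h \<ge> 0 then (passes ^^ nat h) p q else (passes ^^ nat (- h)) q p)"

lemma passes_iff_True: "passes p q \<longleftrightarrow> rep True q = 0 \<and> p = pass True q"
  using rep_pass[of False p] rep_pass[of True q] pass_pass[of False p] pass_pass[of True q]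
  by (auto simp: passes_def)

lemma passes_fun: "passes p q \<Longrightarrow> passes p q' \<Longrightarrow> q = q'"
  by (simp add: passes_def)

lemma passes_inj: "passes p q \<Longrightarrow> passes p' q \<Longrightarrow> p = p'"
  by (simp add: passes_iff_True)

lemma passes_power_0 [simp]: "passes_power 0 p q \<longleftrightarrow> p = q"
  by (simp add: passes_power_def)

lemma passes_power_1: "passes_power 1 p q \<longleftrightarrow> passes p q"
  by (auto simp: passes_power_def)

lemma passes_power_down:
  assumes "passes q q'" "passes_power k p q'"
  shows "passes_power (k - 1) p q"
proof (cases "k \<ge> 1")
  case True
  then have "nat k = Suc (nat (k - 1))" by simp
  then obtain z where "(passes ^^ nat (k - 1)) p z" "passes z q'"
    using assms(2) True by (auto simp: passes_power_def)
  then show ?thesis using passes_inj[OF assms(1)] True by (auto simp: passes_power_def)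
next
  case False
  then have "(passes ^^ nat (- k)) q' p"
    using assms(2) by (cases "k = 0") (auto simp: passes_power_def)
  then have "(passes ^^ Suc (nat (- k))) q p" using assms(1) by (rule relpowp_Suc_I2[rotated])
  moreover have "nat (- (k - 1)) = Suc (nat (- k))" using False by simp
  ultimately show ?thesis using False by (simp add: passes_power_def)
qed

lemma passes_power_up:
  assumes "passes q' q" "passes_power k p q'"
  shows "passes_power (k + 1) p q"
proof (cases "k \<ge> 0")
  case True
  then have "nat (k + 1) = Suc (nat k)" by simp
  then show ?thesis using assms True by (auto simp: passes_power_def)
next
  case False
  then have "nat (- k) = Suc (nat (- (k + 1)))" by simp
  then obtain z where "passes q' z" "(passes ^^ nat (- (k + 1))) z p"
    using assms(2) False relpowp_Suc_D2 by (metis passes_power_def)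
  then show ?thesis
    using passes_fun[OF assms(1)] False by (cases "k = - 1") (auto simp: passes_power_def)
qed

lemma lmult_fixD:
  assumes "normal_form ((e, \<rho>) # l)" "lmult q ((e, \<rho>) # l) = (e, \<rho>) # l"
  shows "rep e q = 0" "lmult (pass e q) l = l" "lcarry q ((e, \<rho>) # l) = lcarry (pass e q) l"
proof -
  have r: "rep e (q + \<rho>) = \<rho>" "rep e \<rho> = \<rho>" using assms by auto
  then show "rep e q = 0" using rep_eqD[of e "q + \<rho>" \<rho>] by simp
  have "carry e q \<rho> = pass e q" using r by (simp add: carry_def)
  then show "lmult (pass e q) l = l" "lcarry q ((e, \<rho>) # l) = lcarry (pass e q) l"
    using assms(2) by auto
qed

lemma passes_power_lcarry:
  assumes "normal_form l" "lmult q l = l"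
  shows "passes_power (exponent_sum l) (lcarry q l) q"
  using assms
proof (induction l arbitrary: q)
  case Nil
  then show ?case by simp
next
  case (Cons s l)
  obtain e \<rho> where s: "s = (e, \<rho>)" by (cases s)
  note fixD = lmult_fixD[OF Cons.prems[unfolded s]]
  have IH: "passes_power (exponent_sum l) (lcarry q (s # l)) (pass e q)"
    unfolding s fixD(3) by (rule Cons.IH) (use Cons.prems s fixD in auto)
  show ?case
  proof (cases e)
    case True
    then have "passes (pass e q) q" using fixD(1) by (simp add: passes_iff_True)
    from passes_power_up[OF this IH] show ?thesis by (simp add: s True add.commute)
  next
    case False
    then have "passes q (pass e q)" using fixD(1) by (simp add: passes_def)
    from passes_power_down[OF this IH] show ?thesis by (simp add: s False)
  qed
qed

lemma
  assumes "g \<in> G" "base_op q \<circ> g = g \<circ> base_op p"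
  shows lmult_vertex_act: "lmult q (vertex_act g []) = vertex_act g []"
    and conj_passes_power: "passes_power (height g) p q"
proof -
  let ?u = "vertex_act g []"
  have root: "normal_form []" by simp
  have u: "normal_form ?u" by (rule normal_form_vertex_act[OF assms(1) root])
  obtain c where g: "\<And>p. g ([], p) = (?u, c + p)"
    by (rule that[OF act_eq[OF assms(1) root]])
  have "base_op q (g ([], 0)) = g (base_op p ([], 0))" using assms(2) by (metis comp_apply)
  then have "base_op q (?u, c) = (?u, c + p)" using g by simp
  then have "lmult q ?u = ?u" "lcarry q ?u = p" using u by (auto simp: base_op_def add.commute)
  then show "lmult q ?u = ?u" "passes_power (height g) p q"
    using passes_power_lcarry[OF u, of q] by (simp_all add: height_def)
qed

end

locale hnn_generated = hnn +
  assumes base_op_in_G: "base_op q \<in> G"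
begin

lemma transitive_on_states: "normal_form l \<Longrightarrow> \<exists>g\<in>G. g ([], 0) = (l, p)"
proof (induction l rule: normal_form.induct)
  case 1
  show ?case using base_op_in_G[of p] by (intro bexI[of _ "base_op p"]) simp_all
next
  case (2 e \<rho> l)
  then obtain g where g: "g \<in> G" "g ([], 0) = (l, p)" by auto
  have "stable_op e (l, p) = ((e, 0) # l, p)" using 2 by (auto simp: stable_op_def push_def)
  moreover have "normal_form ((e, 0) # l)" using 2 by auto
  then have "base_op \<rho> ((e, 0) # l, p) = ((e, \<rho>) # l, p)"
    using 2 by (simp add: base_op_def carry_def lmult_0 lcarry_0)
  ultimately have "(base_op \<rho> \<circ> (stable_op e \<circ> g)) ([], 0) = ((e, \<rho>) # l, p)" using g by simp
  moreover have "base_op \<rho> \<circ> (stable_op e \<circ> g) \<in> G"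
    by (intro G_comp base_op_in_G stable_op_in_G g(1))
  ultimately show ?case by (rule bexI)
qed

lemma conj_base_op_of_fixed_vertex:
  assumes g: "g \<in> G" and u: "normal_form u" "vertex_act g u = u"
  shows "\<exists>h\<in>G. \<exists>q. perm_inv h \<circ> g \<circ> h = base_op q"
proof -
  obtain h where h: "h \<in> G" "h ([], 0) = (u, 0)" using transitive_on_states[OF u(1)] by blast
  have "vertex_act (perm_inv h \<circ> g \<circ> h) [] =
      vertex_act (perm_inv h) (vertex_act g (vertex_act h []))"
    using vertex_act_comp[of "perm_inv h \<circ> g" h "[]"] vertex_act_comp[of "perm_inv h" g u]
      G_comp G_inv h g u by (simp add: vertex_act_def)
  also have "vertex_act g (vertex_act h []) = vertex_act h []" using u(2) h(2)
    by (simp add: vertex_act_def)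
  also have "vertex_act (perm_inv h) (vertex_act h []) = []"
    using vertex_act_comp[OF G_inv[OF h(1)] h(1), of "[]"] G_inv_comp[OF h(1)] by simp
  finally show ?thesis using G_stabilizer G_comp G_inv h(1) g by metis
qed

lemma conj_base_op_of_commuting:
  assumes x: "x \<in> G" "height x \<noteq> 0" and y: "y \<in> G" "height y = 0" and comm: "x \<circ> y = y \<circ> x"
  shows "\<exists>h\<in>G. \<exists>q. perm_inv h \<circ> y \<circ> h = base_op q \<and> passes_power (height x) q q"
proof -
  have "\<exists>u\<in>{u. normal_form u}. vertex_act y u = u"
  proof (rule tree.fixed_vertex_of_commuting[OF _ height_shift_vertex_act[OF x(1)] x(2)])
    show "tree.height_shift 0 (vertex_act y)" using height_shift_vertex_act[OF y(1)] y(2) by simp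
    show "vertex_act x (vertex_act y u) = vertex_act y (vertex_act x u)"
      if "u \<in> {u. normal_form u}" for u
      using vertex_act_comp[OF x(1) y(1), of u] vertex_act_comp[OF y(1) x(1), of u] comm that
      by simp
  qed (auto intro: exI[of _ "[]"])
  then obtain h q where h: "h \<in> G" "perm_inv h \<circ> y \<circ> h = base_op q"
    using conj_base_op_of_fixed_vertex[OF y(1)] by blast
  have "base_op q \<circ> (perm_inv h \<circ> x \<circ> h) = (perm_inv h \<circ> x \<circ> h) \<circ> base_op q"
    unfolding h(2)[symmetric] conj_comp[OF h(1)] comm by (rule refl)
  moreover have "perm_inv h \<circ> x \<circ> h \<in> G" by (intro G_comp G_inv h(1) x(1))
  ultimately have "passes_power (height (perm_inv h \<circ> x \<circ> h)) q q"
    by (rule conj_passes_power[rotated])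
  then show ?thesis using h height_conj[OF h(1) x(1)] by metis
qed

lemma conj_base_op_of_conj_power:
  assumes x: "x \<in> G" "height x = 0" and t: "t \<in> G" "height t \<noteq> 0" and y: "y \<in> G"
    and comm: "x \<circ> y = y \<circ> x" and conj: "t \<circ> x ^^ k = y \<circ> t" and k: "k > 0"
  shows "\<exists>h\<in>G. \<exists>q. perm_inv h \<circ> x \<circ> h = base_op q"
proof -
  have pow: "vertex_act (x ^^ n) u = (vertex_act x ^^ n) u" if "normal_form u" for n u
  proof (induction n)
    case 0
    have "x ^^ 0 = id" by (rule ext) simp
    then show ?case using vertex_act_id funpow_0 by metis
  next
    case (Suc n)
    then show ?case
      unfolding funpow.simps vertex_act_comp[OF x(1) G_funpow[OF x(1)] that] by simp
  qed
  have "\<exists>u\<in>{u. normal_form u}. vertex_act x u = u"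
  proof (rule tree.fixed_vertex_of_conj_power[OF _ height_shift_vertex_act[OF t(1)] t(2)
        tree.height_shift_embedding[OF height_shift_vertex_act[OF y]] _ _ k])
    show "tree.height_shift 0 (vertex_act x)" using height_shift_vertex_act[OF x(1)] x(2) by simp
    fix u assume "u \<in> {u. normal_form u}"
    then have u: "normal_form u" by simp
    show "vertex_act y (vertex_act x u) = vertex_act x (vertex_act y u)"
      using vertex_act_comp[OF x(1) y u] vertex_act_comp[OF y x(1) u] comm by simp
    show "vertex_act t ((vertex_act x ^^ k) u) = vertex_act y (vertex_act t u)"
      using vertex_act_comp[OF t(1) G_funpow[OF x(1)] u, of k] vertex_act_comp[OF y t(1) u]
        pow[OF u] conj by simp
  qed (auto intro: exI[of _ "[]"])
  then show ?thesis using conj_base_op_of_fixed_vertex[OF x(1)] by blast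
qed

end

text \<open>Here the elements of height zero form the union of the increasing sequence of the abelian
groups \<open>a\<^bsup>-i\<^esup> E a\<^bsup>i\<^esup>\<close>.\<close>

locale ascending_hnn = hnn +
  assumes ascending: "rep False q = 0"
begin

lemma stable_op_True_base_op: "stable_op True \<circ> base_op q = base_op (pass False q) \<circ> stable_op True"
  using stable_op_base_op[of True q] ascending by simp

lemma base_op_stable_op_False:
  "base_op q \<circ> stable_op False = stable_op False \<circ> base_op (pass False q)"
  using stable_op_base_op[of False "pass False q"] ascending rep_pass[of False q]
    pass_pass[of False q] by simp

lemma base_op_stable_op_False_funpow:
  "\<exists>q'. base_op q \<circ> stable_op False ^^ i = stable_op False ^^ i \<circ> base_op q'"
proof (induction i)
  case 0
  show ?case by (metis funpow.simps(1) comp_id id_comp)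
next
  case (Suc i)
  then obtain q' where q': "base_op q \<circ> stable_op False ^^ i = stable_op False ^^ i \<circ> base_op q'"
    by blast
  have "base_op q \<circ> stable_op False ^^ Suc i = stable_op False ^^ Suc i \<circ> base_op (pass False q')"
    unfolding funpow_Suc_right comp_assoc[symmetric] q'
    by (simp only: comp_assoc base_op_stable_op_False)
  then show ?case by blast
qed

lemma G_normal_form:
  "g \<in> G \<Longrightarrow> \<exists>i p j. g = stable_op False ^^ i \<circ> base_op p \<circ> stable_op True ^^ j"
proof (induction rule: G_induct_op)
  case id
  show ?case by (rule exI[of _ 0], rule exI[of _ 0], rule exI[of _ 0]) (simp add: base_op_0)
next
  case (stable e g)
  then obtain i p j where g: "g = stable_op False ^^ i \<circ> base_op p \<circ> stable_op True ^^ j" by blast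
  consider (a_inv) "\<not> e" | (a_base) "e" "i = 0" | (a_a_inv) i' where "e" "i = Suc i'"
    by (cases i) auto
  then show ?case
  proof cases
    case a_inv
    then have "stable_op e \<circ> g = stable_op False ^^ Suc i \<circ> base_op p \<circ> stable_op True ^^ j"
      by (simp only: g funpow.simps comp_assoc)
    then show ?thesis by blast
  next
    case a_base
    then have "stable_op e \<circ> g =
        stable_op False ^^ 0 \<circ> base_op (pass False p) \<circ> stable_op True ^^ Suc j"
      unfolding g funpow.simps id_comp comp_assoc[symmetric] stable_op_True_base_op[symmetric]
      by simp
    then show ?thesis by blast
  next
    case a_a_inv
    then have "stable_op e \<circ> g = stable_op False ^^ i' \<circ> base_op p \<circ> stable_op True ^^ j"
      using stable_op_stable_op[of True]
      by (simp only: g funpow.simps comp_assoc[symmetric] not_True_eq_False id_comp)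
    then show ?thesis by blast
  qed
next
  case (base q g)
  then obtain i p j where g: "g = stable_op False ^^ i \<circ> base_op p \<circ> stable_op True ^^ j" by blast
  obtain q' where "base_op q \<circ> stable_op False ^^ i = stable_op False ^^ i \<circ> base_op q'"
    using base_op_stable_op_False_funpow by blast
  then have "base_op q \<circ> g = stable_op False ^^ i \<circ> base_op (q' + p) \<circ> stable_op True ^^ j"
    unfolding g base_op_add by (simp only: comp_assoc[symmetric])
  then show ?case by blast
qed

lemma height_zero_normal_form:
  assumes g: "g \<in> G" "height g = 0"
  shows "\<exists>i. \<forall>n\<ge>i. \<exists>p. g = perm_inv (stable_op True ^^ n) \<circ> base_op p \<circ> stable_op True ^^ n"
proof -
  obtain i p j where ipj: "g = stable_op False ^^ i \<circ> base_op p \<circ> stable_op True ^^ j"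
    using G_normal_form[OF g(1)] by blast
  have "shifts_by (int i * - 1 + 0 + int j * 1) g"
    unfolding ipj using shifts_by_stable_op[of False] shifts_by_stable_op[of True]
    by (intro shifts_by_comp shifts_by_base_op shifts_by_funpow) simp_all
  then have j: "j = i" using g(2) shifts_by_height by fastforce
  have inv: "perm_inv (stable_op True ^^ n) = stable_op False ^^ n" for n
    using inv_fn[OF bij_G[OF stable_op_in_G[of True]], of n] by (simp add: perm_inv_stable_op)
  have "\<exists>p. g = stable_op False ^^ n \<circ> base_op p \<circ> stable_op True ^^ n" if "n \<ge> i" for n
    using that
  proof (induction n rule: dec_induct)
    case base
    show ?case using ipj j by blast
  next
    case (step n)
    then obtain p where p: "g = stable_op False ^^ n \<circ> base_op p \<circ> stable_op True ^^ n" by blast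
    have "base_op p = stable_op False \<circ> (stable_op True \<circ> base_op p)"
      using stable_op_stable_op[of False] by (metis comp_assoc id_comp not_False_eq_True)
    then have "g = stable_op False ^^ Suc n \<circ> base_op (pass False p) \<circ> stable_op True ^^ Suc n"
      unfolding stable_op_True_base_op p funpow.simps(2)[of n "stable_op True"]
        funpow_Suc_right[of n "stable_op False"] by (simp only: comp_assoc)
    then show ?case by blast
  qed
  then show ?thesis unfolding inv by blast
qed

lemma height_zero_commute:
  assumes "g \<in> G" "height g = 0" "h \<in> G" "height h = 0"
  shows "g \<circ> h = h \<circ> g"
proof -
  let ?conj = "\<lambda>n p. perm_inv (stable_op True ^^ n) \<circ> base_op p \<circ> stable_op True ^^ n"
  obtain i j where "\<forall>n\<ge>i. \<exists>p. g = ?conj n p" "\<forall>n\<ge>j. \<exists>q. h = ?conj n q"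
    using height_zero_normal_form assms by meson
  then obtain p q where "g = ?conj (max i j) p" "h = ?conj (max i j) q"
    by (metis max.cobounded1 max.cobounded2)
  then show ?thesis
    using conj_comp[OF G_funpow[OF stable_op_in_G]] base_op_commute by metis
qed

end

section \<open>Baumslag-Solitar groups\<close>

lemma cmod_add_dvd: "x dvd y \<Longrightarrow> (k + y) cmod x = k cmod x"
  by (simp add: centered_modulo_def mod_eq_dvd_iff)

lemma cmod_small:
  assumes "2 * \<bar>k\<bar> < \<bar>x\<bar>" shows "k cmod x = k"
proof -
  have "0 \<le> k + \<bar>x\<bar> div 2" "k + \<bar>x\<bar> div 2 < \<bar>x\<bar>" using assms by linarith+
  then show ?thesis by (simp add: centered_modulo_def)
qed

lemma cmod_eq_0_iff: "k cmod x = 0 \<longleftrightarrow> x dvd k"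
  using mult_cdiv_cmod_eq[of x k] cmod_add_dvd[of x k 0]
  by (metis add.right_neutral add_0 dvd_triv_left zero_cmod_eq)

text \<open>Centered residues, because a fixed integer is its own centered residue modulo every
sufficiently large \<open>x\<close>.\<close>

definition bs_rep :: "int \<Rightarrow> int \<Rightarrow> bool \<Rightarrow> int \<Rightarrow> int" where
  "bs_rep M x e k = (if e then k cmod x else k mod M)"

definition bs_pass :: "int \<Rightarrow> int \<Rightarrow> bool \<Rightarrow> int \<Rightarrow> int" where
  "bs_pass M x e k = (if e then (k div x) * M else (k div M) * x)"

lemma bs_rep_eq_0: "bs_rep M x e k = 0 \<longleftrightarrow> (if e then x else M) dvd k"
  by (simp add: bs_rep_def cmod_eq_0_iff mod_eq_0_iff_dvd)

lemma hnn_bs: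
  assumes "M > 0" "x \<noteq> 0"
  shows "hnn (bs_rep M x) (bs_pass M x)"
proof
  fix e :: bool and y k :: int
  show "bs_rep M x e 0 = 0" by (simp add: bs_rep_eq_0)
  show "bs_rep M x e (k - bs_rep M x e k) = 0"
    unfolding bs_rep_eq_0 by (simp add: bs_rep_def minus_cmod_eq_mult_cdiv)
  show "bs_rep M x e (k + y) = bs_rep M x e k" if "bs_rep M x e y = 0"
    using that cmod_add_dvd[of x y k] unfolding bs_rep_eq_0 by (auto simp: bs_rep_def elim!: dvdE)
  show "bs_pass M x e (k + y) = bs_pass M x e k + bs_pass M x e y"
    if "bs_rep M x e k = 0" "bs_rep M x e y = 0"
    using that assms unfolding bs_rep_eq_0
    by (auto simp: bs_pass_def algebra_simps elim!: dvdE simp flip: distrib_left split: if_splits)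
  show "bs_rep M x (\<not> e) (bs_pass M x e k) = 0" if "bs_rep M x e k = 0"
    unfolding bs_rep_eq_0 by (auto simp: bs_pass_def)
  show "bs_pass M x (\<not> e) (bs_pass M x e k) = k" if "bs_rep M x e k = 0"
    using that assms unfolding bs_rep_eq_0 by (auto simp: bs_pass_def elim!: dvdE split: if_splits)
qed

locale bs_relation = group K for K (structure) +
  fixes a b :: 'a and M x :: int
  assumes ab: "a \<in> carrier K" "b \<in> carrier K"
    and rel: "a \<otimes> b [^] M \<otimes> inv a = b [^] x"
    and M: "M > 0" and x: "x \<noteq> 0"
begin

lemma a_pow: "a \<otimes> b [^] (M * j) = b [^] (x * j) \<otimes> a"
proof -
  have "group_hom K K (\<lambda>g. a \<otimes> g \<otimes> inv a)"
    by unfold_locales (use ab in \<open>auto simp: hom_def m_assoc inv_solve_left\<close>)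
  from group_hom.hom_int_pow[OF this, of "b [^] M" j]
  have "a \<otimes> b [^] (M * j) \<otimes> inv a = b [^] (x * j)"
    using ab rel by (simp add: int_pow_pow)
  then show ?thesis using ab by (metis inv_closed inv_solve_right' m_closed int_pow_closed inv_inv)
qed

lemma a_inv_pow: "inv a \<otimes> b [^] (x * j) = b [^] (M * j) \<otimes> inv a"
  using a_pow[of j] ab
  by (metis inv_closed inv_solve_left inv_solve_right' int_pow_closed m_assoc m_closed)

sublocale hnn_evaluation "bs_rep M x" "bs_pass M x" 1 K
  "\<lambda>e. if e then a else inv a" "\<lambda>k. b [^] (k :: int)"
proof (intro hnn_evaluation.intro hnn_evaluation_axioms.intro hnn_bs[OF M x])
  show "Group.monoid K" by (rule is_monoid)
  fix e and k :: int
  assume "bs_rep M x e k = 0"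
  then obtain j where j: "k = (if e then x else M) * j" unfolding bs_rep_eq_0 by auto
  show "b [^] k \<otimes> (if e then a else inv a) = (if e then a else inv a) \<otimes> b [^] bs_pass M x e k"
    using a_pow[of j] a_inv_pow[of j] M x by (auto simp: j bs_pass_def mult.commute)
qed (use ab in \<open>auto simp: int_pow_mult\<close>)

end

lemma BSN_subset: "N \<lhd> FG \<Longrightarrow> BS_rel p q \<in> N \<Longrightarrow> BSN p q \<subseteq> N"
  by (auto simp: BSN_def)

lemma BS_rel_in_BSN: "BS_rel p q \<in> BSN p q"
  by (simp add: BSN_def)

lemma BS_rel_closed: "BS_rel p q \<in> carrier FG"
  by (simp add: BS_rel_def reduced_reduce)

lemma normal_BSN: "BSN p q \<lhd> FG"
proof -
  have "carrier FG \<lhd> FG"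
    by (rule FG.normal_invI[OF FG.subgroup_self]) (intro FG.m_closed FG.inv_closed)
  then have "{N. N \<lhd> FG \<and> BS_rel p q \<in> N} \<noteq> {}" using BS_rel_closed by blast
  then have "subgroup (BSN p q) FG"
    unfolding BSN_def by (rule FG.subgroups_Inter[rotated]) (auto simp: normal_imp_subgroup)
  moreover have "g \<otimes>\<^bsub>FG\<^esub> h \<otimes>\<^bsub>FG\<^esub> inv\<^bsub>FG\<^esub> g \<in> BSN p q"
    if "g \<in> carrier FG" "h \<in> BSN p q" for g h
    using that normal.inv_op_closed2 unfolding BSN_def by fastforce
  ultimately show ?thesis by (rule FG.normal_invI)
qed

lemma hom_BS_rel:
  assumes "group_hom FG K f"
  shows "f (BS_rel p q) =
    f gen_a \<otimes>\<^bsub>K\<^esub> f gen_b [^]\<^bsub>K\<^esub> p \<otimes>\<^bsub>K\<^esub> inv\<^bsub>K\<^esub> f gen_a \<otimes>\<^bsub>K\<^esub> inv\<^bsub>K\<^esub> (f gen_b [^]\<^bsub>K\<^esub> q)"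
proof -
  interpret group_hom FG K f by fact
  have "gen_a \<in> carrier FG" "gen_b \<in> carrier FG" by simp_all
  then show ?thesis unfolding BS_rel_def
    by (simp only: hom_mult hom_inv hom_int_pow FG.m_closed FG.inv_closed FG.int_pow_closed)
qed

lemma hom_BS_rel_eq_one_iff:
  assumes "group_hom FG K f"
  shows "f (BS_rel p q) = \<one>\<^bsub>K\<^esub> \<longleftrightarrow>
    f gen_a \<otimes>\<^bsub>K\<^esub> f gen_b [^]\<^bsub>K\<^esub> p \<otimes>\<^bsub>K\<^esub> inv\<^bsub>K\<^esub> f gen_a = f gen_b [^]\<^bsub>K\<^esub> q"
proof -
  interpret group_hom FG K f by fact
  have "f gen_a \<in> carrier K" "f gen_b \<in> carrier K" by simp_all
  then show ?thesis unfolding hom_BS_rel[OF assms]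
    by (subst H.inv_solve_right') simp_all
qed

lemma
  assumes "N \<lhd> FG"
  shows group_hom_coset: "group_hom FG (FG Mod N) (\<lambda>g. N #>\<^bsub>FG\<^esub> g)"
    and coset_eq_one_iff: "g \<in> carrier FG \<Longrightarrow> N #>\<^bsub>FG\<^esub> g = \<one>\<^bsub>FG Mod N\<^esub> \<longleftrightarrow> g \<in> N"
proof -
  interpret N: normal N FG by fact
  show "group_hom FG (FG Mod N) (\<lambda>g. N #>\<^bsub>FG\<^esub> g)"
    by (intro group_hom.intro group_hom_axioms.intro group_FG N.factorgroup_is_group
        N.r_coset_hom_Mod)
  show "N #>\<^bsub>FG\<^esub> g = \<one>\<^bsub>FG Mod N\<^esub> \<longleftrightarrow> g \<in> N" if "g \<in> carrier FG"
    using FG.coset_join1[OF _ that N.is_subgroup] FG.coset_join2[OF that N.is_subgroup]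
    by (auto simp: FactGroup_def)
qed

lemma hom_eq_one_of_trivial_action:
  assumes f: "group_hom FG K f" and rel: "f (BS_rel M x) = \<one>\<^bsub>K\<^esub>" and M: "M > 0" and x: "x \<noteq> 0"
    and w: "reduced w" "foldr (hnn.letter_op (bs_rep M x) (bs_pass M x) 1) w ([], 0) = ([], 0)"
  shows "f w = \<one>\<^bsub>K\<^esub>"
proof -
  interpret f: group_hom FG K f by (rule f)
  interpret bs_relation K "f gen_a" "f gen_b" M x
    by unfold_locales (use M x rel hom_BS_rel_eq_one_iff[OF f] in auto)
  have letter: "letter_value l = f [l]" for l
  proof -
    obtain g i where l: "l = (g, i)" by (cases l)
    have "f [(g, True)] = inv\<^bsub>K\<^esub> f [(g, False)]"
      using f.hom_inv[of "[(g, False)]"] by (simp add: inv_FG_generator)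
    moreover have "f gen_b [^]\<^bsub>K\<^esub> (- 1 :: int) = inv\<^bsub>K\<^esub> f gen_b"
      using f.H.int_pow_neg[of "f gen_b" 1] ab(2) by simp
    ultimately show ?thesis unfolding l letter_value_def
      using ab by (cases g; cases i) (simp_all add: gen_a_def gen_b_def)
  qed
  have "f w = evaluate (foldr letter_op w ([], 0))"
    using FG_hom_foldr[OF f w(1)] evaluate_foldr[of w] by (simp add: letter)
  then show ?thesis using w(2) by simp
qed

lemma BS_rel_in_act_kernel:
  assumes "M > 0" "x \<noteq> 0"
  shows "BS_rel M x \<in> letter_permutation.act_kernel (hnn.letter_op (bs_rep M x) (bs_pass M x) 1)"
proof -
  interpret hnn "bs_rep M x" "bs_pass M x" 1 by (rule hnn_bs[OF assms])
  have gens: "foldr letter_op gen_a = stable_op True" "foldr letter_op gen_b = base_op 1"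
    by (simp_all add: gen_a_def gen_b_def letter_op_def fun_eq_iff)
  have gen: "gen_a \<in> carrier FG" "gen_b \<in> carrier FG" by simp_all
  have pow: "foldr letter_op (gen_b [^]\<^bsub>FG\<^esub> k) = base_op k" for k :: int
  proof (induction k rule: int_induct[of _ 0])
    case base
    show ?case by (simp add: base_op_0)
  next
    case (step1 k)
    have "gen_b [^]\<^bsub>FG\<^esub> (k + 1) = gen_b [^]\<^bsub>FG\<^esub> k \<otimes>\<^bsub>FG\<^esub> gen_b"
      using FG.int_pow_mult[OF gen(2), of k 1] gen(2) by simp
    then show ?case unfolding base_op_add using step1 gens(2) foldr_mult by metis
  next
    case (step2 k)
    have "gen_b [^]\<^bsub>FG\<^esub> (k - 1) = gen_b [^]\<^bsub>FG\<^esub> k \<otimes>\<^bsub>FG\<^esub> inv\<^bsub>FG\<^esub> gen_b"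
      using FG.int_pow_diff[OF gen(2), of k 1] gen(2) by simp
    then have "foldr letter_op (gen_b [^]\<^bsub>FG\<^esub> (k - 1)) = base_op k \<circ> base_op (- 1)"
      using step2 gens(2) foldr_mult foldr_inv[OF gen(2)] perm_inv_base_op by metis
    then show ?case by (simp flip: base_op_add)
  qed
  have "bs_rep M x False M = 0" "bs_pass M x False M = x"
    using assms by (simp_all add: bs_rep_def bs_pass_def)
  then have "stable_op True \<circ> base_op M = base_op x \<circ> stable_op True"
    using stable_op_base_op[of True M] by simp
  then have "stable_op True \<circ> base_op M \<circ> stable_op False \<circ> base_op (- x) = id"
    using stable_op_stable_op[of True] base_op_uminus(2)[of x] by (simp add: comp_assoc)
  moreover have "foldr letter_op (BS_rel M x) =
      stable_op True \<circ> base_op M \<circ> stable_op False \<circ> base_op (- x)"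
    unfolding BS_rel_def foldr_mult pow gens(1) foldr_inv[OF gen(1)]
      foldr_inv[OF FG.int_pow_closed[OF gen(2)]] perm_inv_base_op perm_inv_stable_op by simp
  ultimately show ?thesis using BS_rel_closed by (simp add: act_kernel_def)
qed

theorem BSN_eq_act_kernel:
  assumes "M > 0" "x \<noteq> 0"
  shows "BSN M x = letter_permutation.act_kernel (hnn.letter_op (bs_rep M x) (bs_pass M x) 1)"
proof
  interpret hnn "bs_rep M x" "bs_pass M x" 1 by (rule hnn_bs[OF assms])
  show "BSN M x \<subseteq> act_kernel"
    by (rule BSN_subset[OF normal_act_kernel BS_rel_in_act_kernel[OF assms]])
  let ?f = "\<lambda>g. BSN M x #>\<^bsub>FG\<^esub> g"
  note hom = group_hom_coset[OF normal_BSN[of M x]]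
    and kernel = coset_eq_one_iff[OF normal_BSN[of M x]]
  have rel: "?f (BS_rel M x) = \<one>\<^bsub>FG Mod BSN M x\<^esub>"
    using kernel[OF BS_rel_closed] BS_rel_in_BSN by blast
  show "act_kernel \<subseteq> BSN M x"
  proof
    fix w assume w: "w \<in> act_kernel"
    then have "reduced w" by (simp add: act_kernel_def)
    then show "w \<in> BSN M x"
      using hom_eq_one_of_trivial_action[OF hom rel assms] w act_kernel_iff kernel
      by simp
  qed
qed

lemma BSN_uminus: "BSN (- p) (- q) = BSN p q"
proof -
  have "BS_rel (- p) (- q) \<in> BSN p q" for p q
  proof -
    let ?f = "\<lambda>g. BSN p q #>\<^bsub>FG\<^esub> g" and ?Q = "FG Mod BSN p q"
    note hom = group_hom_coset[OF normal_BSN[of p q]]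
      and kernel = coset_eq_one_iff[OF normal_BSN[of p q]]
    interpret f: group_hom FG ?Q ?f by (rule hom)
    have ab: "?f gen_a \<in> carrier ?Q" "?f gen_b \<in> carrier ?Q" by (intro f.hom_closed; simp)+
    have "?f gen_a \<otimes>\<^bsub>?Q\<^esub> ?f gen_b [^]\<^bsub>?Q\<^esub> p \<otimes>\<^bsub>?Q\<^esub> inv\<^bsub>?Q\<^esub> ?f gen_a = ?f gen_b [^]\<^bsub>?Q\<^esub> q"
      using hom_BS_rel_eq_one_iff[OF hom] kernel[OF BS_rel_closed] BS_rel_in_BSN by blast
    then have "inv\<^bsub>?Q\<^esub> (?f gen_a \<otimes>\<^bsub>?Q\<^esub> ?f gen_b [^]\<^bsub>?Q\<^esub> p \<otimes>\<^bsub>?Q\<^esub> inv\<^bsub>?Q\<^esub> ?f gen_a) = ?f gen_b [^]\<^bsub>?Q\<^esub> (- q)"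
      using f.H.int_pow_neg[OF ab(2)] by simp
    then have "?f gen_a \<otimes>\<^bsub>?Q\<^esub> ?f gen_b [^]\<^bsub>?Q\<^esub> (- p) \<otimes>\<^bsub>?Q\<^esub> inv\<^bsub>?Q\<^esub> ?f gen_a = ?f gen_b [^]\<^bsub>?Q\<^esub> (- q)"
      using ab by (simp only: f.H.inv_mult_group f.H.int_pow_neg f.H.inv_inv f.H.m_closed
          f.H.inv_closed f.H.int_pow_closed f.H.m_assoc)
    then show ?thesis using hom_BS_rel_eq_one_iff[OF hom] kernel[OF BS_rel_closed] by blast
  qed
  from this[of p q] this[of "- p" "- q"] show ?thesis
    by (intro subset_antisym BSN_subset[OF normal_BSN]) simp_all
qed

section \<open>Digits\<close>

fun digit_quot :: "int \<Rightarrow> int \<Rightarrow> nat \<Rightarrow> int" where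
  "digit_quot M x 0 = 1"
| "digit_quot M x (Suc i) = (x * digit_quot M x i) div M"

text \<open>These are the \<open>s\<^sub>i\<close> and \<open>r\<^sub>i\<close> of the paper, except that \<open>r\<^sub>0\<close> is \<open>1\<close> instead of \<open>0\<close>: the
linear map with \<open>e\<^sub>i \<mapsto> r\<^sub>i\<close> for all \<open>i\<close> then detects \<open>E\<^bsub>m,\<xi>\<^esub>\<close> as the preimage of \<open>m\<int>\<close>.\<close>

fun digit :: "int \<Rightarrow> int \<Rightarrow> nat \<Rightarrow> int" where
  "digit M x 0 = 1"
| "digit M x (Suc i) = (x * digit_quot M x i) mod M"

lemma digit_quot_Suc: "x * digit_quot M x i = M * digit_quot M x (Suc i) + digit M x (Suc i)"
  by simp

lemma digit_bounds: "M > 0 \<Longrightarrow> i > 0 \<Longrightarrow> 0 \<le> digit M x i \<and> digit M x i < M"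
  by (cases i) auto

lemma digit_quot_diff:
  assumes "digit M x (Suc i) = digit M x' (Suc i)"
  shows "M * (digit_quot M x (Suc i) - digit_quot M x' (Suc i)) =
    x * (digit_quot M x i - digit_quot M x' i) + (x - x') * digit_quot M x' i"
proof -
  have "M * (digit_quot M x (Suc i) - digit_quot M x' (Suc i)) =
      x * digit_quot M x i - x' * digit_quot M x' i"
    using digit_quot_Suc[of x M i] digit_quot_Suc[of x' M i] assms
    by (simp only: right_diff_distrib)
  then show ?thesis by (simp only: algebra_simps)
qed

lemma digit_cong:
  assumes M: "M = d * K" "d > 0" "K > 0" and d: "d dvd x" and dvd: "d * K ^ n dvd x - x'"
    and i: "i \<le> n"
  shows "digit M x i = digit M x' i"
proof -
  have "K ^ (n - i) dvd digit_quot M x i - digit_quot M x' i \<and> digit M x i = digit M x' i"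
    using i
  proof (induction i)
    case (Suc i)
    define D where "D = x * digit_quot M x i - x' * digit_quot M x' i"
    have "d * K ^ (n - i) dvd x * (digit_quot M x i - digit_quot M x' i)"
      using Suc d by (intro mult_dvd_mono) auto
    moreover have "d * K ^ (n - i) dvd d * K ^ n" by (simp add: le_imp_power_dvd)
    then have "d * K ^ (n - i) dvd (x - x') * digit_quot M x' i"
      using dvd by (meson dvd_mult2 dvd_trans)
    moreover have "D = x * (digit_quot M x i - digit_quot M x' i) + (x - x') * digit_quot M x' i"
      by (simp add: D_def algebra_simps)
    ultimately have "d * K ^ (n - i) dvd D" by simp
    moreover have "d * K ^ (n - i) = M * K ^ (n - Suc i)"
      using Suc.prems M by (simp add: Suc_diff_Suc flip: power_Suc)
    ultimately have D: "M * K ^ (n - Suc i) dvd D" by simp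
    then have "M dvd D" by (rule dvd_mult_left)
    then have r: "digit M x (Suc i) = digit M x' (Suc i)" by (simp add: D_def mod_eq_dvd_iff)
    then have "D = M * (digit_quot M x (Suc i) - digit_quot M x' (Suc i))"
      unfolding digit_quot_diff[OF r] D_def by (simp add: algebra_simps)
    then show ?case using D r M by simp
  qed simp
  then show ?thesis by blast
qed

lemma digit_quot_diff_coprime:
  assumes M: "M = d * K" "d > 0" and x: "x = d * \<eta>" "x' = d * \<eta>'" and cop: "coprime \<eta> K"
    and eq: "\<And>i. i \<le> Suc n \<Longrightarrow> digit M x i = digit M x' i"
  shows "\<exists>u. coprime u K \<and>
    K ^ Suc n * (digit_quot M x (Suc n) - digit_quot M x' (Suc n)) = (\<eta> - \<eta>') * u"
  using eq
proof (induction n)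
  case 0
  have "d * (K * (digit_quot M x 1 - digit_quot M x' 1)) = d * (\<eta> - \<eta>')"
    using digit_quot_diff[of M x 0 x'] 0[of 1] unfolding M(1) x by (simp add: algebra_simps)
  then show ?case using M(2) by (intro exI[of _ 1]) simp
next
  case (Suc n)
  let ?s = "digit_quot M x" and ?s' = "digit_quot M x'"
  obtain u where u: "coprime u K" "K ^ Suc n * (?s (Suc n) - ?s' (Suc n)) = (\<eta> - \<eta>') * u"
    using Suc by auto
  define w where "w = (K ^ n * ?s' (Suc n)) * K + \<eta> * u"
  have "d * (K * (?s (Suc (Suc n)) - ?s' (Suc (Suc n)))) =
      d * (\<eta> * (?s (Suc n) - ?s' (Suc n)) + (\<eta> - \<eta>') * ?s' (Suc n))"
    using digit_quot_diff[of M x "Suc n" x'] Suc.prems[of "Suc (Suc n)"] unfolding M(1) x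
    by (simp only: algebra_simps)
  then have "K * (?s (Suc (Suc n)) - ?s' (Suc (Suc n))) =
      \<eta> * (?s (Suc n) - ?s' (Suc n)) + (\<eta> - \<eta>') * ?s' (Suc n)"
    using M(2) by simp
  then have "K ^ Suc (Suc n) * (?s (Suc (Suc n)) - ?s' (Suc (Suc n))) =
      \<eta> * (K ^ Suc n * (?s (Suc n) - ?s' (Suc n))) + (\<eta> - \<eta>') * (K ^ Suc n * ?s' (Suc n))"
    by (metis (no_types, lifting) distrib_left mult.assoc mult.left_commute power_Suc2)
  also have "\<dots> = (\<eta> - \<eta>') * w"
    unfolding u(2) w_def by (simp add: algebra_simps)
  finally have "K ^ Suc (Suc n) * (?s (Suc (Suc n)) - ?s' (Suc (Suc n))) = (\<eta> - \<eta>') * w" .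
  moreover have "gcd K w = gcd K (\<eta> * u)" unfolding w_def by (rule gcd_add_mult)
  then have "coprime w K"
    using cop u(1) by (metis coprime_iff_gcd_eq_1 coprime_mult_left_iff gcd.commute)
  ultimately show ?case by blast
qed

theorem digits_upto_eq_iff:
  assumes M: "M = d * K" "d > 0" "K > 0" and x: "x = d * \<eta>" "x' = d * \<eta>'" and cop: "coprime \<eta> K"
  shows "(\<forall>i\<le>n. digit M x i = digit M x' i) \<longleftrightarrow> d * K ^ n dvd x - x'"
proof
  assume eq: "\<forall>i\<le>n. digit M x i = digit M x' i"
  show "d * K ^ n dvd x - x'"
  proof (cases n)
    case 0
    then show ?thesis by (simp add: x)
  next
    case (Suc k)
    then obtain u where u: "coprime u K"
      "K ^ n * (digit_quot M x n - digit_quot M x' n) = (\<eta> - \<eta>') * u"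
      using digit_quot_diff_coprime[OF M(1,2) x cop, of k] eq by auto
    then have "K ^ n dvd (\<eta> - \<eta>') * u" by (metis dvd_triv_left)
    then have "K ^ n dvd \<eta> - \<eta>'"
      using u(1) coprime_dvd_mult_left_iff[of "K ^ n" u "\<eta> - \<eta>'"] by (simp add: coprime_commute)
    then show ?thesis unfolding x by (simp flip: right_diff_distrib)
  qed
next
  assume "d * K ^ n dvd x - x'"
  then show "\<forall>i\<le>n. digit M x i = digit M x' i"
    using digit_cong[OF M] x(1) by simp
qed

section \<open>The ring of m-adic integers\<close>

lemma Zadic_bounds: "\<xi> \<in> Zadic m \<Longrightarrow> 0 \<le> \<xi> j \<and> \<xi> j < \<bar>m\<bar> ^ j"
  by (simp add: Zadic_def)

lemma Zadic_mod:
  assumes "\<xi> \<in> Zadic m" "j \<le> n"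
  shows "\<xi> n mod \<bar>m\<bar> ^ j = \<xi> j"
  using assms(2)
proof (induction n rule: dec_induct)
  case base
  show ?case using Zadic_bounds[OF assms(1)] by simp
next
  case (step n)
  have "\<xi> (Suc n) mod \<bar>m\<bar> ^ n = \<xi> n" using assms(1) by (simp add: Zadic_def)
  then show ?case
    using step mod_mod_cancel[of "\<bar>m\<bar> ^ j" "\<bar>m\<bar> ^ n" "\<xi> (Suc n)"] by (simp add: le_imp_power_dvd)
qed

lemma Zadic_cong: "\<xi> \<in> Zadic m \<Longrightarrow> j \<le> n \<Longrightarrow> \<bar>m\<bar> ^ j dvd \<xi> n - \<xi> j"
  using Zadic_mod[of \<xi> m j n] Zadic_mod[of \<xi> m j j] by (simp flip: mod_eq_dvd_iff)

lemma ZadicI: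
  assumes "m \<noteq> 0" "\<And>j. \<bar>m\<bar> ^ j dvd c (Suc j) - c j"
  shows "(\<lambda>j. c j mod \<bar>m\<bar> ^ j) \<in> Zadic m"
proof -
  have "(c (Suc j) mod \<bar>m\<bar> ^ Suc j) mod \<bar>m\<bar> ^ j = c j mod \<bar>m\<bar> ^ j" for j
  proof -
    have "(c (Suc j) mod \<bar>m\<bar> ^ Suc j) mod \<bar>m\<bar> ^ j = c (Suc j) mod \<bar>m\<bar> ^ j"
      by (rule mod_mod_cancel) simp
    also have "\<dots> = c j mod \<bar>m\<bar> ^ j" using assms(2)[of j] by (simp only: mod_eq_dvd_iff)
    finally show ?thesis .
  qed
  then show ?thesis using assms(1) by (simp add: Zadic_def)
qed

lemma adic_of_int_closed: "m \<noteq> 0 \<Longrightarrow> adic_of_int m k \<in> Zadic m"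
  unfolding adic_of_int_def by (rule ZadicI) simp_all

lemma adic_mul_closed:
  assumes "m \<noteq> 0" "x \<in> Zadic m" "y \<in> Zadic m"
  shows "adic_mul m x y \<in> Zadic m"
  unfolding adic_mul_def
proof (rule ZadicI[OF assms(1)])
  fix j
  have "x (Suc j) * y (Suc j) - x j * y j = x (Suc j) * (y (Suc j) - y j) + y j * (x (Suc j) - x j)"
    by (simp add: algebra_simps)
  then show "\<bar>m\<bar> ^ j dvd x (Suc j) * y (Suc j) - x j * y j"
    using Zadic_cong[OF assms(2), of j "Suc j"] Zadic_cong[OF assms(3), of j "Suc j"] by simp
qed

lemma adic_add_closed:
  assumes "m \<noteq> 0" "x \<in> Zadic m" "y \<in> Zadic m"
  shows "adic_add m x y \<in> Zadic m"
  unfolding adic_add_def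
proof (rule ZadicI[OF assms(1)])
  fix j
  have "x (Suc j) + y (Suc j) - (x j + y j) = (x (Suc j) - x j) + (y (Suc j) - y j)" by simp
  then show "\<bar>m\<bar> ^ j dvd x (Suc j) + y (Suc j) - (x j + y j)"
    using Zadic_cong[OF assms(2), of j "Suc j"] Zadic_cong[OF assms(3), of j "Suc j"]
    by (metis dvd_add le_SucI order_refl)
qed

lemma adic_smul_closed: "m \<noteq> 0 \<Longrightarrow> x \<in> Zadic m \<Longrightarrow> adic_smul m c x \<in> Zadic m"
  by (simp add: adic_smul_def adic_mul_closed adic_of_int_closed)

lemma adic_smul_apply: "adic_smul m c x j = (c * x j) mod \<bar>m\<bar> ^ j"
  by (simp add: adic_smul_def adic_mul_def adic_of_int_def mod_mult_left_eq)

lemma Zadic_Suc_mod: "\<xi> \<in> Zadic m \<Longrightarrow> \<xi> (Suc j) mod \<bar>m\<bar> = \<xi> 1 mod \<bar>m\<bar>"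
  using Zadic_mod[of \<xi> m 1 "Suc j"] Zadic_mod[of \<xi> m 1 1] by simp

lemma dvd_Zadic:
  assumes "\<xi> \<in> Zadic m" "d dvd m" "d dvd \<xi> 1"
  shows "d dvd \<xi> (Suc j)"
proof -
  have "d dvd \<xi> (Suc j) - \<xi> 1" using Zadic_Suc_mod[OF assms(1), of j] assms(2)
    by (metis dvd_abs_iff dvd_trans mod_eq_dvd_iff)
  then show ?thesis using assms(3) by (metis dvd_add diff_add_cancel)
qed

lemma dvd_adic_smul: "d dvd m \<Longrightarrow> d dvd adic_smul m d x 1"
  by (simp add: adic_smul_apply dvd_mod)

lemma adic_div_unique:
  assumes m: "m \<noteq> 0" and d: "d dvd m" and \<eta>: "\<eta> \<in> Zadic m"
  shows "\<eta> j = (adic_smul m d \<eta> (Suc j) div d) mod \<bar>m\<bar> ^ j"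
proof -
  let ?\<xi> = "adic_smul m d \<eta>"
  have d0: "d \<noteq> 0" using d m by auto
  have "\<bar>m\<bar> ^ Suc j dvd ?\<xi> (Suc j) - d * \<eta> (Suc j)"
    by (simp add: adic_smul_apply flip: mod_eq_dvd_iff)
  moreover have "?\<xi> (Suc j) = d * (?\<xi> (Suc j) div d)"
    using dvd_Zadic[OF adic_smul_closed[OF m \<eta>] d dvd_adic_smul[OF d]] by simp
  moreover have "d * \<bar>m\<bar> ^ j dvd \<bar>m\<bar> ^ Suc j" using d by (simp add: mult_dvd_mono)
  ultimately have "d * \<bar>m\<bar> ^ j dvd d * (?\<xi> (Suc j) div d - \<eta> (Suc j))"
    by (metis dvd_trans right_diff_distrib)
  then have "\<bar>m\<bar> ^ j dvd ?\<xi> (Suc j) div d - \<eta> (Suc j)" using d0 by simp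
  then have "(?\<xi> (Suc j) div d) mod \<bar>m\<bar> ^ j = \<eta> (Suc j) mod \<bar>m\<bar> ^ j" by (simp only: mod_eq_dvd_iff)
  then show ?thesis using Zadic_mod[OF \<eta>, of j "Suc j"] by simp
qed

lemma
  assumes m: "m \<noteq> 0" and \<xi>: "\<xi> \<in> Zadic m" and d: "d dvd m" "d dvd \<xi> 1"
  shows adic_quotient_closed: "(\<lambda>j. (\<xi> (Suc j) div d) mod \<bar>m\<bar> ^ j) \<in> Zadic m"
    and adic_smul_quotient: "adic_smul m d (\<lambda>j. (\<xi> (Suc j) div d) mod \<bar>m\<bar> ^ j) = \<xi>"
proof -
  have d0: "d \<noteq> 0" using d m by auto
  note dvd = dvd_Zadic[OF \<xi> d]
  have "\<bar>m\<bar> ^ j dvd \<xi> (Suc (Suc j)) div d - \<xi> (Suc j) div d" for j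
  proof -
    have "d * (\<xi> (Suc (Suc j)) div d - \<xi> (Suc j) div d) = \<xi> (Suc (Suc j)) - \<xi> (Suc j)"
      using dvd by (simp add: right_diff_distrib)
    moreover have "\<bar>m\<bar> ^ Suc j dvd \<xi> (Suc (Suc j)) - \<xi> (Suc j)" by (rule Zadic_cong[OF \<xi>]) simp
    moreover have "d * \<bar>m\<bar> ^ j dvd \<bar>m\<bar> ^ Suc j" using d(1) by (simp add: mult_dvd_mono)
    ultimately have "d * \<bar>m\<bar> ^ j dvd d * (\<xi> (Suc (Suc j)) div d - \<xi> (Suc j) div d)"
      by (metis dvd_trans)
    then show ?thesis using d0 by simp
  qed
  then show "(\<lambda>j. (\<xi> (Suc j) div d) mod \<bar>m\<bar> ^ j) \<in> Zadic m" by (rule ZadicI[OF m])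
  show "adic_smul m d (\<lambda>j. (\<xi> (Suc j) div d) mod \<bar>m\<bar> ^ j) = \<xi>"
    using dvd Zadic_mod[OF \<xi>] by (simp add: fun_eq_iff adic_smul_apply mod_mult_right_eq)
qed

lemma adic_div_eq:
  assumes "m \<noteq> 0" "\<xi> \<in> Zadic m" "d dvd m" "d dvd \<xi> 1"
  shows "adic_div m \<xi> d = (\<lambda>j. (\<xi> (Suc j) div d) mod \<bar>m\<bar> ^ j)"
  unfolding adic_div_def
proof (rule the_equality)
  show "(\<lambda>j. (\<xi> (Suc j) div d) mod \<bar>m\<bar> ^ j) \<in> Zadic m \<and>
      adic_smul m d (\<lambda>j. (\<xi> (Suc j) div d) mod \<bar>m\<bar> ^ j) = \<xi>"
    using adic_quotient_closed[OF assms] adic_smul_quotient[OF assms] by blast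
qed (use adic_div_unique[OF assms(1,3)] in blast)

lemma adic_multiples_eq:
  assumes "m \<noteq> 0" "d dvd m"
  shows "{adic_smul m d z | z. z \<in> Zadic m} = {\<zeta> \<in> Zadic m. d dvd \<zeta> 1}"
proof (intro equalityI subsetI)
  fix \<zeta> assume "\<zeta> \<in> {\<zeta> \<in> Zadic m. d dvd \<zeta> 1}"
  then show "\<zeta> \<in> {adic_smul m d z | z. z \<in> Zadic m}"
    using adic_quotient_closed[OF assms(1) _ assms(2)] adic_smul_quotient[OF assms(1) _ assms(2)]
    by (metis (mono_tags, lifting) mem_Collect_eq)
qed (use adic_smul_closed dvd_adic_smul assms in auto)

lemma adic_ideal_eq:
  assumes m: "m \<noteq> 0" and \<xi>: "\<xi> \<in> Zadic m"
  shows "{adic_add m (adic_smul m m x) (adic_mul m \<xi> y) | x y. x \<in> Zadic m \<and> y \<in> Zadic m}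
    = {\<zeta> \<in> Zadic m. gcd m (\<xi> 1) dvd \<zeta> 1}" (is "?I = ?J")
proof (intro equalityI subsetI)
  fix \<zeta> assume "\<zeta> \<in> ?I"
  then obtain x y where xy: "x \<in> Zadic m" "y \<in> Zadic m"
    and \<zeta>: "\<zeta> = adic_add m (adic_smul m m x) (adic_mul m \<xi> y)" by blast
  have "\<zeta> \<in> Zadic m"
    unfolding \<zeta> by (intro adic_add_closed adic_smul_closed adic_mul_closed m \<xi> xy)
  moreover have "gcd m (\<xi> 1) dvd \<zeta> 1"
    by (simp add: \<zeta> adic_add_def adic_smul_apply adic_mul_def dvd_mod mod_add_eq)
  ultimately show "\<zeta> \<in> ?J" by simp
next
  fix \<zeta> assume "\<zeta> \<in> ?J"
  then have \<zeta>: "\<zeta> \<in> Zadic m" and "gcd m (\<xi> 1) dvd \<zeta> 1" by auto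
  then obtain t where t: "\<zeta> 1 = gcd m (\<xi> 1) * t" by auto
  obtain u v where uv: "u * m + v * \<xi> 1 = gcd m (\<xi> 1)" using bezout_int[of m "\<xi> 1"] by auto
  define y where "y = adic_of_int m (v * t)"
  define \<zeta>' where "\<zeta>' = adic_add m \<zeta> (adic_smul m (- 1) (adic_mul m \<xi> y))"
  have y: "y \<in> Zadic m" unfolding y_def by (rule adic_of_int_closed[OF m])
  have \<zeta>': "\<zeta>' \<in> Zadic m"
    unfolding \<zeta>'_def by (intro adic_add_closed adic_smul_closed adic_mul_closed m \<xi> \<zeta> y)
  have \<zeta>'_apply: "\<zeta>' j = (\<zeta> j - \<xi> j * (v * t)) mod \<bar>m\<bar> ^ j" for j
    by (simp add: \<zeta>'_def adic_add_def adic_smul_apply adic_mul_def y_def adic_of_int_def mod_simps)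
  have "\<zeta> 1 - \<xi> 1 * (v * t) = m * (u * t)" unfolding t uv[symmetric] by (simp add: algebra_simps)
  then have "m dvd \<zeta>' 1" by (simp add: \<zeta>'_apply dvd_mod)
  then have "\<zeta>' \<in> {adic_smul m m z | z. z \<in> Zadic m}"
    unfolding adic_multiples_eq[OF m dvd_refl] using \<zeta>' by simp
  then obtain x where x: "x \<in> Zadic m" "adic_smul m m x = \<zeta>'" by blast
  have "\<zeta> j = adic_add m \<zeta>' (adic_mul m \<xi> y) j" for j
    using Zadic_mod[OF \<zeta>, of j j]
    by (simp add: adic_add_def \<zeta>'_apply adic_mul_def y_def adic_of_int_def mod_simps)
  then have "\<zeta> = adic_add m (adic_smul m m x) (adic_mul m \<xi> y)" unfolding x(2) by blast
  then show "\<zeta> \<in> ?I" using x(1) y by blast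
qed

lemma adic_multiples_subsetD:
  assumes "m \<noteq> 0" "c dvd m" "{\<zeta> \<in> Zadic m. d dvd \<zeta> 1} \<subseteq> {\<zeta> \<in> Zadic m. c dvd \<zeta> 1}" "d dvd m"
  shows "c dvd d"
proof -
  have "d dvd adic_of_int m d 1" using assms(4) by (simp add: adic_of_int_def dvd_mod)
  then have "c dvd adic_of_int m d 1" using assms(3) adic_of_int_closed[OF assms(1)] by blast
  then show ?thesis using assms(2) by (simp add: adic_of_int_def dvd_mod_iff)
qed

theorem adic_gcd_eq:
  assumes m: "m \<noteq> 0" and \<xi>: "\<xi> \<in> Zadic m"
  shows "adic_gcd m m \<xi> = gcd m (\<xi> 1)"
  unfolding adic_gcd_def adic_ideal_eq[OF m \<xi>]
proof (rule the_equality)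
  show "gcd m (\<xi> 1) > 0 \<and> gcd m (\<xi> 1) dvd m \<and>
      {\<zeta> \<in> Zadic m. gcd m (\<xi> 1) dvd \<zeta> 1} = {adic_smul m (gcd m (\<xi> 1)) z | z. z \<in> Zadic m}"
    using adic_multiples_eq[OF m, of "gcd m (\<xi> 1)"] m by simp
next
  fix d assume d: "d > 0 \<and> d dvd m \<and>
    {\<zeta> \<in> Zadic m. gcd m (\<xi> 1) dvd \<zeta> 1} = {adic_smul m d z | z. z \<in> Zadic m}"
  then have "{\<zeta> \<in> Zadic m. gcd m (\<xi> 1) dvd \<zeta> 1} = {\<zeta> \<in> Zadic m. d dvd \<zeta> 1}"
    using adic_multiples_eq[OF m, of d] by simp
  then have "d dvd gcd m (\<xi> 1)" "gcd m (\<xi> 1) dvd d"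
    using adic_multiples_subsetD[OF m, of d "gcd m (\<xi> 1)"]
      adic_multiples_subsetD[OF m, of "gcd m (\<xi> 1)" d] d
    by simp_all
  then show "d = gcd m (\<xi> 1)" using d by (intro zdvd_antisym_nonneg) simp_all
qed

lemma adic_proj_adic_div_eq_iff:
  assumes m: "m \<noteq> 0" and \<xi>: "\<xi> \<in> Zadic m" and \<zeta>: "\<zeta> \<in> Zadic m"
    and d: "d dvd m" "d dvd \<xi> 1" "d dvd \<zeta> 1"
  shows "adic_proj (m div d) (adic_div m \<xi> d) = adic_proj (m div d) (adic_div m \<zeta> d) \<longleftrightarrow>
    (\<forall>j. d * \<bar>m div d\<bar> ^ j dvd \<xi> (Suc j) - \<zeta> (Suc j))"
proof -
  have d0: "d \<noteq> 0" using d m by auto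
  have "\<bar>m div d\<bar> ^ j dvd \<bar>m\<bar> ^ j" for j
    using d(1) by (intro dvd_power_same) (simp add: div_dvd_iff_mult[OF d0 d(1)])
  then have "adic_proj (m div d) (adic_div m x d) = (\<lambda>j. (x (Suc j) div d) mod \<bar>m div d\<bar> ^ j)"
    if "x \<in> Zadic m" "d dvd x 1" for x
    unfolding adic_div_eq[OF m that(1) d(1) that(2)] adic_proj_def by (simp add: mod_mod_cancel)
  then have "adic_proj (m div d) (adic_div m \<xi> d) = adic_proj (m div d) (adic_div m \<zeta> d) \<longleftrightarrow>
    (\<forall>j. \<bar>m div d\<bar> ^ j dvd \<xi> (Suc j) div d - \<zeta> (Suc j) div d)"
    using \<xi> \<zeta> d by (simp add: fun_eq_iff mod_eq_dvd_iff)
  moreover have "\<bar>m div d\<bar> ^ j dvd \<xi> (Suc j) div d - \<zeta> (Suc j) div d \<longleftrightarrow>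
      d * \<bar>m div d\<bar> ^ j dvd \<xi> (Suc j) - \<zeta> (Suc j)" for j
  proof -
    have "d * (\<xi> (Suc j) div d - \<zeta> (Suc j) div d) = \<xi> (Suc j) - \<zeta> (Suc j)"
      using dvd_Zadic[OF \<xi> d(1,2), of j] dvd_Zadic[OF \<zeta> d(1,3), of j]
      by (simp add: right_diff_distrib)
    then show ?thesis using d0 by (metis dvd_mult_cancel_left)
  qed
  ultimately show ?thesis by simp
qed

section \<open>Digits of m-adic integers\<close>

text \<open>Because of \<open>BS(m,n) = BS(-m,-n)\<close> the sign of \<open>m\<close> can be moved to \<open>\<xi>\<close>.  The \<open>i\<close>-th digit
depends on \<open>\<xi>\<close> only modulo \<open>\<bar>m\<bar>\<^sup>i\<close>.\<close>

definition digits :: "int \<Rightarrow> (nat \<Rightarrow> int) \<Rightarrow> nat \<Rightarrow> int" where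
  "digits m \<xi> i = digit \<bar>m\<bar> (sgn m * \<xi> i) i"

lemma digits_eq_digit:
  assumes "m \<noteq> 0" "\<bar>m\<bar> ^ i dvd x - \<xi> i"
  shows "digits m \<xi> i = digit \<bar>m\<bar> (sgn m * x) i"
proof -
  have "1 * \<bar>m\<bar> ^ i dvd sgn m * x - sgn m * \<xi> i"
    using assms(2) by (simp flip: right_diff_distrib)
  then show ?thesis
    using digit_cong[of "\<bar>m\<bar>" 1 "\<bar>m\<bar>" "sgn m * x" i "sgn m * \<xi> i" i] assms(1)
    by (simp add: digits_def)
qed

lemma digits_eq_digit_le:
  "m \<noteq> 0 \<Longrightarrow> \<xi> \<in> Zadic m \<Longrightarrow> i \<le> n \<Longrightarrow> digits m \<xi> i = digit \<bar>m\<bar> (sgn m * \<xi> n) i"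
  by (intro digits_eq_digit Zadic_cong)

lemma gcd_sgn_mult: "(m :: int) \<noteq> 0 \<Longrightarrow> gcd \<bar>m\<bar> (sgn m * a) = gcd m a"
  by (simp add: sgn_if)

lemma gcd_eq_of_digits_eq:
  assumes m: "m \<noteq> 0" and m': "m' \<noteq> 0" and abs: "\<bar>m\<bar> = \<bar>m'\<bar>" and eq: "digits m \<xi> 1 = digits m' \<xi>' 1"
  shows "gcd m (\<xi> 1) = gcd m' (\<xi>' 1)"
proof -
  have "(sgn m * \<xi> 1) mod \<bar>m\<bar> = (sgn m' * \<xi>' 1) mod \<bar>m\<bar>" using eq abs by (simp add: digits_def)
  then have "gcd \<bar>m\<bar> (sgn m * \<xi> 1) = gcd \<bar>m'\<bar> (sgn m' * \<xi>' 1)"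
    using m abs by (metis abs_eq_0_iff gcd_mod_right)
  then show ?thesis using gcd_sgn_mult[OF m] gcd_sgn_mult[OF m'] by metis
qed

lemma digits_eq_iff:
  assumes m: "m \<noteq> 0" and m': "m' \<noteq> 0" and \<xi>: "\<xi> \<in> Zadic m" and \<xi>': "\<xi>' \<in> Zadic m'"
    and abs: "\<bar>m\<bar> = \<bar>m'\<bar>" and d: "d = gcd m (\<xi> 1)" "d = gcd m' (\<xi>' 1)"
  shows "digits m \<xi> = digits m' \<xi>' \<longleftrightarrow>
    (\<forall>j. d * (\<bar>m\<bar> div d) ^ j dvd sgn m * \<xi> (Suc j) - sgn m' * \<xi>' (Suc j))"
proof -
  let ?x = "\<lambda>j. sgn m * \<xi> (Suc j)" and ?x' = "\<lambda>j. sgn m' * \<xi>' (Suc j)"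
  have M: "\<bar>m\<bar> = d * (\<bar>m\<bar> div d)" "d > 0" using m by (simp_all add: d(1))
  then have K: "\<bar>m\<bar> div d > 0" using m by (metis zero_less_abs_iff zero_less_mult_pos)
  have x: "?x j = d * (?x j div d)" "?x' j = d * (?x' j div d)" for j
    using dvd_Zadic[OF \<xi>, of d j] dvd_Zadic[OF \<xi>', of d j] d
    by (metis dvd_mult dvd_mult_div_cancel gcd_dvd1 gcd_dvd2)+
  have cop: "coprime (?x j div d) (\<bar>m\<bar> div d)" for j
  proof -
    have "gcd \<bar>m\<bar> (\<xi> (Suc j)) = gcd \<bar>m\<bar> (\<xi> 1)"
      using Zadic_Suc_mod[OF \<xi>, of j] m by (metis abs_eq_0_iff gcd_mod_right)
    then have "gcd (?x j) \<bar>m\<bar> = d" using gcd_sgn_mult[OF m] d(1) by (simp add: gcd.commute)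
    then show ?thesis using div_gcd_coprime[of "?x j" "\<bar>m\<bar>"] m by simp
  qed
  have "digits m \<xi> = digits m' \<xi>' \<longleftrightarrow> (\<forall>j. \<forall>i\<le>j. digits m \<xi> i = digits m' \<xi>' i)"
    by (auto simp: fun_eq_iff)
  also have "\<dots> \<longleftrightarrow> (\<forall>j. \<forall>i\<le>j. digit \<bar>m\<bar> (?x j) i = digit \<bar>m\<bar> (?x' j) i)"
    using digits_eq_digit_le[OF m \<xi> le_SucI] digits_eq_digit_le[OF m' \<xi>' le_SucI] abs by metis
  also have "\<dots> \<longleftrightarrow> (\<forall>j. d * (\<bar>m\<bar> div d) ^ j dvd ?x j - ?x' j)"
    using digits_upto_eq_iff[OF M K x(1) x(2) cop] by blast
  finally show ?thesis .
qed

lemma adic_proj_eq_iff_digits_eq: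
  assumes m: "m \<noteq> 0" and \<xi>: "\<xi> \<in> Zadic m" and \<xi>': "\<xi>' \<in> Zadic m'"
    and \<epsilon>: "\<epsilon> \<in> {1, - 1}" "m = \<epsilon> * m'" and d: "d = gcd m (\<xi> 1)" "d = gcd m' (\<xi>' 1)"
  shows "adic_proj (m div d) (adic_div m \<xi> d) =
      adic_proj (m div d) (adic_div m (adic_smul m \<epsilon> \<xi>') d) \<longleftrightarrow> digits m \<xi> = digits m' \<xi>'"
proof -
  let ?\<zeta> = "adic_smul m \<epsilon> \<xi>'"
  have abs: "\<bar>m\<bar> = \<bar>m'\<bar>" and m': "m' \<noteq> 0" using \<epsilon> m by auto
  have \<zeta>: "?\<zeta> \<in> Zadic m" using adic_smul_closed[OF m, of \<xi>'] \<xi>' abs by (simp add: Zadic_def)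
  have d_dvd: "d > 0" "d dvd m" "d dvd \<xi> 1" "d dvd \<xi>' 1" using m d
    by (simp, metis gcd_dvd1, metis gcd_dvd2, metis gcd_dvd2)
  then have d\<zeta>: "d dvd ?\<zeta> 1" by (simp add: adic_smul_apply dvd_mod)
  have K: "\<bar>m div d\<bar> = \<bar>m\<bar> div d" using d_dvd(1,2) by (metis abs_div abs_of_pos)
  have "d * (\<bar>m\<bar> div d) ^ j dvd \<xi> (Suc j) - ?\<zeta> (Suc j) \<longleftrightarrow>
      d * (\<bar>m\<bar> div d) ^ j dvd sgn m * \<xi> (Suc j) - sgn m' * \<xi>' (Suc j)" for j
  proof -
    let ?D = "d * (\<bar>m\<bar> div d) ^ j"
    have "(\<bar>m\<bar> div d) ^ j dvd \<bar>m\<bar> ^ j"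
      using d_dvd(2) by (intro dvd_power_same) (metis dvd_abs_iff dvd_div_mult_self dvd_triv_left)
    then have "?D dvd \<bar>m\<bar> ^ Suc j" using d_dvd(2) by (simp add: mult_dvd_mono)
    moreover have "\<bar>m\<bar> ^ Suc j dvd ?\<zeta> (Suc j) - \<epsilon> * \<xi>' (Suc j)"
      by (simp add: adic_smul_apply flip: mod_eq_dvd_iff)
    ultimately have "?D dvd ?\<zeta> (Suc j) - \<epsilon> * \<xi>' (Suc j)" by (rule dvd_trans)
    then have "?D dvd \<xi> (Suc j) - ?\<zeta> (Suc j) \<longleftrightarrow> ?D dvd \<xi> (Suc j) - \<epsilon> * \<xi>' (Suc j)"
      using dvd_add_left_iff[of ?D "?\<zeta> (Suc j) - \<epsilon> * \<xi>' (Suc j)" "\<xi> (Suc j) - ?\<zeta> (Suc j)"] by simp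
    also have "\<dots> \<longleftrightarrow> ?D dvd sgn m * (\<xi> (Suc j) - \<epsilon> * \<xi>' (Suc j))"
      using m by (cases "m > 0") (simp_all add: dvd_diff_commute)
    also have "sgn m * (\<xi> (Suc j) - \<epsilon> * \<xi>' (Suc j)) = sgn m * \<xi> (Suc j) - sgn m' * \<xi>' (Suc j)"
      using \<epsilon> by (auto simp: sgn_mult right_diff_distrib)
    finally show ?thesis .
  qed
  then show ?thesis
    using adic_proj_adic_div_eq_iff[OF m \<xi> \<zeta> d_dvd(2,3) d\<zeta>] digits_eq_iff[OF m m' \<xi> \<xi>' abs d]
    unfolding K by simp
qed

theorem adic_condition_iff_digits_eq:
  assumes m: "m \<noteq> 0" and m': "m' \<noteq> 0" and \<xi>: "\<xi> \<in> Zadic m" and \<xi>': "\<xi>' \<in> Zadic m'"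
  shows "(\<exists>\<epsilon> \<in> {1, -1 :: int}. \<exists>d :: int. d > 0 \<and> m = \<epsilon> * m' \<and>
       d = adic_gcd m m \<xi> \<and> d = adic_gcd m' m' \<xi>' \<and>
       adic_proj (m div d) (adic_div m \<xi> d) =
       adic_proj (m div d) (adic_div m (adic_smul m \<epsilon> \<xi>') d)) \<longleftrightarrow>
    \<bar>m\<bar> = \<bar>m'\<bar> \<and> digits m \<xi> = digits m' \<xi>'"
    (is "?L \<longleftrightarrow> ?R")
proof
  assume ?L
  then obtain \<epsilon> d where \<epsilon>: "\<epsilon> \<in> {1, - 1}" "m = \<epsilon> * m'" and d: "d = gcd m (\<xi> 1)" "d = gcd m' (\<xi>' 1)"
    and proj: "adic_proj (m div d) (adic_div m \<xi> d) =
      adic_proj (m div d) (adic_div m (adic_smul m \<epsilon> \<xi>') d)"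
    unfolding adic_gcd_eq[OF m \<xi>] adic_gcd_eq[OF m' \<xi>'] by blast
  have "\<bar>m\<bar> = \<bar>m'\<bar>" using \<epsilon> by auto
  then show ?R using adic_proj_eq_iff_digits_eq[OF m \<xi> \<xi>' \<epsilon> d] proj by blast
next
  assume R: ?R
  define \<epsilon> where "\<epsilon> = sgn m * sgn m'"
  have \<epsilon>: "\<epsilon> \<in> {1, - 1}" "m = \<epsilon> * m'"
    using m m' R by (auto simp: \<epsilon>_def sgn_if abs_if split: if_splits)
  have d: "gcd m (\<xi> 1) = gcd m' (\<xi>' 1)" using gcd_eq_of_digits_eq[OF m m'] R by simp
  show ?L
    unfolding adic_gcd_eq[OF m \<xi>] adic_gcd_eq[OF m' \<xi>']
  proof (intro bexI exI conjI)
    show "gcd m (\<xi> 1) > 0" using m by simp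
    show "adic_proj (m div gcd m (\<xi> 1)) (adic_div m \<xi> (gcd m (\<xi> 1))) =
        adic_proj (m div gcd m (\<xi> 1)) (adic_div m (adic_smul m \<epsilon> \<xi>') (gcd m (\<xi> 1)))"
      using adic_proj_eq_iff_digits_eq[OF m \<xi> \<xi>' \<epsilon> refl d] R by blast
  qed (use \<epsilon> d in simp_all)
qed

section \<open>The limit groups\<close>

definition linear_ext :: "(nat \<Rightarrow> 'a::comm_ring_1) \<Rightarrow> 'a poly \<Rightarrow> 'a" where
  "linear_ext u P = (\<Sum>i\<le>degree P. coeff P i * u i)"

lemma linear_ext_altdef: "degree P \<le> n \<Longrightarrow> linear_ext u P = (\<Sum>i\<le>n. coeff P i * u i)"
  unfolding linear_ext_def by (rule sum.mono_neutral_left) (auto simp: coeff_eq_0)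

lemma linear_ext_add: "linear_ext u (P + Q) = linear_ext u P + linear_ext u Q"
proof -
  define n where "n = max (degree P) (degree Q)"
  have "degree (P + Q) \<le> n" "degree P \<le> n" "degree Q \<le> n"
    using degree_add_le_max[of P Q] by (auto simp: n_def)
  then show ?thesis by (simp add: linear_ext_altdef[of _ n] sum.distrib algebra_simps)
qed

lemma linear_ext_uminus: "linear_ext u (- P) = - linear_ext u P"
  by (simp add: linear_ext_def sum_negf)

lemma linear_ext_diff: "linear_ext u (P - Q) = linear_ext u P - linear_ext u Q"
  using linear_ext_add[of u P "- Q"] by (simp add: linear_ext_uminus)

lemma linear_ext_const [simp]: "linear_ext u [:c:] = c * u 0"
  by (simp add: linear_ext_def)

lemma linear_ext_0 [simp]: "linear_ext u 0 = 0"
  by (simp add: linear_ext_def)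

lemma linear_ext_pCons: "linear_ext u (pCons c P) = c * u 0 + linear_ext (\<lambda>i. u (Suc i)) P"
proof -
  have "degree (pCons c P) \<le> Suc (degree P)" by (simp add: degree_pCons_le)
  then have "linear_ext u (pCons c P) = (\<Sum>i\<le>Suc (degree P). coeff (pCons c P) i * u i)"
    by (rule linear_ext_altdef)
  then show ?thesis
    by (simp only: sum.atMost_Suc_shift coeff_pCons_0 coeff_pCons_Suc linear_ext_def)
qed

lemma linear_ext_smult: "linear_ext u (smult c P) = c * linear_ext u P"
  using linear_ext_altdef[OF degree_smult_le, of u c P]
  by (simp add: linear_ext_def sum_distrib_left algebra_simps)

lemma linear_ext_monom [simp]: "linear_ext u (monom c n) = c * u n"
  using linear_ext_altdef[OF degree_monom_le, of u c n]
  by (simp add: if_distrib[of "\<lambda>x. x * _"] cong: if_cong)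

lemma linear_ext_mult_fun: "linear_ext (\<lambda>i. c * u i) P = c * linear_ext u P"
  by (simp add: linear_ext_def sum_distrib_left algebra_simps)

lemma linear_ext_add_fun: "linear_ext (\<lambda>i. u i + v i) P = linear_ext u P + linear_ext v P"
  by (simp add: linear_ext_def sum.distrib algebra_simps)

lemma linear_ext_cong: "(\<And>i. i \<le> degree P \<Longrightarrow> u i = v i) \<Longrightarrow> linear_ext u P = linear_ext v P"
  by (simp add: linear_ext_def)

text \<open>\<open>E\<close> is \<open>\<int>[X]\<close> with \<open>e\<^sub>i = X\<^sup>i\<close>.  A polynomial \<open>P\<close> in \<open>E\<^bsub>m,\<xi>\<^esub>\<close> differs from a combination of
the \<open>e\<^sub>i - r\<^sub>i e\<^sub>0\<close> with \<open>i \<ge> 1\<close> by the multiple \<open>linear_ext r P\<close> of \<open>e\<^sub>0\<close>; so \<open>\<phi>\<close>, which is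
\<open>tilde_pass M r False\<close>, divides that coefficient by \<open>m\<close> and multiplies by \<open>X\<close>.\<close>

definition tilde_rep :: "int \<Rightarrow> (nat \<Rightarrow> int) \<Rightarrow> bool \<Rightarrow> int poly \<Rightarrow> int poly" where
  "tilde_rep M r e P = (if e then [:coeff P 0:] else [:linear_ext r P mod M:])"

definition tilde_pass :: "int \<Rightarrow> (nat \<Rightarrow> int) \<Rightarrow> bool \<Rightarrow> int poly \<Rightarrow> int poly" where
  "tilde_pass M r e P =
    (if e then let Q = poly_shift 1 P in Q + [:M * coeff Q 0 - linear_ext r Q:]
     else pCons 0 (P + [:linear_ext r P div M - coeff P 0:]))"

lemma tilde_rep_True: "tilde_rep M r True P = 0 \<longleftrightarrow> coeff P 0 = 0"
  and tilde_rep_False: "tilde_rep M r False P = 0 \<longleftrightarrow> M dvd linear_ext r P"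
  by (auto simp: tilde_rep_def dvd_eq_mod_eq_0)

lemma tilde_pass_True_pCons:
  "tilde_pass M r True (pCons c Q) = Q + [:M * coeff Q 0 - linear_ext r Q:]"
proof -
  have "poly_shift 1 (pCons c Q) = Q" by (simp add: poly_eq_iff coeff_poly_shift)
  then show ?thesis by (simp add: tilde_pass_def)
qed

lemma tilde_pass_False:
  "M > 0 \<Longrightarrow> linear_ext r P = M * j \<Longrightarrow> tilde_pass M r False P = pCons 0 (P + [:j - coeff P 0:])"
  by (simp add: tilde_pass_def)

lemma linear_ext_tilde_pass_True:
  assumes "r 0 = 1"
  shows "linear_ext r (tilde_pass M r True (pCons c Q)) = M * coeff Q 0"
  by (simp add: tilde_pass_True_pCons linear_ext_add assms)

lemma tilde_pass_tilde_pass: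
  assumes M: "M > 0" and r: "r 0 = 1" and P: "tilde_rep M r e P = 0"
  shows "tilde_pass M r (\<not> e) (tilde_pass M r e P) = P"
proof (cases e)
  case True
  then obtain Q where Q: "P = pCons 0 Q" using P by (cases P) (auto simp: tilde_rep_True)
  show ?thesis
    using True tilde_pass_False[OF M linear_ext_tilde_pass_True[of r M 0 Q, OF r]]
    by (simp add: Q tilde_pass_True_pCons)
next
  case False
  then obtain j where j: "linear_ext r P = M * j" using P by (auto simp: tilde_rep_False)
  then show ?thesis
    using False r by (simp add: tilde_pass_False[OF M j] tilde_pass_True_pCons linear_ext_add)
qed

lemma tilde_pass_add:
  assumes "tilde_rep M r e P = 0"
  shows "tilde_pass M r e (P + Q) = tilde_pass M r e P + tilde_pass M r e Q"
proof (cases e)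
  case True
  have "poly_shift 1 (P + Q) = poly_shift 1 P + poly_shift 1 Q"
    by (simp add: poly_eq_iff coeff_poly_shift)
  then show ?thesis using True by (simp add: tilde_pass_def Let_def linear_ext_add algebra_simps)
next
  case False
  then have "M dvd linear_ext r P" using assms by (simp add: tilde_rep_False)
  then show ?thesis
    using False div_plus_div_distrib_dvd_left[of M "linear_ext r P" "linear_ext r Q"]
    by (simp add: tilde_pass_def linear_ext_add algebra_simps)
qed

lemma hnn_tilde:
  assumes M: "M > 0" and r: "r 0 = 1"
  shows "hnn (tilde_rep M r) (tilde_pass M r)"
proof
  fix e :: bool and P Q :: "int poly"
  show "tilde_rep M r e 0 = 0" by (simp add: tilde_rep_def)
  show "tilde_rep M r e (P - tilde_rep M r e P) = 0"
    by (simp add: tilde_rep_def linear_ext_diff r minus_mod_eq_mult_div)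
  show "tilde_rep M r e (P + Q) = tilde_rep M r e P" if "tilde_rep M r e Q = 0"
    using that by (cases e) (auto simp: tilde_rep_def linear_ext_add elim!: dvdE)
  show "tilde_rep M r (\<not> e) (tilde_pass M r e P) = 0" if P: "tilde_rep M r e P = 0"
  proof (cases e)
    case True
    then show ?thesis using linear_ext_tilde_pass_True[of r M, OF r]
      by (cases P) (simp add: tilde_rep_False)
  qed (simp add: tilde_rep_True tilde_pass_def)
qed (simp_all add: tilde_pass_add tilde_pass_tilde_pass assms)

locale bs_tilde =
  fixes M :: int and r :: "nat \<Rightarrow> int"
  assumes M: "M > 0" and r_0: "r 0 = 1" and r_bounds: "i > 0 \<Longrightarrow> 0 \<le> r i \<and> r i < M"
begin

sublocale hnn "tilde_rep M r" "tilde_pass M r" 1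
  by (rule hnn_tilde) (rule M, rule r_0)

lemma base_op_const_in_G: "base_op [:c:] \<in> G"
proof (induction c rule: int_induct[of _ 0])
  case base
  show ?case unfolding pCons_0_0 base_op_0 by (rule G_id)
next
  case (step1 c)
  have "[:c + 1:] = [:c:] + 1" by (simp add: one_pCons)
  then show ?case using base_op_add_in_G[OF step1(2) base_op_generator_in_G] by (simp only:)
next
  case (step2 c)
  have "[:c - 1:] = [:c:] + - 1" by (simp add: one_pCons)
  then show ?case
    using base_op_add_in_G[OF step2(2) base_op_uminus_in_G[OF base_op_generator_in_G]]
    by (simp only:)
qed

sublocale hnn_generated "tilde_rep M r" "tilde_pass M r" 1
proof
  show "base_op P \<in> G" for P
  proof (induction P rule: pCons_induct)
    case 0
    show ?case using base_op_const_in_G[of 0] by simp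
  next
    case (pCons c P)
    let ?Q = "tilde_pass M r True (pCons 0 P)"
    have T: "tilde_rep M r True (pCons 0 P) = 0" by (simp add: tilde_rep_True)
    have "base_op ?Q \<in> G"
      unfolding tilde_pass_True_pCons using pCons.IH base_op_const_in_G by (rule base_op_add_in_G)
    then have "base_op (pCons 0 P) \<in> G"
      using base_op_pass_in_G[of ?Q False] rep_pass[OF T] pass_pass[OF T] by simp
    then show ?case using base_op_add_in_G[OF base_op_const_in_G[of c]] by fastforce
  qed
qed

lemma passes_0_iff: "passes P Q \<Longrightarrow> P = 0 \<longleftrightarrow> Q = 0"
  using pass_0 by (metis passes_def passes_iff_True)

lemma passes_degree:
  assumes "passes P Q" "P \<noteq> 0"
  shows "degree Q = Suc (degree P)"
proof -
  let ?R = "P + [:linear_ext r P div M - coeff P 0:]"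
  have Q: "Q = pCons 0 ?R" using assms(1) by (simp add: passes_def tilde_pass_def)
  then have "?R \<noteq> 0" using passes_0_iff[OF assms(1)] assms(2) by auto
  then have "degree Q = Suc (degree ?R)" unfolding Q by (rule degree_pCons_eq)
  moreover have "degree ?R = degree P"
  proof (cases "degree P = 0")
    case True
    then show ?thesis using degree_add_le[of P 0 "[:linear_ext r P div M - coeff P 0:]"] by simp
  qed (simp add: degree_add_eq_left)
  ultimately show ?thesis by simp
qed

end

section \<open>Convergence\<close>

text \<open>The limit group maps to \<open>BS(M,x)\<close> by sending \<open>e\<^sub>i\<close> to the power of \<open>b\<close> with exponent
\<open>b_exponent M x i\<close>, as far as the digits of \<open>x\<close> are \<open>r\<close>.\<close>

fun b_exponent :: "int \<Rightarrow> int \<Rightarrow> nat \<Rightarrow> int" where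
  "b_exponent M x 0 = 1"
| "b_exponent M x (Suc i) = x * digit_quot M x i"

lemma b_exponent_mod: "M dvd linear_ext (b_exponent M x) P - linear_ext (digit M x) P"
proof -
  have "b_exponent M x i = M * (if i = 0 then 0 else digit_quot M x i) + digit M x i" for i
    using digit_quot_Suc[of x M "i - 1"] by (cases i) (simp_all del: digit_quot.simps(2))
  then have "linear_ext (b_exponent M x) P =
      linear_ext (\<lambda>i. M * (if i = 0 then 0 else digit_quot M x i) + digit M x i) P"
    by (rule linear_ext_cong)
  then show ?thesis by (simp only: linear_ext_add_fun linear_ext_mult_fun) simp
qed

lemma b_exponent_coeff_0: "x dvd linear_ext (b_exponent M x) P - coeff P 0"
  by (cases P) (simp add: linear_ext_pCons linear_ext_mult_fun)

lemma b_exponent_tilde_pass: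
  assumes M: "M > 0" and r: "linear_ext (digit M x) P = linear_ext r P"
    and dvd: "M dvd linear_ext r P"
  shows "M * linear_ext (b_exponent M x) (tilde_pass M r False P) =
    x * linear_ext (b_exponent M x) P"
proof -
  obtain c Q where P: "P = pCons c Q" by (cases P)
  obtain j where j: "linear_ext r P = M * j" using dvd by blast
  define S where "S = linear_ext (\<lambda>i. digit_quot M x (Suc i)) Q"
  define R where "R = linear_ext (\<lambda>i. digit M x (Suc i)) Q"
  have P': "linear_ext (b_exponent M x) P = c + (M * S + R)"
    unfolding S_def R_def linear_ext_mult_fun[symmetric] linear_ext_add_fun[symmetric]
      digit_quot_Suc[symmetric] by (simp add: P linear_ext_pCons)
  have Mj: "M * j = c + R" using j r by (simp add: P R_def linear_ext_pCons)
  have "tilde_pass M r False P = pCons 0 (pCons j Q)" using tilde_pass_False[OF M j]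
    by (simp add: P)
  then have "linear_ext (b_exponent M x) (tilde_pass M r False P) = x * (j + S)"
    by (simp add: S_def linear_ext_pCons linear_ext_mult_fun distrib_left del: digit_quot.simps(2))
  then have "M * linear_ext (b_exponent M x) (tilde_pass M r False P) = x * (M * j + M * S)"
    by (simp add: algebra_simps)
  then show ?thesis by (simp add: P' Mj)
qed

definition digits_tendsto :: "int \<Rightarrow> (nat \<Rightarrow> int) \<Rightarrow> (nat \<Rightarrow> int) \<Rightarrow> bool" where
  "digits_tendsto M s r \<longleftrightarrow> filterlim (\<lambda>n. \<bar>s n\<bar>) at_top sequentially \<and>
    (\<forall>i. \<forall>\<^sub>F n in sequentially. digit M (s n) i = r i)"

locale bs_limit = bs_tilde +
  fixes s :: "nat \<Rightarrow> int"
  assumes s: "digits_tendsto M s r"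
begin

abbreviation \<psi> :: "nat \<Rightarrow> int poly \<Rightarrow> int" where
  "\<psi> n \<equiv> linear_ext (b_exponent M (s n))"

abbreviation map_\<psi> :: "nat \<Rightarrow> int poly vertex \<Rightarrow> int vertex" where
  "map_\<psi> n \<equiv> map (\<lambda>(e, \<rho>). (e, \<psi> n \<rho>))"

abbreviation bs_lmult :: "nat \<Rightarrow> int \<Rightarrow> int vertex \<Rightarrow> int vertex" where
  "bs_lmult n \<equiv> hnn.lmult (bs_rep M (s n)) (bs_pass M (s n))"

abbreviation bs_lcarry :: "nat \<Rightarrow> int \<Rightarrow> int vertex \<Rightarrow> int" where
  "bs_lcarry n \<equiv> hnn.lcarry (bs_rep M (s n)) (bs_pass M (s n))"

abbreviation bs_normal_form :: "nat \<Rightarrow> int vertex \<Rightarrow> bool" where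
  "bs_normal_form n \<equiv> hnn.normal_form (bs_rep M (s n))"

abbreviation bs_letter_op :: "nat \<Rightarrow> letter \<Rightarrow> int state \<Rightarrow> int state" where
  "bs_letter_op n \<equiv> hnn.letter_op (bs_rep M (s n)) (bs_pass M (s n)) 1"

lemma eventually_large: "\<forall>\<^sub>F n in sequentially. \<bar>s n\<bar> > k"
proof -
  have "\<forall>\<^sub>F n in sequentially. \<bar>s n\<bar> \<ge> k + 1"
    using s by (auto simp: digits_tendsto_def filterlim_at_top)
  then show ?thesis by eventually_elim simp
qed

lemma eventually_nonzero: "\<forall>\<^sub>F n in sequentially. s n \<noteq> 0"
  using eventually_large[of 0] by eventually_elim auto

lemma eventually_hnn: "\<forall>\<^sub>F n in sequentially. hnn (bs_rep M (s n)) (bs_pass M (s n))"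
  using eventually_nonzero by eventually_elim (rule hnn_bs[OF M])

lemma eventually_linear_ext_digit:
  "\<forall>\<^sub>F n in sequentially. linear_ext (digit M (s n)) P = linear_ext r P"
proof -
  have "\<forall>\<^sub>F n in sequentially. \<forall>i\<in>{..degree P}. digit M (s n) i = r i"
    using s by (intro eventually_ball_finite) (auto simp: digits_tendsto_def)
  then show ?thesis by eventually_elim (auto intro: linear_ext_cong)
qed

lemma eventually_rep: "\<forall>\<^sub>F n in sequentially. bs_rep M (s n) e (\<psi> n P) = \<psi> n (tilde_rep M r e P)"
proof (cases e)
  case True
  have "\<forall>\<^sub>F n in sequentially. \<psi> n P cmod s n = coeff P 0"
    using eventually_large[of "2 * \<bar>coeff P 0\<bar>"]
  proof eventually_elim
    case (elim n)
    have "\<psi> n P cmod s n = coeff P 0 cmod s n"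
      using cmod_add_dvd[OF b_exponent_coeff_0[of "s n" M P], of "coeff P 0"] by simp
    then show ?case using cmod_small elim by simp
  qed
  then show ?thesis using True by (simp add: bs_rep_def tilde_rep_def)
next
  case False
  have "\<forall>\<^sub>F n in sequentially. \<psi> n P mod M = linear_ext r P mod M"
    using eventually_linear_ext_digit[of P]
  proof eventually_elim
    case (elim n)
    then show ?case using b_exponent_mod[of M "s n" P] by (simp add: mod_eq_dvd_iff)
  qed
  then show ?thesis using False by (simp add: bs_rep_def tilde_rep_def)
qed

lemma eventually_passes:
  assumes "passes P Q"
  shows "\<forall>\<^sub>F n in sequentially. M dvd \<psi> n P \<and> M * \<psi> n Q = s n * \<psi> n P"
  using eventually_linear_ext_digit[of P]
proof eventually_elim
  case (elim n)
  have dvd: "M dvd linear_ext r P" using assms by (simp add: passes_def tilde_rep_False)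
  then have "M dvd \<psi> n P" using dvd_add[OF b_exponent_mod[of M "s n" P], of "linear_ext r P"] elim
    by simp
  then show ?case using b_exponent_tilde_pass[OF M elim dvd] assms by (simp add: passes_def)
qed

lemma eventually_pass:
  assumes "tilde_rep M r e P = 0"
  shows "\<forall>\<^sub>F n in sequentially. bs_pass M (s n) e (\<psi> n P) = \<psi> n (tilde_pass M r e P)"
proof -
  let ?Q = "tilde_pass M r e P"
  have "if e then passes ?Q P else passes P ?Q"
    using assms passes_iff_True[of ?Q P] passes_def[of P ?Q] by (cases e) auto
  then have "\<forall>\<^sub>F n in sequentially. if e then M dvd \<psi> n ?Q \<and> M * \<psi> n P = s n * \<psi> n ?Q
      else M dvd \<psi> n P \<and> M * \<psi> n ?Q = s n * \<psi> n P"
    using eventually_passes by (cases e) auto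
  then show ?thesis using eventually_nonzero
  proof eventually_elim
    case (elim n)
    then show ?case using M by (cases e) (auto simp: bs_pass_def mult.left_commute elim!: dvdE)
  qed
qed

lemma eventually_\<psi>_nonzero: "P \<noteq> 0 \<Longrightarrow> \<forall>\<^sub>F n in sequentially. \<psi> n P \<noteq> 0"
proof (induction "degree P" arbitrary: P rule: less_induct)
  case less
  show ?case
  proof (cases "coeff P 0 = 0")
    case False
    show ?thesis using eventually_rep[of True P] eventually_nonzero
    proof eventually_elim
      case (elim n)
      then show ?case using False by (auto simp: bs_rep_def tilde_rep_def)
    qed
  next
    case True
    define Q where "Q = tilde_pass M r True P"
    have Q: "passes Q P" using True by (simp add: Q_def passes_iff_True tilde_rep_True)
    then have "Q \<noteq> 0" using passes_0_iff less.prems by blast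
    then have "\<forall>\<^sub>F n in sequentially. \<psi> n Q \<noteq> 0"
      using less.hyps passes_degree[OF Q] by simp
    then show ?thesis using eventually_passes[OF Q] eventually_nonzero
      by eventually_elim (use M in auto)
  qed
qed

lemma eventually_\<psi>_eq_0_iff: "\<forall>\<^sub>F n in sequentially. \<psi> n P = 0 \<longleftrightarrow> P = 0"
  using eventually_\<psi>_nonzero[of P] by (cases "P = 0") (auto elim: eventually_mono)

lemma eventually_lmult:
  "\<forall>\<^sub>F n in sequentially. bs_lmult n (\<psi> n q) (map_\<psi> n l) = map_\<psi> n (lmult q l) \<and>
     bs_lcarry n (\<psi> n q) (map_\<psi> n l) = \<psi> n (lcarry q l)"
proof (induction l arbitrary: q)
  case Nil
  show ?case using eventually_hnn by eventually_elim (simp add: hnn.lmult.simps hnn.lcarry.simps)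
next
  case (Cons p l)
  obtain e \<rho> where p: "p = (e, \<rho>)" by (cases p)
  show ?case
    using Cons.IH[of "carry e q \<rho>"] eventually_rep[of e "q + \<rho>"]
      eventually_pass[OF rep_diff_rep[of e "q + \<rho>"]] eventually_hnn
  proof eventually_elim
    case (elim n)
    interpret Z: hnn "bs_rep M (s n)" "bs_pass M (s n)" by fact
    have rep: "bs_rep M (s n) e (\<psi> n q + \<psi> n \<rho>) = \<psi> n (tilde_rep M r e (q + \<rho>))"
      using elim(2) by (simp add: linear_ext_add)
    have carry: "Z.carry e (\<psi> n q) (\<psi> n \<rho>) = \<psi> n (carry e q \<rho>)"
      using elim(3) unfolding Z.carry_def carry_def rep
      by (simp add: linear_ext_add linear_ext_diff)
    show ?case using elim(1) by (simp add: p rep carry)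
  qed
qed

lemma eventually_push: "\<forall>\<^sub>F n in sequentially. hnn.push e (map_\<psi> n l) = map_\<psi> n (push e l)"
proof (cases l)
  case Nil
  show ?thesis using eventually_hnn
    by eventually_elim (simp add: Nil push_def hnn.push_def)
next
  case (Cons p l')
  show ?thesis using eventually_hnn eventually_\<psi>_eq_0_iff[of "snd p"]
    by eventually_elim (cases p; auto simp: Cons push_def hnn.push_def)
qed

lemma eventually_letter_op:
  assumes "normal_form l"
  shows "\<forall>\<^sub>F n in sequentially. bs_normal_form n (map_\<psi> n l) \<longrightarrow>
    bs_letter_op n c (map_\<psi> n l, \<psi> n p) = map_prod (map_\<psi> n) (\<psi> n) (letter_op c (l, p))"
proof (cases "fst c")
  case True
  let ?q = "if snd c then - 1 else 1 :: int poly"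
  show ?thesis using eventually_lmult[of ?q l] eventually_hnn
  proof eventually_elim
    case (elim n)
    interpret Z: hnn "bs_rep M (s n)" "bs_pass M (s n)" 1 by fact
    have "\<psi> n 1 = 1" by (simp add: one_pCons)
    then have q: "\<psi> n ?q = (if snd c then - 1 else 1)" by (simp add: linear_ext_uminus)
    show ?case using elim(1) assms True unfolding q
      by (auto simp: Z.letter_op_def letter_op_def Z.base_op_def base_op_def linear_ext_add)
  qed
next
  case False
  show ?thesis using eventually_push[of "\<not> snd c" l] eventually_hnn
  proof eventually_elim
    case (elim n)
    interpret Z: hnn "bs_rep M (s n)" "bs_pass M (s n)" 1 by fact
    show ?case using elim(1) assms False
      by (auto simp: Z.letter_op_def letter_op_def Z.stable_op_def stable_op_def)
  qed
qed

lemma eventually_foldr: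
  "\<forall>\<^sub>F n in sequentially. foldr (bs_letter_op n) w ([], 0) =
     map_prod (map_\<psi> n) (\<psi> n) (foldr letter_op w ([], 0))"
proof (induction w)
  case (Cons c w)
  obtain l p where lp: "foldr letter_op w ([], 0) = (l, p)" by (cases "foldr letter_op w ([], 0)")
  have "normal_form l"
    using normal_form_vertex_act[of "foldr letter_op w" "[]"] lp by (simp add: vertex_act_def)
  from eventually_letter_op[OF this, of c p] Cons.IH eventually_hnn show ?case
  proof eventually_elim
    case (elim n)
    interpret Z: hnn "bs_rep M (s n)" "bs_pass M (s n)" 1 by fact
    have state: "foldr Z.letter_op w ([], 0) = (map_\<psi> n l, \<psi> n p)" using elim(2) lp by simp
    then have "Z.normal_form (map_\<psi> n l)"
      using Z.normal_form_vertex_act[of "foldr Z.letter_op w" "[]"] by (simp add: Z.vertex_act_def)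
    then show ?case using elim(1) state lp by simp
  qed
qed simp

lemma eventually_BSN_iff_act_kernel:
  assumes "reduced w"
  shows "\<forall>\<^sub>F n in sequentially. w \<in> BSN M (s n) \<longleftrightarrow> w \<in> act_kernel"
  using eventually_foldr[of w] eventually_nonzero
    eventually_\<psi>_eq_0_iff[of "snd (foldr letter_op w ([], 0))"]
proof eventually_elim
  case (elim n)
  interpret Z: hnn "bs_rep M (s n)" "bs_pass M (s n)" 1 by (rule hnn_bs[OF M elim(2)])
  show ?case
    unfolding BSN_eq_act_kernel[OF M elim(2)] Z.act_kernel_iff[OF assms]
      act_kernel_iff[OF assms] elim(1)
    using elim(3) by (cases "foldr letter_op w ([], 0)") auto
qed

end

lemma G2_tendstoI:
  assumes "\<And>w. w \<in> carrier FG \<Longrightarrow> \<forall>\<^sub>F n in sequentially. w \<in> Ns n \<longleftrightarrow> w \<in> N"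
  shows "G2_tendsto Ns N"
  unfolding G2_tendsto_def
proof
  fix L
  let ?W = "{w \<in> carrier FG. length w \<le> L}"
  have "finite {w :: letter list. set w \<subseteq> UNIV \<and> length w \<le> L}"
    by (rule finite_lists_length_le) simp
  then have "finite ?W" by (rule rev_finite_subset) auto
  then have "\<forall>\<^sub>F n in sequentially. \<forall>w\<in>?W. w \<in> Ns n \<longleftrightarrow> w \<in> N"
    by (rule eventually_ball_finite) (use assms in blast)
  then show "\<exists>n0. \<forall>n\<ge>n0. \<forall>w\<in>carrier FG. length w \<le> L \<longrightarrow> (w \<in> Ns n) = (w \<in> N)"
    unfolding eventually_sequentially by blast
qed

lemma G2_tendsto_unique:
  assumes "G2_tendsto Ns N" "G2_tendsto Ns N'" "N \<subseteq> carrier FG" "N' \<subseteq> carrier FG"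
  shows "N = N'"
proof -
  have "w \<in> N \<longleftrightarrow> w \<in> N'" if w: "w \<in> carrier FG" for w
  proof -
    obtain n0 n1 where "\<forall>n\<ge>n0. w \<in> Ns n \<longleftrightarrow> w \<in> N" "\<forall>n\<ge>n1. w \<in> Ns n \<longleftrightarrow> w \<in> N'"
      using assms(1,2) w unfolding G2_tendsto_def by (metis order_refl)
    then show ?thesis by (metis max.cobounded1 max.cobounded2)
  qed
  then show ?thesis using assms(3,4) by blast
qed

lemma digits_tendsto_of_adic_tendsto:
  assumes m: "m \<noteq> 0" and s: "filterlim (\<lambda>n. \<bar>s n\<bar>) at_top sequentially" "adic_tendsto m s \<xi>"
    and \<xi>: "\<xi> \<in> Zadic m"
  shows "digits_tendsto \<bar>m\<bar> (\<lambda>n. sgn m * s n) (digits m \<xi>)"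
proof -
  have "\<forall>\<^sub>F n in sequentially. digit \<bar>m\<bar> (sgn m * s n) i = digits m \<xi> i" for i
  proof -
    obtain n0 where n0: "\<And>n. n \<ge> n0 \<Longrightarrow> s n mod \<bar>m\<bar> ^ i = \<xi> i"
      using s(2) by (auto simp: adic_tendsto_def)
    have "digit \<bar>m\<bar> (sgn m * s n) i = digits m \<xi> i" if "n \<ge> n0" for n
    proof -
      have "s n mod \<bar>m\<bar> ^ i = \<xi> i mod \<bar>m\<bar> ^ i"
        using n0[OF that] Zadic_mod[OF \<xi>, of i i] by simp
      then show ?thesis using digits_eq_digit[OF m] by (simp add: mod_eq_dvd_iff)
    qed
    then show ?thesis by (auto simp: eventually_sequentially)
  qed
  moreover have "\<bar>sgn m * s n\<bar> = \<bar>s n\<bar>" for n using m by (simp add: abs_mult abs_sgn_eq)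
  ultimately show ?thesis using s(1) by (simp add: digits_tendsto_def)
qed

lemma ex_adic_tendsto:
  assumes "m \<noteq> 0" "\<xi> \<in> Zadic m"
  shows "\<exists>s. filterlim (\<lambda>n. \<bar>s n\<bar>) at_top sequentially \<and> adic_tendsto m s \<xi>"
proof (intro exI conjI)
  let ?s = "\<lambda>n. \<xi> n + \<bar>m\<bar> ^ n * int n"
  have "int n \<le> \<bar>?s n\<bar>" for n
  proof -
    have "\<bar>m\<bar> ^ n * int n \<ge> 1 * int n"
      using assms(1) by (intro mult_right_mono) (auto intro: one_le_power)
    then show ?thesis using Zadic_bounds[OF assms(2), of n] by linarith
  qed
  then show "filterlim (\<lambda>n. \<bar>?s n\<bar>) at_top sequentially"
    by (intro filterlim_at_top_mono[OF filterlim_int_sequentially]) simp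
  show "adic_tendsto m ?s \<xi>"
    unfolding adic_tendsto_def
  proof (intro allI exI impI)
    fix j n :: nat assume "j \<le> n"
    then have "\<bar>m\<bar> ^ j dvd \<bar>m\<bar> ^ n * int n" by (simp add: le_imp_power_dvd dvd_mult2)
    then have "?s n mod \<bar>m\<bar> ^ j = \<xi> n mod \<bar>m\<bar> ^ j" by (simp add: mod_eq_dvd_iff)
    then show "?s n mod \<bar>m\<bar> ^ j = \<xi> j" using Zadic_mod[OF assms(2) \<open>j \<le> n\<close>] by simp
  qed
qed

lemma bs_tilde_digits: "m \<noteq> 0 \<Longrightarrow> bs_tilde \<bar>m\<bar> (digits m \<xi>)"
  by unfold_locales (use digit_bounds[of "\<bar>m\<bar>"] in \<open>simp_all add: digits_def\<close>)

theorem BSbar_eq_act_kernel: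
  assumes m: "m \<noteq> 0" and \<xi>: "\<xi> \<in> Zadic m"
  shows "BSbar m \<xi> = letter_permutation.act_kernel
    (hnn.letter_op (tilde_rep \<bar>m\<bar> (digits m \<xi>)) (tilde_pass \<bar>m\<bar> (digits m \<xi>)) 1)"
proof -
  interpret bs_tilde "\<bar>m\<bar>" "digits m \<xi>" by (rule bs_tilde_digits[OF m])
  have conv: "G2_tendsto (\<lambda>n. BSN m (s n)) act_kernel"
    if s: "filterlim (\<lambda>n. \<bar>s n\<bar>) at_top sequentially" "adic_tendsto m s \<xi>" for s
  proof -
    interpret bs_limit "\<bar>m\<bar>" "digits m \<xi>" "\<lambda>n. sgn m * s n"
      by unfold_locales (rule digits_tendsto_of_adic_tendsto[OF m s \<xi>])
    have "BSN \<bar>m\<bar> (sgn m * s n) = BSN m (s n)" for n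
      using m BSN_uminus[of m "s n"] by (cases "m > 0") auto
    then show ?thesis using G2_tendstoI[of _ act_kernel] eventually_BSN_iff_act_kernel by simp
  qed
  obtain s where s: "filterlim (\<lambda>n. \<bar>s n\<bar>) at_top sequentially" "adic_tendsto m s \<xi>"
    using ex_adic_tendsto[OF assms] by blast
  have sub: "N \<subseteq> carrier FG" if "N \<lhd> FG" for N
    using normal_imp_subgroup[OF that] by (rule subgroup.subset)
  show ?thesis unfolding BSbar_def
  proof (rule the_equality)
    fix N assume "N \<lhd> FG \<and> (\<forall>s. filterlim (\<lambda>n. \<bar>s n\<bar>) at_top sequentially \<and> adic_tendsto m s \<xi> \<longrightarrow>
        G2_tendsto (\<lambda>n. BSN m (s n)) N)"
    then show "N = act_kernel"
      using G2_tendsto_unique[OF _ conv[OF s]] s sub normal_act_kernel by blast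
  qed (use conv normal_act_kernel in blast)
qed

section \<open>Isomorphisms between limit groups\<close>

context bs_tilde
begin

lemma passes_power_degree:
  assumes "passes_power h P Q" "P \<noteq> 0"
  shows "int (degree Q) = int (degree P) + h"
proof -
  have pow: "(P = 0 \<longleftrightarrow> Q = 0) \<and> (P \<noteq> 0 \<longrightarrow> degree Q = degree P + k)" if "(passes ^^ k) P Q" for k P Q
    using that
  proof (induction k arbitrary: Q)
    case (Suc k)
    then obtain R where "(passes ^^ k) P R" "passes R Q" by auto
    then show ?case using Suc.IH[of R] passes_0_iff[of R Q] passes_degree[of R Q] by auto
  qed auto
  show ?thesis
    using assms pow[of "nat h" P Q] pow[of "nat (- h)" Q P]
    by (auto simp: passes_power_def split: if_splits)
qed

lemma height_zero_of_commuting: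
  assumes x: "x \<in> G" and y: "y \<in> G" "height y = 0" "y \<noteq> id" and comm: "x \<circ> y = y \<circ> x"
  shows "height x = 0"
proof (rule ccontr)
  assume nz: "height x \<noteq> 0"
  obtain h q where h: "h \<in> G" "perm_inv h \<circ> y \<circ> h = base_op q"
    and pow: "passes_power (height x) q q"
    using conj_base_op_of_commuting[OF x nz y(1,2) comm] by blast
  have "q \<noteq> 0"
  proof
    assume "q = 0"
    then have "h \<circ> (perm_inv h \<circ> y \<circ> h) \<circ> perm_inv h = h \<circ> perm_inv h"
      by (simp only: h(2) base_op_0 comp_id)
    then have "(h \<circ> perm_inv h) \<circ> y \<circ> (h \<circ> perm_inv h) = h \<circ> perm_inv h" by (simp only: comp_assoc)
    then show False using y(3) unfolding G_comp_inv[OF h(1)] by (simp only: comp_id id_comp)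
  qed
  then show False using passes_power_degree[OF pow] nz by simp
qed

lemma centralizer_base_op_one:
  assumes "M \<noteq> 1" "g \<in> G" "base_op 1 \<circ> g = g \<circ> base_op 1"
  shows "\<exists>q. g = base_op q"
proof (cases "vertex_act g []")
  case Nil
  then show ?thesis using G_stabilizer assms(2) by blast
next
  case (Cons s l)
  obtain e \<rho> where "s = (e, \<rho>)" by (cases s)
  then have "tilde_rep M r e 1 = 0"
    using lmult_fixD(1)[of e \<rho> l 1] lmult_vertex_act[OF assms(2,3)] Cons
      normal_form_vertex_act[OF assms(2), of "[]"] by simp
  then show ?thesis using assms(1) M r_0
    by (cases e) (auto simp: tilde_rep_True tilde_rep_False one_pCons zdvd1_eq)
qed

definition E_basis :: "nat \<Rightarrow> int poly" where
  "E_basis i = (if i = 0 then [:M:] else monom 1 i - [:r i:])"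

lemma passesI:
  "linear_ext r P = M * j \<Longrightarrow> passes P (pCons 0 (P + [:j - coeff P 0:]))"
  using tilde_pass_False[OF M, of r P j] by (simp add: passes_def tilde_rep_False)

lemma passes_E_basis: "passes (E_basis i) (monom 1 (Suc i))"
  using passesI[of "E_basis i" "if i = 0 then 1 else 0"] r_0
  by (auto simp: E_basis_def linear_ext_diff monom_Suc monom_0)

lemma passes_smult:
  assumes "passes P Q"
  shows "passes (smult c P) (smult c Q)"
proof -
  obtain j where j: "linear_ext r P = M * j" using assms by (auto simp: passes_def tilde_rep_False)
  then have "Q = pCons 0 (P + [:j - coeff P 0:])" using assms tilde_pass_False[OF M j]
    by (simp add: passes_def)
  then show ?thesis
    using passesI[of "smult c P" "c * j"] j
    by (simp add: linear_ext_smult smult_add_right algebra_simps)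
qed

end

locale bs_iso = A: bs_tilde M r + B: bs_tilde M' r' for M r M' r' +
  fixes f
  assumes f: "f \<in> iso (act_group A.letter_op) (act_group B.letter_op)"
begin

lemma f_bij: "bij_betw f A.G B.G"
  and f_comp: "g \<in> A.G \<Longrightarrow> h \<in> A.G \<Longrightarrow> f (g \<circ> h) = f g \<circ> f h"
  using f by (auto simp: iso_def hom_def)

lemma f_in_G: "g \<in> A.G \<Longrightarrow> f g \<in> B.G"
  using f_bij by (rule bij_betw_apply)

lemma f_inj: "g \<in> A.G \<Longrightarrow> h \<in> A.G \<Longrightarrow> f g = f h \<Longrightarrow> g = h"
  using f_bij by (auto simp: bij_betw_def inj_on_def)

lemma f_surj: "h \<in> B.G \<Longrightarrow> \<exists>g\<in>A.G. h = f g"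
  using f_bij by (auto simp: bij_betw_def)

lemma f_id: "f id = id"
proof -
  have "f id \<circ> f id = f id" using f_comp[OF A.G_id A.G_id] by (simp only: comp_id)
  then show ?thesis using B.G_inv_comp[OF f_in_G[OF A.G_id]] by (metis comp_assoc id_comp)
qed

lemma f_commute_iff: "g \<in> A.G \<Longrightarrow> h \<in> A.G \<Longrightarrow> f g \<circ> f h = f h \<circ> f g \<longleftrightarrow> g \<circ> h = h \<circ> g"
  using f_comp f_inj A.G_comp by metis

lemma bs_iso_inv: "bs_iso M' r' M r (inv_into A.G f)"
  using group.iso_set_sym[OF A.group_act_group f] by unfold_locales simp

lemma bs_iso_conj:
  assumes h: "h \<in> B.G"
  shows "bs_iso M r M' r' (\<lambda>g. B.perm_inv h \<circ> f g \<circ> h)"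
proof
  note inv = B.G_inv_comp[OF h] B.G_comp_inv[OF h]
  have "bij_betw (\<lambda>g. B.perm_inv h \<circ> g \<circ> h) B.G B.G"
  proof (rule bij_betw_byWitness[where f' = "\<lambda>g. h \<circ> g \<circ> B.perm_inv h"])
    show "\<forall>g\<in>B.G. h \<circ> (B.perm_inv h \<circ> g \<circ> h) \<circ> B.perm_inv h = g"
      "\<forall>g\<in>B.G. B.perm_inv h \<circ> (h \<circ> g \<circ> B.perm_inv h) \<circ> h = g"
      using inv by (metis comp_assoc comp_id id_comp)+
    show "(\<lambda>g. B.perm_inv h \<circ> g \<circ> h) ` B.G \<subseteq> B.G" "(\<lambda>g. h \<circ> g \<circ> B.perm_inv h) ` B.G \<subseteq> B.G"
      using h B.G_inv[OF h] B.G_comp by blast+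
  qed
  then have "(\<lambda>g. B.perm_inv h \<circ> g \<circ> h) \<in> iso (act_group B.letter_op) (act_group B.letter_op)"
    using B.conj_comp[OF h] B.G_comp B.G_inv h by (simp add: iso_def hom_def bij_betw_def)
  from iso_set_trans[OF f this]
  show "(\<lambda>g. B.perm_inv h \<circ> f g \<circ> h) \<in> iso (act_group A.letter_op) (act_group B.letter_op)"
    by (simp only: comp_def)
qed

definition f_a :: "int poly state \<Rightarrow> int poly state" where "f_a = f (A.stable_op True)"
definition f_E :: "int poly \<Rightarrow> int poly state \<Rightarrow> int poly state" where "f_E P = f (A.base_op P)"

lemma f_a_in_G: "f_a \<in> B.G" by (simp only: f_a_def f_in_G A.stable_op_in_G)
lemma f_E_in_G: "f_E P \<in> B.G" by (simp only: f_E_def f_in_G A.base_op_in_G)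

lemma f_E_add: "f_E (P + Q) = f_E P \<circ> f_E Q"
  unfolding f_E_def A.base_op_add by (rule f_comp[OF A.base_op_in_G A.base_op_in_G])

lemma f_E_0: "f_E 0 = id"
  unfolding f_E_def A.base_op_0 by (rule f_id)

lemma f_E_commute: "f_E P \<circ> f_E Q = f_E Q \<circ> f_E P"
  by (simp only: f_E_add[symmetric] add.commute)

lemma f_E_inj: "f_E P = f_E Q \<Longrightarrow> P = Q"
  unfolding f_E_def using f_inj[OF A.base_op_in_G A.base_op_in_G] A.base_op_inj by blast

lemma f_E_funpow: "f_E P ^^ n = f_E (of_nat n * P)"
proof (induction n)
  case 0
  show ?case unfolding funpow.simps of_nat_0 mult_zero_left f_E_0 by (rule refl)
next
  case (Suc n)
  show ?case unfolding funpow.simps Suc f_E_add[symmetric] of_nat_Suc by (simp add: distrib_right)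
qed

lemma f_a_f_E: "A.passes P Q \<Longrightarrow> f_a \<circ> f_E P = f_E Q \<circ> f_a"
proof -
  assume "A.passes P Q"
  then have "A.stable_op True \<circ> A.base_op P = A.base_op Q \<circ> A.stable_op True"
    using A.stable_op_base_op[of True P] by (simp add: A.passes_def)
  then show ?thesis unfolding f_a_def f_E_def using f_comp A.stable_op_in_G A.base_op_in_G by metis
qed

lemma passes_M_X: "A.passes [:M:] [:0, 1:]"
  using A.passes_E_basis[of 0] by (simp add: A.E_basis_def monom_Suc monom_0)

text \<open>The element \<open>e\<^sub>1 - m e\<^sub>0\<close> is mapped to an element of height zero because \<open>e\<^sub>1\<close> and \<open>m e\<^sub>0\<close> are
conjugate.\<close>

lemma height_f_E_one: "B.height (f_E 1) = 0"
proof (rule B.height_zero_of_commuting[OF f_E_in_G f_E_in_G _ _ f_E_commute])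
  let ?Y = "[:- M, 1:]"
  have "f_E [:0, 1:] = f_E ?Y \<circ> f_E [:M:]" by (simp only: f_E_add[symmetric]) simp
  then have "B.height (f_E [:0, 1:]) = B.height (f_E ?Y) + B.height (f_E [:M:])"
    by (simp only: B.height_comp f_E_in_G)
  moreover have "B.height f_a + B.height (f_E [:M:]) = B.height (f_E [:0, 1:]) + B.height f_a"
    using f_a_f_E[OF passes_M_X] B.height_comp f_a_in_G f_E_in_G by metis
  ultimately show "B.height (f_E ?Y) = 0" by simp
  show "f_E ?Y \<noteq> id" using f_E_inj[of ?Y 0] f_E_0 by force
qed

lemma height_f: "g \<in> A.G \<Longrightarrow> B.height (f g) = A.height g * B.height f_a"
proof (induction rule: A.G_induct_op)
  case id
  show ?case unfolding f_id B.height_id A.height_id by (rule mult_zero_left[symmetric])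
next
  case (stable e g)
  have "f (A.stable_op False) \<circ> f_a = id"
    unfolding f_a_def using f_comp[OF A.stable_op_in_G A.stable_op_in_G, of False True]
      A.stable_op_stable_op[of False] f_id by simp
  then have "B.height (f (A.stable_op False)) = - B.height f_a"
    using B.height_comp[OF f_in_G[OF A.stable_op_in_G] f_a_in_G, of False] by simp
  then have "B.height (f (A.stable_op e)) = A.height (A.stable_op e) * B.height f_a"
    by (cases e) (simp_all add: f_a_def)
  then show ?case
    unfolding f_comp[OF A.stable_op_in_G stable(1)] A.height_comp[OF A.stable_op_in_G stable(1)]
      B.height_comp[OF f_in_G[OF A.stable_op_in_G] f_in_G[OF stable(1)]] stable(2)
    by (simp only: distrib_right)
next
  case (base q g)
  have "f_E (- 1) \<circ> f_E 1 = id" by (simp only: f_E_add[symmetric]) (simp add: f_E_0)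
  then have "B.height (f_E (- 1)) = 0"
    using B.height_comp[OF f_E_in_G[of "- 1"] f_E_in_G[of 1]] height_f_E_one by simp
  then have "B.height (f (A.base_op q)) = 0" using base(1) height_f_E_one by (auto simp: f_E_def)
  then show ?case
    unfolding f_comp[OF A.base_op_in_G base(2)] A.height_comp[OF A.base_op_in_G base(2)]
      B.height_comp[OF f_in_G[OF A.base_op_in_G] f_in_G[OF base(2)]] base(3) by simp
qed

lemma height_f_a_nonzero: "B.height f_a \<noteq> 0"
proof
  assume "B.height f_a = 0"
  moreover obtain g where "g \<in> A.G" "B.stable_op True = f g" using f_surj[OF B.stable_op_in_G]
    by blast
  then have "A.height g * B.height f_a = 1" using height_f[of g] B.height_stable_op[of True] by simp
  ultimately show False by simp
qed

text \<open>If \<open>m' = 1\<close>, then \<open>f\<close> maps \<open>b\<close> and \<open>a\<^sup>-\<^sup>1 b a\<close> to elements of height zero, which commute.\<close>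

lemma M_eq_1:
  assumes "M' = 1"
  shows "M = 1"
proof (rule ccontr)
  assume M: "M \<noteq> 1"
  define c where "c = A.perm_inv (A.stable_op True) \<circ> A.base_op 1 \<circ> A.stable_op True"
  have c: "c \<in> A.G" unfolding c_def by (intro A.G_comp A.G_inv A.stable_op_in_G A.base_op_in_G)
  have "A.height c = 0"
    unfolding c_def using A.height_conj[OF A.stable_op_in_G A.base_op_in_G] by simp
  then have height: "B.height (f c) = 0" using height_f[OF c] by simp
  interpret ascending_hnn "tilde_rep M' r'" "tilde_pass M' r'" 1
    by unfold_locales (use assms in \<open>simp add: tilde_rep_False\<close>)
  have "f_E 1 \<circ> f c = f c \<circ> f_E 1"
    by (rule height_zero_commute[OF f_E_in_G height_f_E_one f_in_G[OF c] height])
  then have "A.base_op 1 \<circ> c = c \<circ> A.base_op 1"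
    unfolding f_E_def using f_commute_iff[OF A.base_op_in_G c] by blast
  then obtain q where "c = A.base_op q" using A.centralizer_base_op_one[OF M c] by blast
  then have "A.base_op 1 \<circ> A.stable_op True = A.stable_op True \<circ> A.base_op q"
    using A.G_comp_inv[OF A.stable_op_in_G, of True] unfolding c_def by (metis comp_assoc id_comp)
  from A.lmult_vertex_act[OF A.stable_op_in_G this]
  have "A.lmult 1 [(True, 0)] = [(True, 0)]"
    by (simp add: A.vertex_act_def A.stable_op_def A.push_def)
  then have "tilde_rep M r True 1 = 0" using A.lmult_fixD(1)[of True 0 "[]" 1] by simp
  then show False by (simp add: tilde_rep_True)
qed

lemma ex_conj_into_base: "\<exists>h\<in>B.G. \<exists>Q. B.perm_inv h \<circ> f_E 1 \<circ> h = B.base_op Q"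
proof (rule B.conj_base_op_of_conj_power[OF f_E_in_G height_f_E_one f_a_in_G height_f_a_nonzero
      f_E_in_G f_E_commute])
  show "nat M > 0" using A.M by simp
  have "of_nat (nat M) * 1 = [:M:]" using A.M by (simp add: of_nat_poly)
  then show "f_a \<circ> f_E 1 ^^ nat M = f_E [:0, 1:] \<circ> f_a"
    unfolding f_E_funpow using f_a_f_E[OF passes_M_X] by simp
qed

end

locale bs_iso_based = bs_iso +
  fixes Q
  assumes M_neq_1: "M \<noteq> 1" "M' \<noteq> 1" and f_E_one: "f_E 1 = B.base_op Q"
begin

text \<open>As \<open>E\<close> is the centralizer of \<open>e\<^sub>0\<close> on both sides, \<open>f\<close> restricts to an isomorphism \<open>F\<close> between
the two copies of \<open>E\<close>.\<close>

lemma base_op_eq_f_E: "\<exists>P. f_E P = B.base_op q"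
proof -
  obtain g where g: "g \<in> A.G" "B.base_op q = f g" using f_surj[OF B.base_op_in_G] by blast
  have "f_E 1 \<circ> f g = f g \<circ> f_E 1" unfolding f_E_one g(2)[symmetric] by (rule B.base_op_commute)
  then have "A.base_op 1 \<circ> g = g \<circ> A.base_op 1"
    unfolding f_E_def using f_commute_iff[OF A.base_op_in_G g(1)] by blast
  then obtain P where "g = A.base_op P" using A.centralizer_base_op_one[OF M_neq_1(1) g(1)] by blast
  then show ?thesis using g(2) by (auto simp: f_E_def)
qed

lemma f_E_eq_base_op: "\<exists>q. f_E P = B.base_op q"
proof -
  obtain P1 where "f_E P1 = B.base_op 1" using base_op_eq_f_E by blast
  then have "B.base_op 1 \<circ> f_E P = f_E P \<circ> B.base_op 1" using f_E_commute by metis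
  then show ?thesis using B.centralizer_base_op_one[OF M_neq_1(2) f_E_in_G] by blast
qed

definition F :: "int poly \<Rightarrow> int poly" where "F P = (SOME q. f_E P = B.base_op q)"

lemma f_E_eq: "f_E P = B.base_op (F P)"
  unfolding F_def by (rule someI_ex[OF f_E_eq_base_op])

lemma F_add: "F (P + R) = F P + F R"
  using f_E_add[of P R] unfolding f_E_eq B.base_op_add[symmetric] by (rule B.base_op_inj)

lemma F_0 [simp]: "F 0 = 0"
  using F_add[of 0 0] by simp

lemma F_uminus: "F (- P) = - F P"
  using F_add[of P "- P"] by (simp add: add_eq_0_iff2)

lemma F_diff: "F (P - R) = F P - F R"
  using F_add[of P "- R"] F_uminus[of R] by simp

lemma F_eq_0_iff: "F P = 0 \<longleftrightarrow> P = 0"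
  using f_E_inj[of P 0] f_E_eq[of P] f_E_eq[of 0] by auto

lemma F_surj: "\<exists>P. F P = R"
  using base_op_eq_f_E[of R] f_E_eq B.base_op_inj by metis

lemma F_smult: "F (smult c P) = smult c (F P)"
proof -
  have nat: "F (smult (int n) P) = smult (int n) (F P)" for n
    by (induction n) (simp_all add: smult_add_left F_add)
  show ?thesis
  proof (cases c rule: int_cases2)
    case (nonpos n)
    then show ?thesis using nat[of n] by (simp add: F_uminus)
  qed (use nat in simp)
qed

lemma F_const: "F [:c:] = smult c Q"
proof -
  have "F 1 = Q" using f_E_one f_E_eq[of 1] B.base_op_inj by simp
  then show ?thesis using F_smult[of c 1] by (simp add: one_pCons)
qed

lemma F_passes_power: "A.passes P R \<Longrightarrow> B.passes_power (B.height f_a) (F P) (F R)"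
  using f_a_f_E[of P R] unfolding f_E_eq by (intro B.conj_passes_power[OF f_a_in_G]) (rule sym)

text \<open>A polynomial of positive degree is, up to its constant term, the image under \<open>\<phi>\<close> of one of
smaller degree.\<close>

lemma degree_F_step:
  assumes "degree P = Suc n"
  obtains R where "R \<noteq> 0" "degree R = n"
    "int (degree (F (P - [:coeff P 0:]))) = int (degree (F R)) + B.height f_a"
proof -
  obtain c P' where P: "P = pCons c P'" by (cases P)
  then have P': "P' \<noteq> 0" using assms by auto
  then have deg: "degree (pCons 0 P') = Suc n" using assms P by simp
  let ?R = "tilde_pass M r True (pCons 0 P')"
  have R: "A.passes ?R (pCons 0 P')" by (simp add: A.passes_iff_True tilde_rep_True)
  have R0: "?R \<noteq> 0" using A.passes_0_iff[OF R] P' by simp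
  have "degree ?R = n" using A.passes_degree[OF R R0] deg by simp
  moreover have "P - [:coeff P 0:] = pCons 0 P'" by (simp add: P)
  then have "int (degree (F (P - [:coeff P 0:]))) = int (degree (F ?R)) + B.height f_a"
    using B.passes_power_degree[OF F_passes_power[OF R]] F_eq_0_iff R0 by simp
  ultimately show thesis using R0 that by blast
qed

lemma F_split_const: "F P = F (P - [:coeff P 0:]) + smult (coeff P 0) Q"
  using F_add[of "P - [:coeff P 0:]" "[:coeff P 0:]"] by (simp add: F_const)

lemma degree_F_le: "B.height f_a \<le> 0 \<Longrightarrow> degree (F P) \<le> degree Q"
proof (induction "degree P" arbitrary: P)
  case 0
  then obtain c where "P = [:c:]" by (metis degree_eq_zeroE)
  then show ?case by (simp add: F_const)
next
  case (Suc n)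
  obtain R where "degree R = n"
    "int (degree (F (P - [:coeff P 0:]))) = int (degree (F R)) + B.height f_a"
    using degree_F_step[of P n] Suc.hyps(2) by metis
  then have "degree (F (P - [:coeff P 0:])) \<le> degree Q" using Suc.hyps(1)[of R] Suc.prems by simp
  then show ?case unfolding F_split_const[of P] by (simp add: degree_add_le degree_smult_le)
qed

lemma height_f_a_pos: "B.height f_a > 0"
proof (rule ccontr)
  assume "\<not> B.height f_a > 0"
  moreover obtain P where "F P = monom 1 (Suc (degree Q))" using F_surj by blast
  ultimately show False using degree_F_le[of P] by (simp add: degree_monom_eq)
qed

lemma degree_F: "P \<noteq> 0 \<Longrightarrow> int (degree (F P)) = int (degree Q) + B.height f_a * int (degree P)"
proof (induction "degree P" arbitrary: P)
  case 0
  then obtain c where "P = [:c:]" "c \<noteq> 0" by (metis degree_eq_zeroE pCons_0_0)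
  then show ?case by (simp add: F_const)
next
  case (Suc n)
  let ?P = "P - [:coeff P 0:]"
  obtain R where R: "R \<noteq> 0" "degree R = n" "int (degree (F ?P)) = int (degree (F R)) + B.height f_a"
    using degree_F_step[of P n] Suc.hyps(2) by metis
  then have deg: "int (degree (F ?P)) = int (degree Q) + B.height f_a * int (degree P)"
    using Suc.hyps(1)[of R] Suc.hyps(2)[symmetric] by (simp add: algebra_simps)
  moreover have "B.height f_a * int (degree P) > 0" using height_f_a_pos Suc.hyps(2) by simp
  ultimately have "degree Q < degree (F ?P)" by linarith
  then have "degree (smult (coeff P 0) Q) < degree (F ?P)"
    by (rule le_less_trans[OF degree_smult_le])
  then show ?case unfolding F_split_const[of P] using deg by (simp add: degree_add_eq_left)
qed

lemma Q_unit: "\<exists>q\<in>{1, - 1}. Q = [:q:]"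
proof -
  obtain P where P: "F P = 1" using F_surj by blast
  then have "P \<noteq> 0" by auto
  from degree_F[OF this] P have "int (degree Q) + B.height f_a * int (degree P) = 0" by simp
  moreover have "B.height f_a * int (degree P) \<ge> 0" using height_f_a_pos by simp
  ultimately have "degree Q = 0" "B.height f_a * int (degree P) = 0" by linarith+
  then have "degree Q = 0" "degree P = 0" using height_f_a_pos by auto
  then obtain q p where qp: "Q = [:q:]" "P = [:p:]" by (meson degree_eq_zeroE)
  then have "p * q = 1" using P by (simp add: F_const one_pCons)
  then have "q = 1 \<or> q = - 1" using zmult_eq_1_iff by blast
  then show ?thesis using qp by blast
qed

lemma height_f_a_eq_1: "B.height f_a = 1"
proof -
  obtain P where P: "F P = monom 1 1" using F_surj by blast
  then have "P \<noteq> 0" by auto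
  moreover have "degree Q = 0" using Q_unit by auto
  ultimately have "B.height f_a * int (degree P) = 1" using degree_F[of P] P
    by (simp add: degree_monom_eq)
  then show ?thesis using height_f_a_pos zmult_eq_1_iff by auto
qed

lemma F_passes: "A.passes P R \<Longrightarrow> B.passes (F P) (F R)"
  using F_passes_power by (simp add: height_f_a_eq_1 B.passes_power_1)

lemma M'_dvd_M: "M' dvd M"
proof -
  obtain q where q: "Q = [:q:]" "q \<in> {1, - 1}" using Q_unit by blast
  have "M' dvd linear_ext r' (F [:M:])"
    using F_passes[OF passes_M_X] by (simp add: B.passes_def tilde_rep_False)
  then show ?thesis using q B.r_0 by (auto simp: F_const)
qed

lemma F_E_basis: "i > 0 \<Longrightarrow> F (A.E_basis i) = F (monom 1 i) - smult (r i) Q"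
  by (simp add: A.E_basis_def F_diff F_const)

lemma digit_eq_of_F_monom:
  assumes "M = M'" "i > 0" and q: "Q = [:q:]" "q \<in> {1, - 1}"
    and F: "F (monom 1 i) = smult q (monom 1 i)"
  shows "r i = r' i"
proof -
  have "M' dvd linear_ext r' (F (A.E_basis i))"
    using F_passes[OF A.passes_E_basis] by (simp add: B.passes_def tilde_rep_False)
  also have "linear_ext r' (F (A.E_basis i)) = q * (r' i - r i)"
    using F B.r_0 q(1) assms(2)
    by (simp add: F_E_basis linear_ext_diff linear_ext_smult algebra_simps)
  finally have "M dvd r' i - r i" using q(2) assms(1) by (auto simp: dvd_diff_commute)
  then have "r' i mod M = r i mod M" by (simp add: mod_eq_dvd_iff)
  then show ?thesis using A.r_bounds[OF assms(2)] B.r_bounds[OF assms(2)] assms(1) by simp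
qed

lemma F_monom:
  assumes "M = M'" and q: "Q = [:q:]" "q \<in> {1, - 1}"
  shows "F (monom 1 i) = smult q (monom 1 i)"
proof (induction i)
  case 0
  then show ?case using F_const[of 1] q(1) by (simp add: monom_0)
next
  case (Suc i)
  have "F (A.E_basis i) = smult q (B.E_basis i)"
  proof (cases "i = 0")
    case True
    then have "F (A.E_basis i) = smult M Q" by (simp add: A.E_basis_def F_const)
    also have "\<dots> = smult q (B.E_basis i)" using True assms(1) q(1) by (simp add: B.E_basis_def)
    finally show ?thesis .
  next
    case False
    then show ?thesis
      using digit_eq_of_F_monom[OF assms(1) _ q Suc] F_E_basis[of i] Suc q(1)
      by (simp add: B.E_basis_def smult_diff_right)
  qed
  then show ?case
    using F_passes[OF A.passes_E_basis] B.passes_smult[OF B.passes_E_basis] B.passes_fun by metis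
qed

lemma digits_eq: "M = M' \<Longrightarrow> i > 0 \<Longrightarrow> r i = r' i"
  using Q_unit digit_eq_of_F_monom F_monom by blast

end

lemma (in bs_iso) M'_dvd_M_and_digits_eq:
  assumes "M \<noteq> 1" "M' \<noteq> 1"
  shows "M' dvd M" "M = M' \<Longrightarrow> i > 0 \<Longrightarrow> r i = r' i"
proof -
  obtain h Q where h: "h \<in> B.G" "B.perm_inv h \<circ> f_E 1 \<circ> h = B.base_op Q" using ex_conj_into_base
    by blast
  interpret conj: bs_iso M r M' r' "\<lambda>g. B.perm_inv h \<circ> f g \<circ> h" by (rule bs_iso_conj[OF h(1)])
  interpret conj: bs_iso_based M r M' r' "\<lambda>g. B.perm_inv h \<circ> f g \<circ> h" Q
    by unfold_locales (use assms h(2) in \<open>simp_all add: conj.f_E_def f_E_def\<close>)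
  show "M' dvd M" "M = M' \<Longrightarrow> i > 0 \<Longrightarrow> r i = r' i"
    by (rule conj.M'_dvd_M, rule conj.digits_eq)
qed

theorem (in bs_iso) iso_imp_eq: "M = M' \<and> r = r'"
proof (cases "M = 1 \<or> M' = 1")
  case True
  interpret inv: bs_iso M' r' M r "inv_into A.G f" by (rule bs_iso_inv)
  have M: "M = 1" "M' = 1" using True M_eq_1 inv.M_eq_1 by auto
  moreover have "r i = r' i" for i
    using A.r_bounds[of i] B.r_bounds[of i] A.r_0 B.r_0 M by (cases i) auto
  ultimately show ?thesis by blast
next
  case False
  interpret inv: bs_iso M' r' M r "inv_into A.G f" by (rule bs_iso_inv)
  have "M' dvd M" "M dvd M'" using M'_dvd_M_and_digits_eq(1) inv.M'_dvd_M_and_digits_eq(1) False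
    by auto
  then have "M = M'" using A.M B.M by (intro zdvd_antisym_nonneg) auto
  moreover have "r i = r' i" for i
    using M'_dvd_M_and_digits_eq(2)[OF _ _ \<open>M = M'\<close>, of i] False A.r_0 B.r_0 by (cases i) auto
  ultimately show ?thesis by blast
qed

theorem FG_Mod_BSbar_iso_iff:
  assumes m: "m \<noteq> 0" "m' \<noteq> 0" and \<xi>: "\<xi> \<in> Zadic m" "\<xi>' \<in> Zadic m'"
  shows "(FG Mod BSbar m \<xi>) \<cong> (FG Mod BSbar m' \<xi>') \<longleftrightarrow> \<bar>m\<bar> = \<bar>m'\<bar> \<and> digits m \<xi> = digits m' \<xi>'"
proof
  interpret A: bs_tilde "\<bar>m\<bar>" "digits m \<xi>" by (rule bs_tilde_digits[OF m(1)])
  interpret B: bs_tilde "\<bar>m'\<bar>" "digits m' \<xi>'" by (rule bs_tilde_digits[OF m(2)])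
  note BSbar = BSbar_eq_act_kernel[OF m(1) \<xi>(1)] BSbar_eq_act_kernel[OF m(2) \<xi>(2)]
  assume "FG Mod BSbar m \<xi> \<cong> FG Mod BSbar m' \<xi>'"
  then have "act_group A.letter_op \<cong> act_group B.letter_op"
    unfolding BSbar using A.FG_Mod_act_kernel B.FG_Mod_act_kernel
    by (meson group.iso_sym iso_trans normal.factorgroup_is_group[OF A.normal_act_kernel])
  then obtain f where "f \<in> iso (act_group A.letter_op) (act_group B.letter_op)"
    by (auto simp: is_iso_def)
  then interpret bs_iso "\<bar>m\<bar>" "digits m \<xi>" "\<bar>m'\<bar>" "digits m' \<xi>'" f
    by unfold_locales
  show "\<bar>m\<bar> = \<bar>m'\<bar> \<and> digits m \<xi> = digits m' \<xi>'" by (rule iso_imp_eq)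
next
  assume "\<bar>m\<bar> = \<bar>m'\<bar> \<and> digits m \<xi> = digits m' \<xi>'"
  then have "BSbar m \<xi> = BSbar m' \<xi>'"
    unfolding BSbar_eq_act_kernel[OF m(1) \<xi>(1)] BSbar_eq_act_kernel[OF m(2) \<xi>(2)] by simp
  then show "FG Mod BSbar m \<xi> \<cong> FG Mod BSbar m' \<xi>'" by (simp add: iso_refl)
qed

theorem theoremC:
  fixes m m' :: int and \<xi> \<xi>' :: "nat \<Rightarrow> int"
  assumes "m \<noteq> 0" and "m' \<noteq> 0" and "\<xi> \<in> Zadic m" and "\<xi>' \<in> Zadic m'"
  shows "(FG Mod BSbar m \<xi>) \<cong> (FG Mod BSbar m' \<xi>') \<longleftrightarrow>
    (\<exists>\<epsilon> \<in> {1, -1 :: int}. \<exists>d :: int. d > 0 \<and> m = \<epsilon> * m' \<and>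
       d = adic_gcd m m \<xi> \<and> d = adic_gcd m' m' \<xi>' \<and>
       adic_proj (m div d) (adic_div m \<xi> d) =
       adic_proj (m div d) (adic_div m (adic_smul m \<epsilon> \<xi>') d))"
  unfolding FG_Mod_BSbar_iso_iff[OF assms] adic_condition_iff_digits_eq[OF assms] by (rule refl)

end
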